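(* For $u\in\mathbb Q\setminus\{0\}$ let $g_u(x)\in\mathbb Q[x]$ be the polynomial $$\begin{aligned} g_u(x)=\;& x^6-\dfrac{16u}{u^5+8}\,x^5-\dfrac{u^{15}+40u^{10}+128u^5+512}{2u^3(u^5+8)^2}\,x^4+\dfrac{6u^{15}+224u^{10}+1536u^5+3072}{u^2(u^5+8)^3}\,x^3\\ &+\dfrac{u^{30}+112u^{25}+2880u^{20}+25600u^{15}+106496u^{10}+262144u^5+262144}{16u^6(u^5+8)^4}\,x^2\\ &-\dfrac{u^{25}+80u^{20}+1664u^{15}+12288u^{10}+36864u^5+32768}{2u^5(u^5+8)^4}\,x\\ &-\dfrac{u^{25}+46u^{20}+736u^{15}+5248u^{10}+18432u^5+24576}{2u^4(u^5+8)^4}, \end{aligned}$$ and let $\mathcal G_u$ be the smooth projective curve of affine equation $y^2=g_u(x)$. For $t\in\mathbb Q$ let $\mathcal F_t$ be the curve of affine equation $y^2=f_t(x)$, where $$f_t(x)=x^6+2x^5+(2t+3)x^4+2x^3+(t^2+1)x^2+2t(1-t)x+t^2 .$$ Then for each $u\in\mathbb Q\setminus\{0\}$ the divisor at infinity of the Jacobian of $\mathcal G_u$ has order $11$. Moreover, there are infinitely many pairwise non-isomorphic curves among the $\mathcal G_u$, and none of the $\mathcal G_u$ is isomorphic to any of the curves $\mathcal F_t$, $t\in\mathbb Q$.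
   Context: For a curve $\mathcal C$ that is the smooth projective model of $y^2=f(x)$ with $f$ of even degree and leading coefficient a nonzero square in the base field, there are two points at infinity $P,Q$ (both rational over the base field). The divisor at infinity is $D_\infty=P-Q$, regarded as an element of the Jacobian $\mathrm{Jac}(\mathcal C)$, the group of degree-zero divisors of $\mathcal C$ modulo principal divisors. "The divisor at infinity has order $N$" means that the class of $D_\infty$ in $\mathrm{Jac}(\mathcal C)$ has order exactly $N$. Isomorphism of curves is understood over the algebraic closure $\overline{\mathbb Q}$ (isomorphism classes of genus two curves are those distinguished by the Igusa invariants). The family $\mathcal F_t$ is Flynn's one-parameter family. *)

theory Defs
  imports
    "HOL-Analysis.Abstract_Topology"
    "HOL-Algebra.Free_Abelian_Groups"
    "HOL-Algebra.Multiplicative_Group"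
    "HOL-Algebra.Algebraic_Closure_Type"
begin

section \<open>The projective model of \<open>y^2 = f(x)\<close>\<close>

text \<open>
  Let \<open>f\<close> have even degree \<open>2m\<close> over an algebraically closed field. The projective model of
  \<open>y^2 = f(x)\<close> is the curve in the weighted projective plane \<open>P(1,m,1)\<close>, glued from the two
  affine plane curves \<open>y^2 = f(x)\<close> and \<open>w^2 = z^(2m) f(1/z)\<close> along \<open>z = 1/x\<close>, \<open>w = y/x^m\<close>.
  It is smooth exactly when \<open>f\<close> is squarefree. \<open>Affine a b\<close> is the point with \<open>(x,y) = (a,b)\<close>,
  and \<open>Infinity c\<close> is the point at infinity with \<open>(z,w) = (0,c)\<close>.
\<close>

datatype 'a point = Affine 'a 'a | Infinity 'a

definition curve :: "'a::alg_closed_field poly \<Rightarrow> 'a point set" where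
  "curve f = {Affine a b | a b. b ^ 2 = poly f a} \<union> {Infinity c | c. c ^ 2 = lead_coeff f}"

text \<open>
  Bivariate polynomials are polynomials in the second coordinate whose coefficients are
  polynomials in the first one.
\<close>

definition eval2 :: "'a::comm_ring_1 poly poly \<Rightarrow> 'a \<Rightarrow> 'a \<Rightarrow> 'a" where
  "eval2 p a b = poly (poly p [:b:]) a"

datatype chart = XY_Chart | ZW_Chart

text \<open>
  The value of a polynomial in the coordinates of a chart. The value is 0 at points outside the
  chart, so that the nonvanishing locus of a polynomial always lies inside the chart.
\<close>

fun chart_eval :: "nat \<Rightarrow> chart \<Rightarrow> 'a::field poly poly \<Rightarrow> 'a point \<Rightarrow> 'a" where
  "chart_eval m XY_Chart p (Affine a b) = eval2 p a b"
| "chart_eval m XY_Chart p (Infinity c) = 0"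
| "chart_eval m ZW_Chart p (Affine a b) = (if a = 0 then 0 else eval2 p (1 / a) (b / a ^ m))"
| "chart_eval m ZW_Chart p (Infinity c) = eval2 p 0 c"

definition basic_open :: "'a::alg_closed_field poly \<Rightarrow> chart \<Rightarrow> 'a poly poly \<Rightarrow> 'a point set" where
  "basic_open f ch q = {P \<in> curve f. chart_eval (degree f div 2) ch q P \<noteq> 0}"

definition zariski :: "'a::alg_closed_field poly \<Rightarrow> 'a point topology" where
  "zariski f = topology_generated_by {basic_open f ch q | ch q. True}"

lemma topspace_zariski: "topspace (zariski f) = curve f"
proof
  show "topspace (zariski f) \<subseteq> curve f"
    by (simp add: zariski_def Sup_le_iff) (auto simp: basic_open_def)
  show "curve f \<subseteq> topspace (zariski f)"
  proof
    fix P assume P: "P \<in> curve f"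
    obtain ch where "P \<in> basic_open f ch 1"
    proof (cases P)
      case (Affine a b)
      with P have "P \<in> basic_open f XY_Chart 1"
        by (simp add: basic_open_def eval2_def)
      then show ?thesis by (rule that)
    next
      case (Infinity c)
      with P have "P \<in> basic_open f ZW_Chart 1"
        by (simp add: basic_open_def eval2_def)
      then show ?thesis by (rule that)
    qed
    then have "\<exists>B\<in>{basic_open f ch q | ch q. True}. P \<in> B"
      by blast
    then show "P \<in> topspace (zariski f)"
      by (simp add: zariski_def)
  qed
qed

text \<open>The structure sheaf: functions that are locally quotients of polynomials in a chart.\<close>

definition regular_on ::
    "'a::alg_closed_field poly \<Rightarrow> 'a point set \<Rightarrow> ('a point \<Rightarrow> 'a) \<Rightarrow> bool" where
  "regular_on f U h \<longleftrightarrow> openin (zariski f) U \<and>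
     (\<forall>P\<in>U. \<exists>ch p q. P \<in> basic_open f ch q \<and>
        (\<forall>Q \<in> U \<inter> basic_open f ch q.
           h Q = chart_eval (degree f div 2) ch p Q / chart_eval (degree f div 2) ch q Q))"

text \<open>
  Isomorphism of varieties over the algebraically closed ground field: a homeomorphism that
  identifies the regular functions on corresponding open sets.
\<close>

definition isomorphic_curves ::
    "'a::alg_closed_field poly \<Rightarrow> 'a poly \<Rightarrow> bool" where
  "isomorphic_curves f g \<longleftrightarrow>
     (\<exists>\<phi>. homeomorphic_map (zariski f) (zariski g) \<phi> \<and>
        (\<forall>V h. openin (zariski g) V \<longrightarrow>
           (regular_on g V h \<longleftrightarrow> regular_on f {P \<in> curve f. \<phi> P \<in> V} (h \<circ> \<phi>))))"


section \<open>The Jacobian\<close>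

text \<open>
  From here on \<open>f\<close> is meant to be squarefree of even positive degree, so that the curve is
  smooth and irreducible.
\<close>

text \<open>\<open>t\<close> generates the maximal ideal of the local ring at \<open>P\<close>.\<close>

definition uniformizer ::
    "'a::alg_closed_field poly \<Rightarrow> 'a point \<Rightarrow> ('a point \<Rightarrow> 'a) \<Rightarrow> bool" where
  "uniformizer f P t \<longleftrightarrow>
     (\<exists>U. P \<in> U \<and> regular_on f U t) \<and> t P = 0 \<and>
     (\<forall>V s. P \<in> V \<and> regular_on f V s \<and> s P = 0 \<longrightarrow>
        (\<exists>W r. P \<in> W \<and> W \<subseteq> V \<and> regular_on f W r \<and> (\<forall>Q\<in>W. s Q = t Q * r Q)))"

text \<open>
  A rational function is given by a regular function \<open>h\<close> on a nonempty open set \<open>U\<close>, which is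
  dense; \<open>P\<close> need not belong to \<open>U\<close>. It has order \<open>n\<close> at \<open>P\<close> if it is a unit of the local
  ring at \<open>P\<close> times the \<open>n\<close>-th power of a uniformizer.
\<close>

definition has_order_at ::
    "'a::alg_closed_field poly \<Rightarrow> 'a point set \<Rightarrow> ('a point \<Rightarrow> 'a) \<Rightarrow> 'a point \<Rightarrow> int \<Rightarrow> bool"
  where
  "has_order_at f U h P n \<longleftrightarrow>
     (\<exists>V t e. P \<in> V \<and> uniformizer f P t \<and> regular_on f V t \<and>
        regular_on f V e \<and> (\<forall>Q\<in>V. e Q \<noteq> 0) \<and>
        (\<forall>Q \<in> U \<inter> V - {P}. h Q = e Q * t Q powi n))"

definition principal_divisor :: "'a::alg_closed_field poly \<Rightarrow> ('a point \<Rightarrow>\<^sub>0 int) \<Rightarrow> bool" where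
  "principal_divisor f D \<longleftrightarrow> Poly_Mapping.keys D \<subseteq> curve f \<and>
     (\<exists>U h. regular_on f U h \<and> (\<exists>Q\<in>U. h Q \<noteq> 0) \<and>
        (\<forall>P\<in>curve f. has_order_at f U h P (Poly_Mapping.lookup D P)))"

definition divisor_degree :: "('a point \<Rightarrow>\<^sub>0 int) \<Rightarrow> int" where
  "divisor_degree D = (\<Sum>P\<in>Poly_Mapping.keys D. Poly_Mapping.lookup D P)"

definition degree_zero_divisors ::
    "'a::alg_closed_field poly \<Rightarrow> ('a point \<Rightarrow>\<^sub>0 int) monoid" where
  "degree_zero_divisors f = (free_Abelian_group (curve f))
     \<lparr>carrier := {D \<in> carrier (free_Abelian_group (curve f)). divisor_degree D = 0}\<rparr>"

definition principal_divisors :: "'a::alg_closed_field poly \<Rightarrow> ('a point \<Rightarrow>\<^sub>0 int) set" where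
  "principal_divisors f = {D \<in> carrier (degree_zero_divisors f). principal_divisor f D}"

definition jacobian :: "'a::alg_closed_field poly \<Rightarrow> ('a point \<Rightarrow>\<^sub>0 int) set monoid" where
  "jacobian f = degree_zero_divisors f Mod principal_divisors f"

definition divisor_class ::
    "'a::alg_closed_field poly \<Rightarrow> ('a point \<Rightarrow>\<^sub>0 int) \<Rightarrow> ('a point \<Rightarrow>\<^sub>0 int) set" where
  "divisor_class f D = principal_divisors f #>\<^bsub>degree_zero_divisors f\<^esub> D"

text \<open>For monic \<open>f\<close> of even degree the two points at infinity have \<open>w = 1\<close> and \<open>w = -1\<close>.\<close>

definition divisor_at_infinity :: "'a::alg_closed_field point \<Rightarrow>\<^sub>0 int" where
  "divisor_at_infinity = frag_of (Infinity 1) - frag_of (Infinity (- 1))"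


section \<open>The two families\<close>

definition g_poly :: "rat \<Rightarrow> rat poly" where
  "g_poly u =
     [: - ((u^25 + 46 * u^20 + 736 * u^15 + 5248 * u^10 + 18432 * u^5 + 24576)
           / (2 * u^4 * (u^5 + 8)^4)),
        - ((u^25 + 80 * u^20 + 1664 * u^15 + 12288 * u^10 + 36864 * u^5 + 32768)
           / (2 * u^5 * (u^5 + 8)^4)),
        (u^30 + 112 * u^25 + 2880 * u^20 + 25600 * u^15 + 106496 * u^10 + 262144 * u^5 + 262144)
           / (16 * u^6 * (u^5 + 8)^4),
        (6 * u^15 + 224 * u^10 + 1536 * u^5 + 3072) / (u^2 * (u^5 + 8)^3),
        - ((u^15 + 40 * u^10 + 128 * u^5 + 512) / (2 * u^3 * (u^5 + 8)^2)),
        - (16 * u / (u^5 + 8)),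
        1 :]"

definition f_poly :: "rat \<Rightarrow> rat poly" where
  "f_poly t = [: t^2, 2 * t * (1 - t), t^2 + 1, 2, 2 * t + 3, 2, 1 :]"

text \<open>Base change of the defining polynomials to the algebraic closure of the rationals.\<close>

definition G_curve :: "rat \<Rightarrow> rat alg_closure poly" where
  "G_curve u = map_poly to_ac (g_poly u)"

definition F_curve :: "rat \<Rightarrow> rat alg_closure poly" where
  "F_curve t = map_poly to_ac (f_poly t)"

end

(*
A solution of the Pell equation A^2 - g B^2 = c with deg A = 11 makes A + B y a unit of the affine
coordinate ring of y^2 = g, with divisor 11 (P - Q) up to sign; it comes from the continued fraction
of sqrt g, which depends on u only through v = u^5 after the substitution x = u X. Since 11 is prime,
it remains to see that P - Q is not principal: the coordinate ring is integrally closed, so a function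
regular on the affine part is A + B y, and a single pole at infinity is impossible in genus two.

An isomorphism of two such curves descends to a Moebius map between the sets of branch points. This is
read off from the pull-back of 1/(x - c), a function with two simple poles, without the canonical
divisor. Hence the invariants of the two binary sextics agree up to weighted scaling. On G_u the
absolute invariants are rational functions of v. The 11-adic valuation of one of them separates the
values u = 11^k. An isomorphism between G_u and F_t equates two absolute invariants, and the resulting
system has no solution modulo 11, where v = u^5 can only be 0, 1, -1 or infinity.
*)

theory Submission
  imports Defs "HOL-Number_Theory.Cong"
begin

section \<open>Regular functions in charts\<close>

text \<open>A rational function has arbitrary values outside its domain, and its order at a point is
  tested away from that point. Nonempty open sets of the curves in question are cofinite, so
  functions are compared modulo finite sets throughout, and a germ is one quotient of expressions
  \<open>A + B y\<close>.

  \<open>F_curve t\<close> may be singular, so the target of an isomorphism is only taken to be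
  monic of even degree. The homeomorphism carries the cofinite topology over, and
  \<open>x - c\<close> is still a local parameter where \<open>y\<close> is nonzero; the Moebius
  argument uses nothing else about the target. The genus enters through the pole of order
  \<open>m\<close> of \<open>y\<close> at infinity: functions with smaller poles there and none
  elsewhere are polynomials in \<open>x\<close>.

  One relation between absolute invariants would only be a plane curve in \<open>v\<close> and
  \<open>t\<close>, so comparing the two families takes two of them. The modulus 11 is chosen
  because 5 divides 11 - 1 with quotient 2; it has nothing to do with the torsion order 11.\<close>

fun in_chart :: "chart \<Rightarrow> 'a::field point \<Rightarrow> bool" where
  "in_chart XY_Chart (Affine a b) = True"
| "in_chart XY_Chart (Infinity c) = False"
| "in_chart ZW_Chart (Affine a b) = (a \<noteq> 0)"
| "in_chart ZW_Chart (Infinity c) = True"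

fun fst_coord :: "chart \<Rightarrow> 'a::field point \<Rightarrow> 'a" where
  "fst_coord XY_Chart (Affine a b) = a"
| "fst_coord XY_Chart (Infinity c) = 0"
| "fst_coord ZW_Chart (Affine a b) = 1 / a"
| "fst_coord ZW_Chart (Infinity c) = 0"

fun snd_coord :: "nat \<Rightarrow> chart \<Rightarrow> 'a::field point \<Rightarrow> 'a" where
  "snd_coord m XY_Chart (Affine a b) = b"
| "snd_coord m XY_Chart (Infinity c) = 0"
| "snd_coord m ZW_Chart (Affine a b) = b / a ^ m"
| "snd_coord m ZW_Chart (Infinity c) = c"

definition chart_poly :: "chart \<Rightarrow> 'a::field poly \<Rightarrow> 'a poly" where
  "chart_poly ch f = (case ch of XY_Chart \<Rightarrow> f | ZW_Chart \<Rightarrow> reflect_poly f)"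

lemma chart_eval_eq:
  "chart_eval m ch p P = (if in_chart ch P then eval2 p (fst_coord ch P) (snd_coord m ch P) else 0)"
  by (cases ch; cases P) auto

lemma point_eq_in_chart:
  assumes "in_chart ch P" "in_chart ch Q"
    "fst_coord ch P = fst_coord ch Q" "snd_coord m ch P = snd_coord m ch Q"
    "P \<in> curve f" "Q \<in> curve f"
  shows "P = Q"
  using assms by (cases ch; cases P; cases Q) auto

text \<open>Horner's scheme modulo \<open>y^2 = F\<close>: multiplying \<open>A + B y\<close> by
  \<open>y\<close> gives \<open>B F + A y\<close>, so every chart polynomial has a normal form
  linear in \<open>y\<close>.\<close>

lemma eval2_on_curve:
  fixes p :: "'a::comm_ring_1 poly poly"
  shows "\<exists>A B. \<forall>a b. b ^ 2 = poly F a \<longrightarrow> eval2 p a b = poly A a + poly B a * b"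
proof (induction p)
  case 0
  show ?case by (rule exI[of _ 0], rule exI[of _ 0]) (simp add: eval2_def)
next
  case (pCons c p)
  then obtain A B where AB: "\<And>a b. b ^ 2 = poly F a \<Longrightarrow> eval2 p a b = poly A a + poly B a * b"
    by blast
  have "eval2 (pCons c p) a b = poly (c + B * F) a + poly A a * b" if "b ^ 2 = poly F a" for a b
    using AB[OF that] that[symmetric] by (simp add: eval2_def algebra_simps power2_eq_square)
  then show ?case by blast
qed

definition lin :: "nat \<Rightarrow> 'a::field poly \<Rightarrow> 'a poly \<Rightarrow> chart \<Rightarrow> 'a point \<Rightarrow> 'a" where
  "lin m A B ch P = poly A (fst_coord ch P) + poly B (fst_coord ch P) * snd_coord m ch P"

lemma eval2_linear: "eval2 [:A, B:] a b = poly A a + poly B a * b"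
  by (simp add: eval2_def)

lemma chart_eval_linear: "in_chart ch P \<Longrightarrow> chart_eval m ch [:A, B:] P = lin m A B ch P"
  by (simp add: chart_eval_eq eval2_linear lin_def)

text \<open>One quotient must represent \<open>h\<close> wherever its denominator is nonzero, so
  regularity at a point carries no open set. With cofinite open sets this agrees with
  \<open>regular_on\<close>, since finitely many bad points can be absorbed into the
  denominator.\<close>

definition reg_at :: "'a::alg_closed_field poly \<Rightarrow> chart \<Rightarrow> ('a point \<Rightarrow> 'a) \<Rightarrow> 'a point \<Rightarrow> bool" where
  "reg_at f ch h P \<longleftrightarrow> in_chart ch P \<and> (\<exists>A B C D. lin (degree f div 2) C D ch P \<noteq> 0 \<and>
     (\<forall>Q\<in>curve f. in_chart ch Q \<longrightarrow> lin (degree f div 2) C D ch Q \<noteq> 0 \<longrightarrow>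
        h Q = lin (degree f div 2) A B ch Q / lin (degree f div 2) C D ch Q))"

lemma poly_inverse_arg:
  fixes A :: "'a::field poly"
  shows "x \<noteq> 0 \<Longrightarrow> poly A (1 / x) = poly (reflect_poly A) x / x ^ degree A"
  by (simp add: poly_reflect_poly_nz inverse_eq_divide)

text \<open>The class includes singular models, because the target of an isomorphism may a priori be
  a singular member of the second family.\<close>

locale even_curve =
  fixes f :: "'a::{alg_closed_field, field_char_0} poly" and m :: nat
  assumes degree_f: "degree f = 2 * m" and m_pos: "m > 0" and monic: "lead_coeff f = 1"
begin

lemma m_eq: "degree f div 2 = m"
  using degree_f by simp

lemma snd_coord_sq:
  assumes "P \<in> curve f" "in_chart ch P"
  shows "snd_coord m ch P ^ 2 = poly (chart_poly ch f) (fst_coord ch P)"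
proof (cases ch)
  case XY_Chart
  with assms show ?thesis by (cases P) (auto simp: curve_def chart_poly_def)
next
  case ZW_Chart
  show ?thesis
  proof (cases P)
    case (Affine a b)
    with assms ZW_Chart have "a \<noteq> 0" "b ^ 2 = poly f a" by (auto simp: curve_def)
    then show ?thesis using Affine ZW_Chart
      by (simp add: chart_poly_def poly_reflect_poly_nz degree_f power_divide field_simps
          flip: power_mult)
  next
    case (Infinity c)
    with assms ZW_Chart show ?thesis by (auto simp: curve_def chart_poly_def poly_reflect_poly_0)
  qed
qed

lemma curve_infinity: "Infinity c \<in> curve f \<longleftrightarrow> c = 1 \<or> c = -1"
  using monic by (auto simp: curve_def power2_eq_1_iff)

lemma ex_chart: obtains ch where "in_chart ch P"
  by (cases P) (use in_chart.simps in blast)+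

lemma chart_change:
  assumes "in_chart ch P" "in_chart ch' P" "ch \<noteq> ch'"
  shows "fst_coord ch P \<noteq> 0" "fst_coord ch' P = 1 / fst_coord ch P"
    "snd_coord m ch' P = snd_coord m ch P / fst_coord ch P ^ m"
  using assms by (cases ch; cases ch'; cases P; simp add: field_simps)+

lemma in_chart_change:
  assumes "in_chart ch P" "fst_coord ch P \<noteq> 0"
  shows "in_chart ch' P"
  using assms by (cases ch; cases ch'; cases P) auto

text \<open>The exponents clear denominators: \<open>A(1/z)\<close>, \<open>B(1/z)\<close> and
  \<open>w/z^m\<close> contribute \<open>degree A\<close>, \<open>degree B\<close> and
  \<open>m\<close>.\<close>

lemma lin_chart_change:
  assumes "ch \<noteq> ch'"
  shows "\<exists>A' B' N. \<forall>P. in_chart ch P \<longrightarrow> in_chart ch' P \<longrightarrow>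
           lin m A B ch' P = lin m A' B' ch P / fst_coord ch P ^ N"
proof -
  have "lin m A B ch' P =
      lin m (monom 1 (degree B + m) * reflect_poly A) (monom 1 (degree A) * reflect_poly B) ch P
        / fst_coord ch P ^ (degree A + degree B + m)"
    if "in_chart ch P" "in_chart ch' P" for P
  proof -
    note c = chart_change[OF that assms]
    show ?thesis
      unfolding lin_def c(2,3) poly_inverse_arg[OF c(1)]
      using c(1) by (simp add: poly_monom field_simps power_add)
  qed
  then show ?thesis by blast
qed

lemma lin_mult:
  "\<exists>A B. \<forall>P\<in>curve f. in_chart ch P \<longrightarrow> lin m A1 B1 ch P * lin m A2 B2 ch P = lin m A B ch P"
proof -
  have "lin m A1 B1 ch P * lin m A2 B2 ch P =
      lin m (A1 * A2 + B1 * B2 * chart_poly ch f) (A1 * B2 + A2 * B1) ch P"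
    if "P \<in> curve f" "in_chart ch P" for P
    using snd_coord_sq[OF that, symmetric] by (simp add: lin_def algebra_simps power2_eq_square)
  then show ?thesis by blast
qed

lemma lin_add: "lin m A1 B1 ch P + lin m A2 B2 ch P = lin m (A1 + A2) (B1 + B2) ch P"
  by (simp add: lin_def algebra_simps)

lemma chart_eval_lin:
  "\<exists>A B. \<forall>P\<in>curve f. in_chart ch P \<longrightarrow> chart_eval m ch p P = lin m A B ch P"
proof -
  obtain A B where "\<And>a b. b ^ 2 = poly (chart_poly ch f) a \<Longrightarrow> eval2 p a b = poly A a + poly B a * b"
    using eval2_on_curve by meson
  then have "chart_eval m ch p P = lin m A B ch P" if "P \<in> curve f" "in_chart ch P" for P
    using snd_coord_sq[OF that] that by (simp add: chart_eval_eq lin_def)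
  then show ?thesis by blast
qed

lemma reg_at_iff:
  "reg_at f ch h P \<longleftrightarrow> in_chart ch P \<and> (\<exists>A B C D. lin m C D ch P \<noteq> 0 \<and>
     (\<forall>Q\<in>curve f. in_chart ch Q \<longrightarrow> lin m C D ch Q \<noteq> 0 \<longrightarrow>
        h Q = lin m A B ch Q / lin m C D ch Q))"
  by (simp add: reg_at_def m_eq)

lemma reg_atI:
  assumes "in_chart ch P" "lin m C D ch P \<noteq> 0"
    "\<And>Q. Q \<in> curve f \<Longrightarrow> in_chart ch Q \<Longrightarrow> lin m C D ch Q \<noteq> 0 \<Longrightarrow>
      h Q = lin m A B ch Q / lin m C D ch Q"
  shows "reg_at f ch h P"
  using assms unfolding reg_at_iff by blast

text \<open>A germ that is a quotient off a finite set is a quotient: enlarge the denominator.\<close>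

lemma lin_separating:
  assumes "finite S" "P \<notin> S" "P \<in> curve f" "in_chart ch P" "S \<subseteq> curve f"
  shows "\<exists>A B. lin m A B ch P \<noteq> 0 \<and> (\<forall>R\<in>S. in_chart ch R \<longrightarrow> lin m A B ch R = 0)"
  using assms
proof (induction S rule: finite_induct)
  case empty
  have "lin m 1 0 ch P \<noteq> 0" by (simp add: lin_def)
  then show ?case by blast
next
  case (insert R S)
  then obtain A B where AB: "lin m A B ch P \<noteq> 0" "\<And>R. R \<in> S \<Longrightarrow> in_chart ch R \<Longrightarrow> lin m A B ch R = 0"
    by auto
  show ?case
  proof (cases "in_chart ch R")
    case False
    then show ?thesis using AB by blast
  next
    case True
    obtain A' B' where AB': "lin m A' B' ch P \<noteq> 0" "lin m A' B' ch R = 0"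
    proof (cases "fst_coord ch P = fst_coord ch R")
      case True
      then have "snd_coord m ch P \<noteq> snd_coord m ch R"
        using point_eq_in_chart insert.prems \<open>in_chart ch R\<close> by blast
      then show ?thesis
        by (intro that[of "[:- snd_coord m ch R:]" 1]) (simp_all add: lin_def)
    next
      case False
      then show ?thesis
        by (intro that[of "[:- fst_coord ch R, 1:]" 0]) (simp_all add: lin_def)
    qed
    obtain A'' B'' where "\<And>Q. Q \<in> curve f \<Longrightarrow> in_chart ch Q \<Longrightarrow>
        lin m A B ch Q * lin m A' B' ch Q = lin m A'' B'' ch Q"
      using lin_mult by meson
    then have "lin m A'' B'' ch P \<noteq> 0" "\<forall>Q\<in>insert R S. in_chart ch Q \<longrightarrow> lin m A'' B'' ch Q = 0"
      using AB AB' insert.prems by (metis mult_eq_0_iff, metis insert_iff mult_eq_0_iff subsetD)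
    then show ?thesis by blast
  qed
qed

lemma reg_at_cofinite:
  assumes "P \<in> curve f" "in_chart ch P" "finite S" "P \<notin> S" "lin m C D ch P \<noteq> 0"
    and h: "\<And>Q. Q \<in> curve f - S \<Longrightarrow> in_chart ch Q \<Longrightarrow> lin m C D ch Q \<noteq> 0 \<Longrightarrow>
      h Q = lin m A B ch Q / lin m C D ch Q"
  shows "reg_at f ch h P"
proof -
  obtain E G where EG: "lin m E G ch P \<noteq> 0"
    "\<And>R. R \<in> S \<inter> curve f \<Longrightarrow> in_chart ch R \<Longrightarrow> lin m E G ch R = 0"
    using lin_separating[of "S \<inter> curve f" P ch] assms by auto
  obtain A' B' where 1: "\<And>Q. Q \<in> curve f \<Longrightarrow> in_chart ch Q \<Longrightarrow>
        lin m A B ch Q * lin m E G ch Q = lin m A' B' ch Q"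
    using lin_mult by meson
  obtain C' D' where 2: "\<And>Q. Q \<in> curve f \<Longrightarrow> in_chart ch Q \<Longrightarrow>
        lin m C D ch Q * lin m E G ch Q = lin m C' D' ch Q"
    using lin_mult by meson
  show ?thesis
  proof (rule reg_atI[of ch P C' D' _ A' B'])
    show "lin m C' D' ch P \<noteq> 0" using 2[OF assms(1,2)] assms(5) EG(1) by (metis mult_eq_0_iff)
    fix Q assume Q: "Q \<in> curve f" "in_chart ch Q" "lin m C' D' ch Q \<noteq> 0"
    then have "lin m C D ch Q \<noteq> 0" "lin m E G ch Q \<noteq> 0" using 2 by (metis mult_eq_0_iff)+
    moreover from this have "Q \<notin> S" using EG(2) Q by blast
    ultimately show "h Q = lin m A' B' ch Q / lin m C' D' ch Q"
      using h[of Q] Q 1[of Q, symmetric] 2[of Q, symmetric] by simp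
  qed fact
qed

lemma reg_at_chart:
  assumes P: "P \<in> curve f" and h: "reg_at f ch h P" and ch': "in_chart ch' P"
  shows "reg_at f ch' h P"
proof (cases "ch = ch'")
  case False
  from h obtain A B C D where AD: "in_chart ch P" "lin m C D ch P \<noteq> 0"
    "\<And>Q. Q \<in> curve f \<Longrightarrow> in_chart ch Q \<Longrightarrow> lin m C D ch Q \<noteq> 0 \<Longrightarrow>
      h Q = lin m A B ch Q / lin m C D ch Q" unfolding reg_at_iff by blast
  obtain A' B' N where 1: "\<And>P. in_chart ch' P \<Longrightarrow> in_chart ch P \<Longrightarrow>
      lin m A B ch P = lin m A' B' ch' P / fst_coord ch' P ^ N"
    using lin_chart_change[of ch' ch] False by metis
  obtain C' D' N' where 2: "\<And>P. in_chart ch' P \<Longrightarrow> in_chart ch P \<Longrightarrow>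
      lin m C D ch P = lin m C' D' ch' P / fst_coord ch' P ^ N'"
    using lin_chart_change[of ch' ch] False by metis
  note nz = chart_change(1)[OF _ _ False[symmetric]]
  have mon: "lin m (monom 1 k * A) (monom 1 k * B) ch' Q = fst_coord ch' Q ^ k * lin m A B ch' Q" for k A B Q
    by (simp add: lin_def poly_monom algebra_simps)
  \<comment> \<open>\<open>Suc\<close> guarantees a factor \<open>fst_coord\<close> in the
    denominator even for \<open>N = 0\<close>: where the new denominator is nonzero, the point lies
    in both charts and the old formula applies.\<close>
  show ?thesis
  proof (rule reg_atI[of ch' P "monom 1 (Suc N) * C'" "monom 1 (Suc N) * D'" _
        "monom 1 (Suc N') * A'" "monom 1 (Suc N') * B'"])
    show "lin m (monom 1 (Suc N) * C') (monom 1 (Suc N) * D') ch' P \<noteq> 0"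
      using 2[OF ch' AD(1)] AD(2) nz[OF ch' AD(1)] by (simp only: mon) auto
    fix Q assume Q: "Q \<in> curve f" "in_chart ch' Q"
      "lin m (monom 1 (Suc N) * C') (monom 1 (Suc N) * D') ch' Q \<noteq> 0"
    then have z: "fst_coord ch' Q \<noteq> 0" "lin m C' D' ch' Q \<noteq> 0" unfolding mon by auto
    then have c: "in_chart ch Q" using in_chart_change Q by blast
    have "lin m C D ch Q \<noteq> 0" using 2[OF Q(2) c] z by simp
    from AD(3)[OF Q(1) c this]
    show "h Q = lin m (monom 1 (Suc N') * A') (monom 1 (Suc N') * B') ch' Q /
        lin m (monom 1 (Suc N) * C') (monom 1 (Suc N) * D') ch' Q"
      using z unfolding mon 1[OF Q(2) c] 2[OF Q(2) c] by (simp add: field_simps)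
  qed fact
qed (use h in simp)

end

section \<open>Cofinite open sets and the ring of regular germs at a point\<close>

context even_curve begin

lemma chart_infinity: "finite {P \<in> curve f. \<not> in_chart ch P}"
proof -
  have sq: "finite {y::'a. y ^ 2 = c}" for c
    using poly_roots_finite[of "[:- c, 0, 1:]"] by (simp add: power2_eq_square algebra_simps)
  have "{P \<in> curve f. \<not> in_chart ch P} \<subseteq> {Infinity 1, Infinity (-1)} \<union> Affine 0 ` {y. y ^ 2 = poly f 0}"
  proof
    fix P assume "P \<in> {P \<in> curve f. \<not> in_chart ch P}"
    then show "P \<in> {Infinity 1, Infinity (-1)} \<union> Affine 0 ` {y. y ^ 2 = poly f 0}"
      using curve_infinity by (cases ch; cases P) (auto simp: curve_def)
  qed
  then show ?thesis by (rule finite_subset) (simp add: sq)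
qed

lemma infinite_curve: "infinite (curve f)"
proof
  assume fin: "finite (curve f)"
  have "UNIV \<subseteq> fst_coord XY_Chart ` curve f"
  proof
    fix a :: 'a
    obtain b where "b ^ 2 = poly f a" using nth_root_exists[of 2 "poly f a"] by auto
    then have "Affine a b \<in> curve f" by (simp add: curve_def)
    then show "a \<in> fst_coord XY_Chart ` curve f" by force
  qed
  then show False using fin infinite_UNIV_char_0 by (meson finite_imageI finite_subset)
qed

lemma openin_basic: "openin (zariski f) (basic_open f ch q)"
  unfolding zariski_def by (rule topology_generated_by_Basis) blast

lemma basic_open_linear:
  "basic_open f ch [:A, B:] = {P \<in> curve f. in_chart ch P \<and> lin m A B ch P \<noteq> 0}"
  by (auto simp: basic_open_def m_eq chart_eval_eq eval2_linear lin_def)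

lemma openin_Diff_singleton: "openin (zariski f) (curve f - {P})"
proof (cases "P \<in> curve f")
  case True
  have "\<exists>q. Q \<in> basic_open f ch q \<and> basic_open f ch q \<subseteq> curve f - {P}"
    if Q: "Q \<in> curve f - {P}" "in_chart ch Q" for Q ch
  proof (cases "in_chart ch P")
    case False
    have "Q \<in> basic_open f ch [:1, 0:] \<and> basic_open f ch [:1, 0:] \<subseteq> curve f - {P}"
      using Q False by (subst (1 2) basic_open_linear) (auto simp: lin_def)
    then show ?thesis by blast
  next
    case inP: True
    obtain A B where "lin m A B ch Q \<noteq> 0" "\<forall>R\<in>{P}. in_chart ch R \<longrightarrow> lin m A B ch R = 0"
      using lin_separating[of "{P}" Q ch] Q True by auto
    then have "Q \<in> basic_open f ch [:A, B:] \<and> basic_open f ch [:A, B:] \<subseteq> curve f - {P}"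
      using Q inP by (subst (1 2) basic_open_linear) auto
    then show ?thesis by blast
  qed
  then have "\<exists>ch q. Q \<in> basic_open f ch q \<and> basic_open f ch q \<subseteq> curve f - {P}"
    if "Q \<in> curve f - {P}" for Q using that ex_chart by metis
  then show ?thesis by (subst openin_subopen) (use openin_basic in blast)
qed (metis Diff_empty Diff_insert0 openin_topspace topspace_zariski)

lemma openin_cofinite:
  assumes "U \<subseteq> curve f" "finite (curve f - U)"
  shows "openin (zariski f) U"
proof -
  have "openin (zariski f) (curve f - S)" if "finite S" for S
    using that
  proof (induction S)
    case empty
    then show ?case by (metis Diff_empty openin_topspace topspace_zariski)
  next
    case (insert P S)
    have "curve f - insert P S = (curve f - S) \<inter> (curve f - {P})" by blast
    then show ?case using insert openin_Diff_singleton openin_Int by metis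
  qed
  from this[OF assms(2)] assms(1) show ?thesis by (simp add: double_diff)
qed

abbreviation reg :: "('a point \<Rightarrow> 'a) \<Rightarrow> 'a point \<Rightarrow> bool" where
  "reg h P \<equiv> P \<in> curve f \<and> (\<exists>ch. reg_at f ch h P)"

lemma reg_in_chart: "reg h P \<Longrightarrow> in_chart ch P \<Longrightarrow> reg_at f ch h P"
  using reg_at_chart by blast

text \<open>Regularity at \<open>P\<close> does not see the values at finitely many other points;
  this lets rational functions be handled modulo finite sets.\<close>

lemma reg_cong:
  assumes "reg h P" "finite S" "P \<notin> S" "\<And>Q. Q \<in> curve f - S \<Longrightarrow> h' Q = h Q"
  shows "reg h' P"
proof -
  obtain ch where "reg_at f ch h P" using assms by blast
  then obtain A B C D where AD: "in_chart ch P" "lin m C D ch P \<noteq> 0"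
    "\<And>Q. Q \<in> curve f \<Longrightarrow> in_chart ch Q \<Longrightarrow> lin m C D ch Q \<noteq> 0 \<Longrightarrow>
      h Q = lin m A B ch Q / lin m C D ch Q" unfolding reg_at_iff by blast
  have "reg_at f ch h' P"
    by (rule reg_at_cofinite[of P ch S C D h' A B]) (use assms AD in auto)
  then show ?thesis using assms(1) by blast
qed

lemma reg_lin: "P \<in> curve f \<Longrightarrow> in_chart ch P \<Longrightarrow> reg (lin m A B ch) P"
  by (intro conjI exI[of _ ch] reg_atI[of ch P 1 0 _ A B]) (auto simp: lin_def)

lemma reg_const: "P \<in> curve f \<Longrightarrow> reg (\<lambda>_. c) P"
proof -
  assume P: "P \<in> curve f"
  obtain ch where "in_chart ch P" by (rule ex_chart)
  from reg_lin[OF P this, of "[:c:]" 0] show ?thesis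
    by (rule reg_cong[where S = "{}"]) (simp_all add: lin_def)
qed

lemma reg_mult:
  assumes "reg g P" "reg h P"
  shows "reg (\<lambda>Q. g Q * h Q) P"
proof -
  obtain ch where "reg_at f ch g P" using assms by blast
  moreover from this have "reg_at f ch h P" using reg_in_chart[OF assms(2)] reg_at_iff by blast
  ultimately have gh: "reg_at f ch g P" "reg_at f ch h P" by blast+
  from gh(1) obtain A B C D where AD: "in_chart ch P" "lin m C D ch P \<noteq> 0"
    "\<And>Q. Q \<in> curve f \<Longrightarrow> in_chart ch Q \<Longrightarrow> lin m C D ch Q \<noteq> 0 \<Longrightarrow>
      g Q = lin m A B ch Q / lin m C D ch Q" unfolding reg_at_iff by blast
  from gh(2) obtain A' B' C' D' where AD': "lin m C' D' ch P \<noteq> 0"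
    "\<And>Q. Q \<in> curve f \<Longrightarrow> in_chart ch Q \<Longrightarrow> lin m C' D' ch Q \<noteq> 0 \<Longrightarrow>
      h Q = lin m A' B' ch Q / lin m C' D' ch Q" unfolding reg_at_iff by blast
  obtain A1 B1 where 1: "\<And>Q. Q \<in> curve f \<Longrightarrow> in_chart ch Q \<Longrightarrow>
      lin m A B ch Q * lin m A' B' ch Q = lin m A1 B1 ch Q" using lin_mult by meson
  obtain C1 D1 where 2: "\<And>Q. Q \<in> curve f \<Longrightarrow> in_chart ch Q \<Longrightarrow>
      lin m C D ch Q * lin m C' D' ch Q = lin m C1 D1 ch Q" using lin_mult by meson
  have "reg_at f ch (\<lambda>Q. g Q * h Q) P"
  proof (rule reg_atI[of ch P C1 D1 _ A1 B1])
    show "lin m C1 D1 ch P \<noteq> 0" using AD AD' 2 assms(1) by (metis mult_eq_0_iff)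
    fix Q assume Q: "Q \<in> curve f" "in_chart ch Q" "lin m C1 D1 ch Q \<noteq> 0"
    then have "lin m C D ch Q \<noteq> 0" "lin m C' D' ch Q \<noteq> 0" using 2 by (metis mult_eq_0_iff)+
    then show "g Q * h Q = lin m A1 B1 ch Q / lin m C1 D1 ch Q"
      using AD(3)[OF Q(1,2)] AD'(2)[OF Q(1,2)] 1[OF Q(1,2)] 2[OF Q(1,2)] by simp
  qed fact
  then show ?thesis using assms(1) by blast
qed

lemma reg_inverse:
  assumes "reg h P" "h P \<noteq> 0"
  shows "reg (\<lambda>Q. inverse (h Q)) P"
proof -
  obtain ch where "reg_at f ch h P" using assms by blast
  then obtain A B C D where AD: "in_chart ch P" "lin m C D ch P \<noteq> 0"
    "\<And>Q. Q \<in> curve f \<Longrightarrow> in_chart ch Q \<Longrightarrow> lin m C D ch Q \<noteq> 0 \<Longrightarrow>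
      h Q = lin m A B ch Q / lin m C D ch Q" unfolding reg_at_iff by blast
  \<comment> \<open>The inverted fraction is expanded by the old denominator, so that the new
    denominator is nonzero only where the quotient formula for \<open>h\<close> is valid.\<close>
  obtain A1 B1 where 1: "\<And>Q. Q \<in> curve f \<Longrightarrow> in_chart ch Q \<Longrightarrow>
      lin m C D ch Q * lin m C D ch Q = lin m A1 B1 ch Q" using lin_mult by meson
  obtain C1 D1 where 2: "\<And>Q. Q \<in> curve f \<Longrightarrow> in_chart ch Q \<Longrightarrow>
      lin m A B ch Q * lin m C D ch Q = lin m C1 D1 ch Q" using lin_mult by meson
  have "reg_at f ch (\<lambda>Q. inverse (h Q)) P"
  proof (rule reg_atI[of ch P C1 D1 _ A1 B1])
    have "lin m A B ch P \<noteq> 0" using AD(3)[OF _ AD(1,2)] assms by auto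
    then show "lin m C1 D1 ch P \<noteq> 0" using AD 2 assms(1) by (metis mult_eq_0_iff)
    fix Q assume Q: "Q \<in> curve f" "in_chart ch Q" "lin m C1 D1 ch Q \<noteq> 0"
    then have "lin m C D ch Q \<noteq> 0" "lin m A B ch Q \<noteq> 0" using 2 by (metis mult_eq_0_iff)+
    then show "inverse (h Q) = lin m A1 B1 ch Q / lin m C1 D1 ch Q"
      using AD(3)[OF Q(1,2)] by (simp flip: 1[OF Q(1,2)] 2[OF Q(1,2)])
  qed fact
  then show ?thesis using assms(1) by blast
qed

lemma reg_power: "reg h P \<Longrightarrow> reg (\<lambda>Q. h Q ^ n) P"
proof (induction n)
  case 0
  then show ?case using reg_const[of P 1] by simp
next
  case (Suc n)
  then show ?case using reg_mult[of P h "\<lambda>Q. h Q ^ n"] by simp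
qed

end

text \<open>This holds for a smooth curve, and it is inherited along homeomorphisms.\<close>

locale cofinite_curve = even_curve +
  assumes finite_complement: "openin (zariski f) U \<Longrightarrow> U \<noteq> {} \<Longrightarrow> finite (curve f - U)"
begin

lemma openin_subset_curve: "openin (zariski f) U \<Longrightarrow> U \<subseteq> curve f"
  using openin_subset topspace_zariski by blast

lemma regular_on_imp_reg:
  assumes "regular_on f U h" "P \<in> U"
  shows "reg h P"
proof -
  have U: "openin (zariski f) U" using assms by (simp add: regular_on_def)
  then have P: "P \<in> curve f" using openin_subset_curve assms(2) by blast
  have fin: "finite (curve f - U)" using finite_complement[OF U] assms(2) by blast
  obtain ch p q where pq: "P \<in> basic_open f ch q" "\<And>Q. Q \<in> U \<inter> basic_open f ch q \<Longrightarrow>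
      h Q = chart_eval m ch p Q / chart_eval m ch q Q"
    using assms unfolding regular_on_def m_eq by blast
  obtain A B where AB: "\<And>Q. Q \<in> curve f \<Longrightarrow> in_chart ch Q \<Longrightarrow> chart_eval m ch p Q = lin m A B ch Q"
    using chart_eval_lin by meson
  obtain C D where CD: "\<And>Q. Q \<in> curve f \<Longrightarrow> in_chart ch Q \<Longrightarrow> chart_eval m ch q Q = lin m C D ch Q"
    using chart_eval_lin by meson
  have in_ch: "in_chart ch P" using pq(1) by (auto simp: basic_open_def chart_eval_eq split: if_splits)
  have "reg_at f ch h P"
  proof (rule reg_at_cofinite[of P ch "curve f - U" C D h A B])
    show "lin m C D ch P \<noteq> 0" using pq(1) CD[OF P in_ch] by (simp add: basic_open_def m_eq)
    fix Q assume "Q \<in> curve f - (curve f - U)" "in_chart ch Q" "lin m C D ch Q \<noteq> 0"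
    then show "h Q = lin m A B ch Q / lin m C D ch Q"
      using pq(2)[of Q] AB[of Q] CD[of Q] by (auto simp: basic_open_def m_eq)
  qed (use P fin in_ch assms in auto)
  then show ?thesis using P by blast
qed

lemma regular_onI:
  assumes "U \<subseteq> curve f" "finite (curve f - U)" "\<And>P. P \<in> U \<Longrightarrow> reg h P"
  shows "regular_on f U h"
  unfolding regular_on_def m_eq
proof (intro conjI ballI)
  show "openin (zariski f) U" using assms openin_cofinite by blast
  fix P assume P: "P \<in> U"
  then obtain ch where "reg_at f ch h P" using assms(3) by blast
  then obtain A B C D where AD: "in_chart ch P" "lin m C D ch P \<noteq> 0"
    "\<And>Q. Q \<in> curve f \<Longrightarrow> in_chart ch Q \<Longrightarrow> lin m C D ch Q \<noteq> 0 \<Longrightarrow>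
      h Q = lin m A B ch Q / lin m C D ch Q" unfolding reg_at_iff by blast
  show "\<exists>ch p q. P \<in> basic_open f ch q \<and> (\<forall>Q\<in>U \<inter> basic_open f ch q.
      h Q = chart_eval m ch p Q / chart_eval m ch q Q)"
    by (rule exI[of _ ch], rule exI[of _ "[:A, B:]"], rule exI[of _ "[:C, D:]"], unfold basic_open_linear)
      (use AD P assms(1) in \<open>auto simp: chart_eval_linear\<close>)
qed

lemma regular_on_cofinite: "regular_on f U h \<Longrightarrow> U \<noteq> {} \<Longrightarrow> finite (curve f - U)"
  using finite_complement by (auto simp: regular_on_def)

lemma reg_imp_regular_on:
  assumes "reg h P"
  obtains W where "P \<in> W" "regular_on f W h"
proof -
  obtain ch where "reg_at f ch h P" using assms by blast
  then obtain A B C D where AD: "in_chart ch P" "lin m C D ch P \<noteq> 0"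
    "\<And>Q. Q \<in> curve f \<Longrightarrow> in_chart ch Q \<Longrightarrow> lin m C D ch Q \<noteq> 0 \<Longrightarrow>
      h Q = lin m A B ch Q / lin m C D ch Q" unfolding reg_at_iff by blast
  define W where "W = basic_open f ch [:C, D:]"
  have W: "W = {P \<in> curve f. in_chart ch P \<and> lin m C D ch P \<noteq> 0}"
    unfolding W_def by (rule basic_open_linear)
  have P: "P \<in> W" using AD(1,2) assms unfolding W by simp
  then have "W \<noteq> {}" by blast
  then have fin: "finite (curve f - W)"
    using finite_complement openin_basic unfolding W_def by metis
  have sub: "W \<subseteq> curve f" unfolding W by simp
  have "reg h Q" if Q: "Q \<in> W" for Q
  proof
    have "reg_at f ch h Q" by (rule reg_atI[of ch Q C D h A B]) (use AD(3) Q W in auto)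
    then show "\<exists>ch. reg_at f ch h Q" ..
  qed (use Q W in simp)
  with sub fin have "regular_on f W h" by (rule regular_onI)
  with P show ?thesis by (rule that)
qed

end

section \<open>Identity principle and local parameters\<close>

context cofinite_curve begin

lemma lin_nonzero_cofinite:
  assumes "P \<in> curve f" "in_chart ch P" "lin m A B ch P \<noteq> 0"
  shows "finite {Q \<in> curve f. \<not> (in_chart ch Q \<and> lin m A B ch Q \<noteq> 0)}"
proof -
  have eq: "basic_open f ch [:A, B:] = {P \<in> curve f. in_chart ch P \<and> lin m A B ch P \<noteq> 0}"
    by (rule basic_open_linear)
  then have "basic_open f ch [:A, B:] \<noteq> {}" using assms by blast
  then have "finite (curve f - basic_open f ch [:A, B:])"
    using finite_complement openin_basic by blast
  moreover have "curve f - basic_open f ch [:A, B:] =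
      {Q \<in> curve f. \<not> (in_chart ch Q \<and> lin m A B ch Q \<noteq> 0)}"
    unfolding eq by blast
  ultimately show ?thesis by simp
qed

lemma reg_nonzero_cofinite:
  assumes "reg h P" "h P \<noteq> 0"
  shows "finite {Q \<in> curve f. h Q = 0}"
proof -
  obtain ch where "reg_at f ch h P" using assms by blast
  then obtain A B C D where AD: "in_chart ch P" "lin m C D ch P \<noteq> 0"
    "\<And>Q. Q \<in> curve f \<Longrightarrow> in_chart ch Q \<Longrightarrow> lin m C D ch Q \<noteq> 0 \<Longrightarrow>
      h Q = lin m A B ch Q / lin m C D ch Q" unfolding reg_at_iff by blast
  have P: "P \<in> curve f" using assms by blast
  have "lin m A B ch P \<noteq> 0" using AD(3)[OF P AD(1,2)] assms(2) by auto
  from lin_nonzero_cofinite[OF P AD(1) this] lin_nonzero_cofinite[OF P AD(1,2)]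
  have "finite ({Q \<in> curve f. \<not> (in_chart ch Q \<and> lin m A B ch Q \<noteq> 0)} \<union>
      {Q \<in> curve f. \<not> (in_chart ch Q \<and> lin m C D ch Q \<noteq> 0)})" (is "finite ?S")
    by (rule finite_UnI)
  moreover have "{Q \<in> curve f. h Q = 0} \<subseteq> ?S" using AD(3) by auto
  ultimately show ?thesis by (meson finite_subset)
qed

text \<open>Identity principle: if the germs differed at \<open>P\<close>, the numerator of their
  difference would be nonzero at \<open>P\<close>, hence off a finite set, whereas the curve is
  infinite.\<close>

lemma reg_eq:
  assumes "reg g P" "reg h P" "finite S" "\<And>Q. Q \<in> curve f - S \<Longrightarrow> g Q = h Q"
  shows "g P = h P"
proof (rule ccontr)
  assume neq: "g P \<noteq> h P"
  obtain ch where ch: "reg_at f ch g P" using assms by blast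
  then have ch': "reg_at f ch h P" using reg_in_chart[OF assms(2)] reg_at_iff by blast
  from ch obtain A B C D where AD: "in_chart ch P" "lin m C D ch P \<noteq> 0"
    "\<And>Q. Q \<in> curve f \<Longrightarrow> in_chart ch Q \<Longrightarrow> lin m C D ch Q \<noteq> 0 \<Longrightarrow>
      g Q = lin m A B ch Q / lin m C D ch Q" unfolding reg_at_iff by blast
  from ch' obtain A' B' C' D' where AD': "lin m C' D' ch P \<noteq> 0"
    "\<And>Q. Q \<in> curve f \<Longrightarrow> in_chart ch Q \<Longrightarrow> lin m C' D' ch Q \<noteq> 0 \<Longrightarrow>
      h Q = lin m A' B' ch Q / lin m C' D' ch Q" unfolding reg_at_iff by blast
  obtain A1 B1 where 1: "\<And>Q. Q \<in> curve f \<Longrightarrow> in_chart ch Q \<Longrightarrow>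
      lin m A B ch Q * lin m C' D' ch Q = lin m A1 B1 ch Q" using lin_mult by meson
  obtain A2 B2 where 2: "\<And>Q. Q \<in> curve f \<Longrightarrow> in_chart ch Q \<Longrightarrow>
      lin m (-A') (-B') ch Q * lin m C D ch Q = lin m A2 B2 ch Q" using lin_mult by meson
  let ?E = "lin m (A1 + A2) (B1 + B2) ch"
  have E: "?E Q = (g Q - h Q) * (lin m C D ch Q * lin m C' D' ch Q)"
    if Q: "Q \<in> curve f" "in_chart ch Q" "lin m C D ch Q \<noteq> 0" "lin m C' D' ch Q \<noteq> 0" for Q
  proof -
    have neg: "lin m (-A') (-B') ch Q = - lin m A' B' ch Q" by (simp add: lin_def)
    have g: "lin m A B ch Q = g Q * lin m C D ch Q" using AD(3)[OF Q(1-3)] Q(3) by simp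
    have h: "lin m A' B' ch Q = h Q * lin m C' D' ch Q" using AD'(2)[OF Q(1,2,4)] Q(4) by simp
    show ?thesis
      unfolding lin_add[symmetric] 1[OF Q(1,2), symmetric] 2[OF Q(1,2), symmetric] neg g h
      by (simp add: algebra_simps)
  qed
  have P: "P \<in> curve f" using assms by blast
  have "?E P \<noteq> 0" using E[OF P AD(1,2) AD'(1)] neq AD(2) AD'(1) by simp
  note fin = lin_nonzero_cofinite[OF P AD(1) this] lin_nonzero_cofinite[OF P AD(1,2)]
    lin_nonzero_cofinite[OF P AD(1) AD'(1)]
  from assms(3) fin have "finite (S \<union> {Q \<in> curve f. \<not> (in_chart ch Q \<and> ?E Q \<noteq> 0)} \<union>
      {Q \<in> curve f. \<not> (in_chart ch Q \<and> lin m C D ch Q \<noteq> 0)} \<union>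
      {Q \<in> curve f. \<not> (in_chart ch Q \<and> lin m C' D' ch Q \<noteq> 0)})" (is "finite ?T")
    by (intro finite_UnI)
  moreover have "curve f \<subseteq> ?T"
  proof
    fix Q assume Q: "Q \<in> curve f"
    show "Q \<in> ?T"
    proof (rule ccontr)
      assume "Q \<notin> ?T"
      then have "Q \<notin> S" "in_chart ch Q" "?E Q \<noteq> 0" "lin m C D ch Q \<noteq> 0" "lin m C' D' ch Q \<noteq> 0"
        using Q by blast+
      then show False using E[OF Q] assms(4)[of Q] Q by simp
    qed
  qed
  ultimately show False using infinite_curve finite_subset by blast
qed

text \<open>At points with \<open>y \<noteq> 0\<close> the local parameter is \<open>x - x(P)\<close>: if \<open>A + B y\<close> vanishes at the point
  and \<open>A - B y\<close> does not, then the norm \<open>A\<^sup>2 - B\<^sup>2 F\<close> is divisible by it.\<close>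

lemma fst_coord_divides:
  assumes s: "reg s P" "s P = 0" and P: "in_chart ch P" "snd_coord m ch P \<noteq> 0"
  shows "\<exists>r S. reg r P \<and> finite S \<and> P \<notin> S \<and>
    (\<forall>Q\<in>curve f - S. s Q = (fst_coord ch Q - fst_coord ch P) * r Q)"
proof -
  let ?x = "fst_coord ch P" and ?y = "snd_coord m ch P"
  have Pc: "P \<in> curve f" using s by blast
  from reg_in_chart[OF s(1) P(1)] obtain A B C D where AD: "lin m C D ch P \<noteq> 0"
    "\<And>Q. Q \<in> curve f \<Longrightarrow> in_chart ch Q \<Longrightarrow> lin m C D ch Q \<noteq> 0 \<Longrightarrow>
      s Q = lin m A B ch Q / lin m C D ch Q" unfolding reg_at_iff by blast
  let ?S = "{Q \<in> curve f. \<not> (in_chart ch Q \<and> lin m C D ch Q \<noteq> 0)}"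
  have S: "finite ?S" "P \<notin> ?S" using lin_nonzero_cofinite[OF Pc P(1) AD(1)] AD(1) P(1) by auto
  have num: "lin m A B ch P = 0" using AD(2)[OF Pc P(1) AD(1)] s(2) AD(1) by simp
  have CD: "reg (\<lambda>Q. inverse (lin m C D ch Q)) P" by (rule reg_inverse[OF reg_lin[OF Pc P(1)] AD(1)])
  show ?thesis
  proof (cases "lin m A (- B) ch P = 0")
    \<comment> \<open>Both conjugates vanish at \<open>P\<close> and \<open>y(P)\<close> is nonzero,
      so \<open>A\<close> and \<open>B\<close> vanish separately and \<open>x - x(P)\<close> can be
      cancelled without the norm.\<close>
    case True
    then have "poly A ?x = 0" "poly B ?x = 0" using num P(2) by (simp_all add: lin_def)
    then obtain A1 B1 where AB: "A = [:- ?x, 1:] * A1" "B = [:- ?x, 1:] * B1"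
      by (auto simp: poly_eq_0_iff_dvd elim!: dvdE)
    let ?r = "\<lambda>Q. lin m A1 B1 ch Q * inverse (lin m C D ch Q)"
    have "reg ?r P" by (rule reg_mult[OF reg_lin[OF Pc P(1)] CD])
    moreover have "s Q = (fst_coord ch Q - ?x) * ?r Q" if "Q \<in> curve f - ?S" for Q
      using that AD(2)[of Q] by (auto simp: AB lin_def field_simps)
    ultimately show ?thesis using S by blast
  next
    case False
    let ?T = "{Q \<in> curve f. \<not> (in_chart ch Q \<and> lin m A (- B) ch Q \<noteq> 0)}"
    have T: "finite ?T" "P \<notin> ?T" using lin_nonzero_cofinite[OF Pc P(1) False] False P(1) by auto
    let ?N = "A * A - B * B * chart_poly ch f"
    have norm: "lin m A B ch Q * lin m A (-B) ch Q = poly ?N (fst_coord ch Q)"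
      if "Q \<in> curve f" "in_chart ch Q" for Q
      using snd_coord_sq[OF that] by (simp add: lin_def algebra_simps power2_eq_square)
    then have "poly ?N ?x = 0" using num Pc P(1) by (metis mult_zero_left)
    then obtain N1 where N1: "?N = [:- ?x, 1:] * N1" unfolding poly_eq_0_iff_dvd by (elim dvdE)
    let ?r = "\<lambda>Q. lin m N1 0 ch Q * inverse (lin m A (-B) ch Q) * inverse (lin m C D ch Q)"
    have "reg ?r P"
      by (rule reg_mult[OF reg_mult[OF reg_lin[OF Pc P(1)] reg_inverse[OF reg_lin[OF Pc P(1)] False]] CD])
    moreover have "s Q = (fst_coord ch Q - ?x) * ?r Q" if "Q \<in> curve f - (?S \<union> ?T)" for Q
    proof -
      have Q: "Q \<in> curve f" "in_chart ch Q" "lin m C D ch Q \<noteq> 0" "lin m A (- B) ch Q \<noteq> 0"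
        using that by auto
      have "lin m A B ch Q * lin m A (-B) ch Q = (fst_coord ch Q - ?x) * lin m N1 0 ch Q"
        unfolding norm[OF Q(1,2)] N1 by (simp add: lin_def algebra_simps)
      then have "lin m A B ch Q = (fst_coord ch Q - ?x) * lin m N1 0 ch Q * inverse (lin m A (-B) ch Q)"
        using Q(4) by (metis nonzero_eq_divide_eq divide_inverse)
      then show ?thesis using AD(2)[OF Q(1-3)] by (simp only: divide_inverse mult.assoc)
    qed
    ultimately show ?thesis using S T by (intro exI[of _ ?r] exI[of _ "?S \<union> ?T"]) blast
  qed
qed

lemma uniformizerI:
  assumes t: "reg t P" "t P = 0"
    and div: "\<And>s. reg s P \<Longrightarrow> s P = 0 \<Longrightarrow>
      \<exists>r S. reg r P \<and> finite S \<and> P \<notin> S \<and> (\<forall>Q\<in>curve f - S. s Q = t Q * r Q)"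
  shows "uniformizer f P t"
  unfolding uniformizer_def
proof (intro conjI allI impI)
  show "\<exists>U. P \<in> U \<and> regular_on f U t" by (rule reg_imp_regular_on[OF t(1)]) blast
  fix V s assume Vs: "P \<in> V \<and> regular_on f V s \<and> s P = 0"
  then have "reg s P" by (intro regular_on_imp_reg[of V]) simp_all
  from div[OF this] Vs obtain r S where r: "reg r P" "finite S" "P \<notin> S" "\<And>Q. Q \<in> curve f - S \<Longrightarrow> s Q = t Q * r Q"
    by blast
  obtain W where W: "P \<in> W" "regular_on f W r" by (rule reg_imp_regular_on[OF r(1)])
  let ?W = "V \<inter> W - S"
  have sub: "V \<subseteq> curve f" using Vs openin_subset_curve by (simp add: regular_on_def)
  have "curve f - ?W \<subseteq> (curve f - V) \<union> (curve f - W) \<union> S" by blast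
  moreover have "finite ((curve f - V) \<union> (curve f - W) \<union> S)"
    using regular_on_cofinite[of V s] regular_on_cofinite[OF W(2)] Vs W(1) r(2) by blast
  ultimately have fin: "finite (curve f - ?W)" by (rule finite_subset)
  have "?W \<subseteq> curve f" using sub by blast
  moreover have "reg r Q" if "Q \<in> ?W" for Q
    by (rule regular_on_imp_reg[OF W(2)]) (use that in blast)
  ultimately have "regular_on f ?W r" using fin by (intro regular_onI) (assumption | blast)+
  moreover have "\<forall>Q\<in>?W. s Q = t Q * r Q" using r(4) sub by blast
  ultimately show "\<exists>W r. P \<in> W \<and> W \<subseteq> V \<and> regular_on f W r \<and> (\<forall>Q\<in>W. s Q = t Q * r Q)"
    using Vs W(1) r(3) by (intro exI[of _ ?W] exI[of _ r]) blast
qed (fact t)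

lemma uniformizer_divides:
  assumes "uniformizer f P t" "reg s P" "s P = 0"
  shows "\<exists>r S. reg r P \<and> finite S \<and> P \<notin> S \<and> (\<forall>Q\<in>curve f - S. s Q = t Q * r Q)"
proof -
  obtain V where "P \<in> V" "regular_on f V s" by (rule reg_imp_regular_on[OF assms(2)])
  then obtain W r where W: "P \<in> W" "regular_on f W r" "\<forall>Q\<in>W. s Q = t Q * r Q"
    using assms(1,3) unfolding uniformizer_def by meson
  have "finite (curve f - W)" using regular_on_cofinite[OF W(2)] W(1) by blast
  moreover have "reg r P" by (rule regular_on_imp_reg[OF W(2,1)])
  ultimately show ?thesis using W by (intro exI[of _ r] exI[of _ "curve f - W"]) simp
qed

lemma reg_power_int:
  assumes "reg h P" "h P \<noteq> 0"
  shows "reg (\<lambda>Q. h Q powi n) P"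
proof (cases "n \<ge> 0")
  case True
  then show ?thesis using reg_power[OF assms(1), of "nat n"] by (simp add: power_int_def)
next
  case False
  then show ?thesis using reg_power[OF reg_inverse[OF assms], of "nat (- n)"]
    by (simp add: power_int_def)
qed

end

section \<open>Smooth models: irreducibility and the cofinite topology\<close>

locale smooth_curve = even_curve +
  assumes simple_root: "poly f r = 0 \<Longrightarrow> poly (pderiv f) r \<noteq> 0"
begin

lemma simple_factor:
  assumes "poly f r = 0"
  obtains F where "f = [:- r, 1:] * F" "poly F r \<noteq> 0"
proof -
  obtain F where F: "f = [:- r, 1:] * F" using assms unfolding poly_eq_0_iff_dvd by (elim dvdE)
  have "poly (pderiv f) r = poly F r" unfolding F pderiv_mult by (simp add: pderiv_pCons)
  then show ?thesis using that F simple_root[OF assms] by simp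
qed

lemma chart_poly_simple_factor:
  assumes "poly (chart_poly ch f) r = 0"
  shows "\<exists>F. chart_poly ch f = [:- r, 1:] * F \<and> poly F r \<noteq> 0"
proof (cases ch)
  case XY_Chart
  with assms have "poly f r = 0" by (simp add: chart_poly_def)
  from simple_factor[OF this] show ?thesis using XY_Chart by (auto simp: chart_poly_def)
next
  case ZW_Chart
  then have refl: "poly (reflect_poly f) r = 0" using assms by (simp add: chart_poly_def)
  then have r: "r \<noteq> 0" using monic by (auto simp: poly_reflect_poly_0)
  then have "poly f (inverse r) = 0" using refl by (simp add: poly_reflect_poly_nz)
  then obtain F where F: "f = [:- inverse r, 1:] * F" "poly F (inverse r) \<noteq> 0" by (rule simple_factor)
  have "reflect_poly [:- inverse r, 1:] = smult (- inverse r) [:- r, 1:]"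
    using r by (simp add: reflect_poly_pCons del: smult_minus_left)
  then have "reflect_poly f = [:- r, 1:] * smult (- inverse r) (reflect_poly F)"
    unfolding F(1) reflect_poly_mult by (simp only: mult_smult_left mult_smult_right)
  moreover have "poly (smult (- inverse r) (reflect_poly F)) r \<noteq> 0"
    using F(2) r by (simp add: poly_reflect_poly_nz)
  ultimately show ?thesis unfolding chart_poly_def ZW_Chart chart.case by blast
qed

text \<open>Through \<open>z = 1/x\<close> the second chart needs a nonzero root of
  \<open>f\<close>. The degree is at least 2 and the roots are simple, so there are two distinct
  roots, not both zero.\<close>

lemma chart_poly_root: "\<exists>r. poly (chart_poly ch f) r = 0"
proof -
  obtain r where r: "poly f r = 0"
    using alg_closed_imp_poly_has_root[of f] degree_f m_pos by auto
  then obtain F where F: "f = [:- r, 1:] * F" "poly F r \<noteq> 0" by (rule simple_factor)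
  then have "F \<noteq> 0" by auto
  then have "degree f = 1 + degree F" unfolding F(1) by (subst degree_mult_eq) auto
  then have "degree F > 0" using degree_f m_pos by linarith
  then obtain r' where r': "poly F r' = 0" using alg_closed_imp_poly_has_root by blast
  then have "poly f r' = 0" "r \<noteq> r'" using F by auto
  then obtain s where "poly f s = 0" "s \<noteq> 0" using r by metis
  then have "poly (reflect_poly f) (inverse s) = 0" by (simp add: poly_reflect_poly_nz)
  then show ?thesis using r by (cases ch) (auto simp: chart_poly_def)
qed

text \<open>This is the irreducibility of the curve: at a simple root of the chart polynomial the
  left side, unless zero, vanishes to even order and the right side to odd order.\<close>

lemma norm_eq_0_imp:
  assumes "A * A = B * B * chart_poly ch f"
  shows "A = 0 \<and> B = 0"
proof -
  obtain r where "poly (chart_poly ch f) r = 0" using chart_poly_root by blast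
  then obtain F where F: "chart_poly ch f = [:- r, 1:] * F" "poly F r \<noteq> 0"
    using chart_poly_simple_factor by blast
  then have "F \<noteq> 0" by auto
  then have nz: "chart_poly ch f \<noteq> 0" unfolding F(1) by (intro no_zero_divisors) simp_all
  have "Polynomial.order r (chart_poly ch f) = 1"
    using nz order_mult[of "[:- r, 1:]" F r] order_power_n_n[of r 1] F by (simp add: order_0I)
  moreover have "Polynomial.order r (A * A) = 2 * Polynomial.order r A" if "A \<noteq> 0"
    using that by (simp add: order_mult)
  moreover have "Polynomial.order r (B * B * chart_poly ch f) =
      2 * Polynomial.order r B + Polynomial.order r (chart_poly ch f)" if "B \<noteq> 0"
    using that nz by (simp add: order_mult)
  ultimately have "B = 0" using assms nz by (metis Suc_eq_plus1 even_Suc even_mult_iff even_numeral mult_eq_0_iff)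
  then show ?thesis using assms by simp
qed

text \<open>At a zero of \<open>A + B y\<close> the norm \<open>A^2 - B^2 F\<close> vanishes, which
  is a nonzero polynomial in \<open>x\<close> alone; each of its roots carries finitely many
  points.\<close>

lemma lin_zero_finite:
  assumes "A \<noteq> 0 \<or> B \<noteq> 0"
  shows "finite {P \<in> curve f. in_chart ch P \<and> lin m A B ch P = 0}" (is "finite ?Z")
proof -
  let ?F = "chart_poly ch f"
  let ?N = "A * A - B * B * ?F"
  have N: "?N \<noteq> 0" using norm_eq_0_imp assms by auto
  have norm: "poly ?N (fst_coord ch P) = 0" if "P \<in> ?Z" for P
  proof -
    have "poly A (fst_coord ch P) = - (poly B (fst_coord ch P) * snd_coord m ch P)"
      using that by (simp add: lin_def add_eq_0_iff2)
    then show ?thesis using snd_coord_sq[of P ch] that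
      by (simp add: power2_eq_square algebra_simps)
  qed
  have sq: "finite {y::'a. y ^ 2 = c}" for c
    using poly_roots_finite[of "[:- c, 0, 1:]"] by (simp add: power2_eq_square algebra_simps)
  let ?c = "\<lambda>P. (fst_coord ch P, snd_coord m ch P)"
  have "?c ` ?Z \<subseteq> (SIGMA x : {x. poly ?N x = 0}. {y. y ^ 2 = poly ?F x})"
  proof
    fix z assume "z \<in> ?c ` ?Z"
    then obtain P where "P \<in> ?Z" "z = ?c P" by blast
    then show "z \<in> (SIGMA x : {x. poly ?N x = 0}. {y. y ^ 2 = poly ?F x})"
      using norm[of P] snd_coord_sq[of P ch] by auto
  qed
  moreover have "finite (SIGMA x : {x. poly ?N x = 0}. {y. y ^ 2 = poly ?F x})"
    using poly_roots_finite[OF N] sq by (intro finite_SigmaI)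
  ultimately have "finite (?c ` ?Z)" by (rule finite_subset)
  moreover have "inj_on ?c ?Z" using point_eq_in_chart unfolding inj_on_def by blast
  ultimately show ?thesis by (rule finite_imageD)
qed

lemma basic_open_cofinite:
  assumes "basic_open f ch q \<noteq> {}"
  shows "finite (curve f - basic_open f ch q)"
proof -
  obtain A B where AB: "\<And>P. P \<in> curve f \<Longrightarrow> in_chart ch P \<Longrightarrow> chart_eval m ch q P = lin m A B ch P"
    using chart_eval_lin by meson
  have bo: "basic_open f ch q = {P \<in> curve f. in_chart ch P \<and> lin m A B ch P \<noteq> 0}"
    using AB by (auto simp: basic_open_def m_eq) (auto simp: chart_eval_eq split: if_splits)
  then have "A \<noteq> 0 \<or> B \<noteq> 0" using assms by (auto simp: lin_def)
  then have "finite ({P \<in> curve f. \<not> in_chart ch P} \<union> {P \<in> curve f. in_chart ch P \<and> lin m A B ch P = 0})"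
    using chart_infinity lin_zero_finite by simp
  then show ?thesis by (rule rev_finite_subset) (auto simp: bo)
qed

sublocale cofinite_curve
proof
  fix U assume "openin (zariski f) U" "U \<noteq> {}"
  then have "generate_topology_on {basic_open f ch q | ch q. True} U"
    unfolding zariski_def openin_topology_generated_by_iff by simp
  then have "U = {} \<or> finite (curve f - U)"
  proof induction
    case (Int a b)
    have "curve f - a \<inter> b = (curve f - a) \<union> (curve f - b)" by blast
    then show ?case using Int by auto
  next
    case (UN K)
    show ?case
    proof (cases "\<Union> K = {}")
      case False
      then obtain k where k: "k \<in> K" "k \<noteq> {}" by blast
      then have "finite (curve f - k)" using UN by blast
      then have "finite (curve f - \<Union> K)" by (rule rev_finite_subset) (use k in blast)
      then show ?thesis by blast
    qed simp
  qed (use basic_open_cofinite in auto)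
  then show "finite (curve f - U)" using \<open>U \<noteq> {}\<close> by blast
qed

end

section \<open>Uniformizers and orders of vanishing\<close>

text \<open>The branch points have \<open>y = 0\<close>; there \<open>y\<close> replaces \<open>x - x(P)\<close> as local parameter.\<close>

fun unif :: "nat \<Rightarrow> 'a::field point \<Rightarrow> 'a point \<Rightarrow> 'a" where
  "unif m (Affine a b) Q = (if b = 0 then snd_coord m XY_Chart Q else fst_coord XY_Chart Q - a)"
| "unif m (Infinity c) Q = fst_coord ZW_Chart Q"

context smooth_curve begin

text \<open>At a branch point \<open>F = (x - x(P)) F1\<close> with \<open>F1\<close> nonzero there,
  so \<open>x - x(P) = y^2 / F1\<close>. A numerator \<open>A + B y\<close> vanishing at
  \<open>P\<close> has \<open>A\<close> divisible by \<open>x - x(P)\<close>, hence is itself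
  divisible by \<open>y\<close>.\<close>

lemma snd_coord_divides:
  assumes s: "reg s P" "s P = 0" and P: "in_chart ch P" "snd_coord m ch P = 0"
  shows "\<exists>r S. reg r P \<and> finite S \<and> P \<notin> S \<and> (\<forall>Q\<in>curve f - S. s Q = snd_coord m ch Q * r Q)"
proof -
  let ?x = "fst_coord ch P"
  have Pc: "P \<in> curve f" using s by blast
  from reg_in_chart[OF s(1) P(1)] obtain A B C D where AD: "lin m C D ch P \<noteq> 0"
    "\<And>Q. Q \<in> curve f \<Longrightarrow> in_chart ch Q \<Longrightarrow> lin m C D ch Q \<noteq> 0 \<Longrightarrow>
      s Q = lin m A B ch Q / lin m C D ch Q" unfolding reg_at_iff by blast
  let ?S = "{Q \<in> curve f. \<not> (in_chart ch Q \<and> lin m C D ch Q \<noteq> 0)}"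
  have S: "finite ?S" "P \<notin> ?S" using lin_nonzero_cofinite[OF Pc P(1) AD(1)] AD(1) P(1) by auto
  have "lin m A B ch P = 0" using AD(2)[OF Pc P(1) AD(1)] s(2) AD(1) by simp
  then have "poly A ?x = 0" using P(2) by (simp add: lin_def)
  then obtain A1 where A1: "A = [:- ?x, 1:] * A1" unfolding poly_eq_0_iff_dvd by (elim dvdE)
  have "poly (chart_poly ch f) ?x = 0" using snd_coord_sq[OF Pc P(1)] P(2) by simp
  then obtain F where F: "chart_poly ch f = [:- ?x, 1:] * F" "poly F ?x \<noteq> 0"
    using chart_poly_simple_factor by blast
  have FP: "lin m F 0 ch P \<noteq> 0" using F(2) by (simp add: lin_def)
  let ?T = "{Q \<in> curve f. \<not> (in_chart ch Q \<and> lin m F 0 ch Q \<noteq> 0)}"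
  have T: "finite ?T" "P \<notin> ?T" using lin_nonzero_cofinite[OF Pc P(1) FP] FP P(1) by auto
  let ?r = "\<lambda>Q. lin m (B * F) A1 ch Q * inverse (lin m F 0 ch Q) * inverse (lin m C D ch Q)"
  have "reg ?r P"
    by (rule reg_mult[OF reg_mult[OF reg_lin[OF Pc P(1)] reg_inverse[OF reg_lin[OF Pc P(1)] FP]]
          reg_inverse[OF reg_lin[OF Pc P(1)] AD(1)]])
  moreover have "s Q = snd_coord m ch Q * ?r Q" if "Q \<in> curve f - (?S \<union> ?T)" for Q
  proof -
    have Q: "Q \<in> curve f" "in_chart ch Q" "lin m C D ch Q \<noteq> 0" "lin m F 0 ch Q \<noteq> 0"
      using that by auto
    have sq: "(fst_coord ch Q - ?x) * poly F (fst_coord ch Q) = snd_coord m ch Q ^ 2"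
      using snd_coord_sq[OF Q(1,2)] by (simp add: F(1) algebra_simps)
    have "lin m F 0 ch Q * lin m A B ch Q = poly A1 (fst_coord ch Q) *
        ((fst_coord ch Q - ?x) * poly F (fst_coord ch Q)) +
        poly B (fst_coord ch Q) * poly F (fst_coord ch Q) * snd_coord m ch Q"
      by (simp add: lin_def A1 algebra_simps)
    also have "\<dots> = snd_coord m ch Q * lin m (B * F) A1 ch Q"
      unfolding sq by (simp add: lin_def algebra_simps power2_eq_square)
    finally have "lin m A B ch Q = snd_coord m ch Q * lin m (B * F) A1 ch Q * inverse (lin m F 0 ch Q)"
      using Q(4) by (metis mult.commute nonzero_eq_divide_eq divide_inverse)
    then show ?thesis using AD(2)[OF Q(1-3)] by (simp only: divide_inverse mult.assoc)
  qed
  ultimately show ?thesis using S T by (intro exI[of _ ?r] exI[of _ "?S \<union> ?T"]) blast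
qed

lemma reg_fst_coord: "P \<in> curve f \<Longrightarrow> in_chart ch P \<Longrightarrow> reg (\<lambda>Q. fst_coord ch Q - a) P"
  using reg_lin[of P ch "[:- a, 1:]" 0] by (simp add: lin_def[abs_def])

lemma reg_snd_coord: "P \<in> curve f \<Longrightarrow> in_chart ch P \<Longrightarrow> reg (snd_coord m ch) P"
  using reg_lin[of P ch 0 1] by (simp add: lin_def[abs_def])

text \<open>Points at infinity fall under the second case, because their second coordinate is 1 or
  -1.\<close>

lemma unif_eq:
  assumes "P \<in> curve f"
  obtains ch where "in_chart ch P" "snd_coord m ch P = 0" "unif m P = snd_coord m ch"
  | ch where "in_chart ch P" "snd_coord m ch P \<noteq> 0"
    "unif m P = (\<lambda>Q. fst_coord ch Q - fst_coord ch P)"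
proof (cases P)
  case (Affine a b)
  show ?thesis
  proof (cases "b = 0")
    case True
    show ?thesis by (rule that(1)[of XY_Chart]) (auto simp: Affine True)
  next
    case False
    show ?thesis by (rule that(2)[of XY_Chart]) (auto simp: Affine False)
  qed
next
  case (Infinity c)
  then have "c \<noteq> 0" using assms curve_infinity by auto
  show ?thesis by (rule that(2)[of ZW_Chart]) (auto simp: Infinity \<open>c \<noteq> 0\<close>)
qed

lemma unif_reg:
  assumes "P \<in> curve f"
  shows "reg (unif m P) P"
proof (rule unif_eq[OF assms])
  fix ch assume "in_chart ch P" "unif m P = snd_coord m ch"
  then show ?thesis using reg_snd_coord[OF assms] by simp
next
  fix ch assume "in_chart ch P" "unif m P = (\<lambda>Q. fst_coord ch Q - fst_coord ch P)"
  then show ?thesis using reg_fst_coord[OF assms] by simp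
qed

lemma unif_self: "P \<in> curve f \<Longrightarrow> unif m P P = 0"
  by (erule unif_eq) simp_all

lemma unif_nonzero: "P \<in> curve f \<Longrightarrow> finite {Q \<in> curve f. unif m P Q = 0}"
proof (erule unif_eq)
  have *: "finite {Q \<in> curve f. lin m A B ch Q = 0}" if "A \<noteq> 0 \<or> B \<noteq> 0" for A B ch
    by (rule finite_subset[OF _ finite_UnI[OF lin_zero_finite[OF that, of ch] chart_infinity[of ch]]]) blast
  {
    fix ch assume "unif m P = snd_coord m ch"
    then show ?thesis using *[of 0 1 ch] by (simp add: lin_def)
  next
    fix ch assume "unif m P = (\<lambda>Q. fst_coord ch Q - fst_coord ch P)"
    then show ?thesis using *[of "[:- fst_coord ch P, 1:]" 0 ch] by (simp add: lin_def)
  }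
qed

lemma unif_divides:
  assumes "reg s P" "s P = 0"
  shows "\<exists>r S. reg r P \<and> finite S \<and> P \<notin> S \<and> (\<forall>Q\<in>curve f - S. s Q = unif m P Q * r Q)"
proof -
  have "P \<in> curve f" using assms by blast
  then show ?thesis
  proof (rule unif_eq)
    fix ch assume *: "in_chart ch P" "snd_coord m ch P = 0" and eq: "unif m P = snd_coord m ch"
    show ?thesis unfolding eq by (rule snd_coord_divides[OF assms *])
  next
    fix ch assume *: "in_chart ch P" "snd_coord m ch P \<noteq> 0"
      and eq: "unif m P = (\<lambda>Q. fst_coord ch Q - fst_coord ch P)"
    show ?thesis unfolding eq by (rule fst_coord_divides[OF assms *])
  qed
qed

lemma uniformizer_unif: "P \<in> curve f \<Longrightarrow> uniformizer f P (unif m P)"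
  by (rule uniformizerI[OF unif_reg unif_self unif_divides])

text \<open>The parameter is the fixed \<open>unif m P\<close>, and the exceptional set is any
  finite set, possibly containing \<open>P\<close>. Orders thus become independent of the domain
  \<open>U\<close> that \<open>has_order_at\<close> carries.\<close>

definition ord_at :: "('a point \<Rightarrow> 'a) \<Rightarrow> 'a point \<Rightarrow> int \<Rightarrow> bool" where
  "ord_at h P n \<longleftrightarrow> (\<exists>e S. reg e P \<and> e P \<noteq> 0 \<and> finite S \<and>
     (\<forall>Q\<in>curve f - S. h Q = e Q * unif m P Q powi n))"

text \<open>Two uniformizers divide each other. The product of the quotients is 1 off a finite set
  and so at \<open>P\<close>, hence they differ by a unit, whose \<open>n\<close>-th power is moved
  into \<open>e\<close>.\<close>

lemma has_order_imp_ord_at: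
  assumes h: "has_order_at f U h P n" and U: "finite (curve f - U)" and P: "P \<in> curve f"
  shows "ord_at h P n"
proof -
  obtain V t e where V: "P \<in> V" "uniformizer f P t" "regular_on f V t" "regular_on f V e"
    "\<forall>Q\<in>V. e Q \<noteq> 0" "\<forall>Q \<in> U \<inter> V - {P}. h Q = e Q * t Q powi n"
    using h unfolding has_order_at_def by blast
  have e: "reg e P" "e P \<noteq> 0" using regular_on_imp_reg[OF V(4,1)] V(1,5) by auto
  have t: "reg t P" "t P = 0" using regular_on_imp_reg[OF V(3,1)] V(2) by (auto simp: uniformizer_def)
  from uniformizer_divides[OF V(2) unif_reg[OF P] unif_self[OF P]]
  obtain r S where r: "reg r P" "finite S" "\<forall>Q\<in>curve f - S. unif m P Q = t Q * r Q" by metis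
  from unif_divides[OF t]
  obtain r' S' where r': "reg r' P" "finite S'" "\<forall>Q\<in>curve f - S'. t Q = unif m P Q * r' Q" by metis
  let ?Z = "{Q \<in> curve f. unif m P Q = 0}"
  have "r' Q * r Q = 1" if Q: "Q \<in> curve f - (S \<union> S' \<union> ?Z)" for Q
  proof -
    have "unif m P Q = t Q * r Q" "t Q = unif m P Q * r' Q" using r(3) r'(3) Q by blast+
    then have "unif m P Q = unif m P Q * (r' Q * r Q)" by (metis mult.assoc)
    then show ?thesis using Q by simp
  qed
  moreover have "finite (S \<union> S' \<union> ?Z)" using r(2) r'(2) unif_nonzero[OF P] by simp
  ultimately have "r' P * r P = 1"
    by (intro reg_eq[OF reg_mult[OF r'(1) r(1)] reg_const[OF P, of 1]])
  then have r'P: "r' P \<noteq> 0" by auto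
  let ?e = "\<lambda>Q. e Q * r' Q powi n"
  let ?S = "S' \<union> (curve f - U) \<union> (curve f - V) \<union> {P}"
  have "reg ?e P" by (rule reg_mult[OF e(1) reg_power_int[OF r'(1) r'P]])
  moreover have "?e P \<noteq> 0" using e(2) r'P by (simp add: power_int_eq_0_iff)
  moreover have "finite ?S" using regular_on_cofinite[OF V(3)] V(1) U r'(2) by (auto simp del: finite_Diff)
  moreover have "h Q = ?e Q * unif m P Q powi n" if Q: "Q \<in> curve f - ?S" for Q
  proof -
    have "h Q = e Q * t Q powi n" using V(6) Q by blast
    moreover have "t Q = unif m P Q * r' Q" using r'(3) Q by blast
    ultimately show ?thesis by (simp add: power_int_mult_distrib)
  qed
  ultimately show ?thesis unfolding ord_at_def
    by (intro exI[of _ ?e] exI[of _ ?S] conjI) (assumption | blast)+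
qed

lemma ord_at_imp_has_order:
  assumes h: "ord_at h P n" and P: "P \<in> curve f"
  shows "has_order_at f U h P n"
proof -
  obtain e S where e: "reg e P" "e P \<noteq> 0" "finite S"
    "\<And>Q. Q \<in> curve f - S \<Longrightarrow> h Q = e Q * unif m P Q powi n"
    using h unfolding ord_at_def by blast
  obtain W where W: "P \<in> W" "regular_on f W e" by (rule reg_imp_regular_on[OF e(1)])
  obtain W' where W': "P \<in> W'" "regular_on f W' (unif m P)" by (rule reg_imp_regular_on[OF unif_reg[OF P]])
  let ?Z = "{Q \<in> curve f. e Q = 0}"
  let ?V = "W \<inter> W' - ((S - {P}) \<union> ?Z)"
  have sub: "W \<subseteq> curve f" using W(2) openin_subset_curve by (simp add: regular_on_def)
  have "curve f - ?V \<subseteq> (curve f - W) \<union> (curve f - W') \<union> S \<union> ?Z" by blast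
  moreover have "finite ((curve f - W) \<union> (curve f - W') \<union> S \<union> ?Z)"
    using regular_on_cofinite[OF W(2)] regular_on_cofinite[OF W'(2)] W(1) W'(1) e(3)
      reg_nonzero_cofinite[OF e(1,2)] by (auto simp del: finite_Diff)
  ultimately have fin: "finite (curve f - ?V)" by (rule finite_subset)
  have subV: "?V \<subseteq> curve f" using sub by blast
  have "regular_on f ?V e"
    by (rule regular_onI[OF subV fin]) (rule regular_on_imp_reg[OF W(2)], blast)
  moreover have "regular_on f ?V (unif m P)"
    by (rule regular_onI[OF subV fin]) (rule regular_on_imp_reg[OF W'(2)], blast)
  moreover have "P \<in> ?V" using W(1) W'(1) e(2) by blast
  moreover have "\<forall>Q\<in>?V. e Q \<noteq> 0" using sub by blast
  moreover have "\<forall>Q \<in> U \<inter> ?V - {P}. h Q = e Q * unif m P Q powi n" using e(4) sub by blast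
  ultimately show ?thesis unfolding has_order_at_def
    using uniformizer_unif[OF P]
    by (intro exI[of _ ?V] exI[of _ "unif m P"] exI[of _ e] conjI) assumption+
qed

lemma ord_at_mult:
  assumes "ord_at g P k" "ord_at h P n" "P \<in> curve f"
  shows "ord_at (\<lambda>Q. g Q * h Q) P (k + n)"
proof -
  obtain e S where e: "reg e P" "e P \<noteq> 0" "finite S"
    "\<And>Q. Q \<in> curve f - S \<Longrightarrow> g Q = e Q * unif m P Q powi k"
    using assms(1) unfolding ord_at_def by blast
  obtain e' S' where e': "reg e' P" "e' P \<noteq> 0" "finite S'"
    "\<And>Q. Q \<in> curve f - S' \<Longrightarrow> h Q = e' Q * unif m P Q powi n"
    using assms(2) unfolding ord_at_def by blast
  let ?S = "S \<union> S' \<union> {Q \<in> curve f. unif m P Q = 0}"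
  have "reg (\<lambda>Q. e Q * e' Q) P" by (rule reg_mult[OF e(1) e'(1)])
  moreover have "finite ?S" using e(3) e'(3) unif_nonzero[OF assms(3)] by blast
  moreover have "g Q * h Q = e Q * e' Q * unif m P Q powi (k + n)" if Q: "Q \<in> curve f - ?S" for Q
  proof -
    have "unif m P Q \<noteq> 0" using Q by blast
    then show ?thesis using e(4)[of Q] e'(4)[of Q] Q by (simp add: power_int_add)
  qed
  ultimately show ?thesis unfolding ord_at_def using e(2) e'(2)
    by (intro exI[of _ "\<lambda>Q. e Q * e' Q"] exI[of _ ?S]) simp
qed

lemma ord_at_inverse:
  assumes "ord_at h P n"
  shows "ord_at (\<lambda>Q. inverse (h Q)) P (- n)"
proof -
  obtain e S where e: "reg e P" "e P \<noteq> 0" "finite S"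
    "\<And>Q. Q \<in> curve f - S \<Longrightarrow> h Q = e Q * unif m P Q powi n"
    using assms(1) unfolding ord_at_def by blast
  have "reg (\<lambda>Q. inverse (e Q)) P" by (rule reg_inverse[OF e(1,2)])
  then show ?thesis unfolding ord_at_def using e
    by (intro exI[of _ "\<lambda>Q. inverse (e Q)"] exI[of _ S]) (simp add: power_int_minus)
qed

lemma ord_at_const: "P \<in> curve f \<Longrightarrow> c \<noteq> 0 \<Longrightarrow> ord_at (\<lambda>_. c) P 0"
  unfolding ord_at_def using reg_const[of P c]
  by (intro exI[of _ "\<lambda>_. c"] exI[of _ "{}"]) simp

text \<open>Having an order at a single point already forces \<open>h\<close> to be nonzero almost
  everywhere, since the unit and the parameter both have finitely many zeros.\<close>

lemma ord_at_nonzero: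
  assumes "ord_at h P n" "P \<in> curve f"
  shows "finite {Q \<in> curve f. h Q = 0}"
proof -
  obtain e S where e: "reg e P" "e P \<noteq> 0" "finite S"
    "\<And>Q. Q \<in> curve f - S \<Longrightarrow> h Q = e Q * unif m P Q powi n"
    using assms(1) unfolding ord_at_def by blast
  have "finite (S \<union> {Q \<in> curve f. e Q = 0} \<union> {Q \<in> curve f. unif m P Q = 0})"
    using e(3) reg_nonzero_cofinite[OF e(1,2)] unif_nonzero[OF assms(2)] by blast
  moreover have "{Q \<in> curve f. h Q = 0} \<subseteq> S \<union> {Q \<in> curve f. e Q = 0} \<union> {Q \<in> curve f. unif m P Q = 0}"
    using e(4) by (auto simp: power_int_eq_0_iff)
  ultimately show ?thesis by (meson finite_subset)
qed

lemma principal_divisor_iff: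
  "principal_divisor f D \<longleftrightarrow> Poly_Mapping.keys D \<subseteq> curve f \<and>
    (\<exists>U h. U \<subseteq> curve f \<and> finite (curve f - U) \<and> (\<forall>P\<in>U. reg h P) \<and>
      (\<forall>P\<in>curve f. ord_at h P (Poly_Mapping.lookup D P)))"
  (is "_ \<longleftrightarrow> ?K \<and> (\<exists>U h. ?Q U h)")
proof
  assume "principal_divisor f D"
  then obtain U h where K: ?K and U: "regular_on f U h" "\<exists>Q\<in>U. h Q \<noteq> 0"
    "\<And>P. P \<in> curve f \<Longrightarrow> has_order_at f U h P (Poly_Mapping.lookup D P)"
    unfolding principal_divisor_def by blast
  have fin: "finite (curve f - U)" using regular_on_cofinite[OF U(1)] U(2) by blast
  have "U \<subseteq> curve f" using U(1) openin_subset_curve by (simp add: regular_on_def)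
  with fin have "?Q U h" using regular_on_imp_reg[OF U(1)] has_order_imp_ord_at[OF U(3) fin] by simp
  with K show "?K \<and> (\<exists>U h. ?Q U h)" by blast
next
  assume "?K \<and> (\<exists>U h. ?Q U h)"
  then obtain U h where K: ?K and U: "U \<subseteq> curve f" "finite (curve f - U)" "\<And>P. P \<in> U \<Longrightarrow> reg h P"
    "\<And>P. P \<in> curve f \<Longrightarrow> ord_at h P (Poly_Mapping.lookup D P)" by blast
  have "regular_on f U h" using U by (intro regular_onI)
  moreover have "\<exists>Q\<in>U. h Q \<noteq> 0"
  proof (rule ccontr)
    assume "\<not> (\<exists>Q\<in>U. h Q \<noteq> 0)"
    then have sub: "curve f \<subseteq> (curve f - U) \<union> {Q \<in> curve f. h Q = 0}" by blast
    obtain P where P: "P \<in> curve f" using infinite_curve by fastforce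
    have "finite ((curve f - U) \<union> {Q \<in> curve f. h Q = 0})"
      using U(2) ord_at_nonzero[OF U(4)[OF P] P] by blast
    then show False using sub infinite_curve finite_subset by blast
  qed
  moreover have "has_order_at f U h P (Poly_Mapping.lookup D P)" if "P \<in> curve f" for P
    using ord_at_imp_has_order[OF U(4)] that by blast
  ultimately show "principal_divisor f D" unfolding principal_divisor_def using K by blast
qed

end

section \<open>The class of the divisor at infinity\<close>

lemma divisor_degree_superset:
  assumes "finite S" "Poly_Mapping.keys D \<subseteq> S"
  shows "divisor_degree D = (\<Sum>P\<in>S. Poly_Mapping.lookup D P)"
  unfolding divisor_degree_def using assms
  by (intro sum.mono_neutral_left) (auto simp: in_keys_iff)

lemma divisor_degree_add: "divisor_degree (D + E) = divisor_degree D + divisor_degree E"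
proof -
  let ?S = "Poly_Mapping.keys D \<union> Poly_Mapping.keys E"
  have "Poly_Mapping.keys (D + E) \<subseteq> ?S" by (rule keys_add)
  then show ?thesis
    using divisor_degree_superset[of ?S "D + E"] divisor_degree_superset[of ?S D]
      divisor_degree_superset[of ?S E] by (simp add: lookup_add sum.distrib)
qed

lemma divisor_degree_uminus: "divisor_degree (- D) = - divisor_degree D"
  using divisor_degree_add[of D "- D"] by (simp add: divisor_degree_def)

lemma degree_zero_divisors_simps:
  "D \<in> carrier (degree_zero_divisors f) \<longleftrightarrow> Poly_Mapping.keys D \<subseteq> curve f \<and> divisor_degree D = 0"
  "D \<otimes>\<^bsub>degree_zero_divisors f\<^esub> E = D + E"
  "\<one>\<^bsub>degree_zero_divisors f\<^esub> = 0"
  by (auto simp: degree_zero_divisors_def free_Abelian_group_def)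

lemma comm_group_degree_zero_divisors: "comm_group (degree_zero_divisors f)"
proof (rule comm_groupI)
  fix D E assume "D \<in> carrier (degree_zero_divisors f)" "E \<in> carrier (degree_zero_divisors f)"
  then show "D \<otimes>\<^bsub>degree_zero_divisors f\<^esub> E \<in> carrier (degree_zero_divisors f)"
    using keys_add[of D E] by (auto simp: degree_zero_divisors_simps divisor_degree_add)
next
  fix D assume "D \<in> carrier (degree_zero_divisors f)"
  then show "\<exists>E\<in>carrier (degree_zero_divisors f). E \<otimes>\<^bsub>degree_zero_divisors f\<^esub> D = \<one>\<^bsub>degree_zero_divisors f\<^esub>"
    by (intro bexI[of _ "- D"]) (auto simp: degree_zero_divisors_simps divisor_degree_uminus)
qed (auto simp: degree_zero_divisors_simps divisor_degree_def add.assoc add.commute)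

section \<open>Principal divisors and the order of a divisor class\<close>

context smooth_curve begin

lemma principal_divisors_iff:
  "D \<in> principal_divisors f \<longleftrightarrow> D \<in> carrier (degree_zero_divisors f) \<and> principal_divisor f D"
  by (simp add: principal_divisors_def)

lemma principal_zero: "principal_divisor f 0"
  unfolding principal_divisor_iff
  by (intro conjI exI[of _ "curve f"] exI[of _ "\<lambda>_. 1"] ballI reg_const) (simp_all add: ord_at_const)

lemma principal_add:
  assumes "principal_divisor f D" "principal_divisor f E"
  shows "principal_divisor f (D + E)"
proof -
  obtain U h where h: "U \<subseteq> curve f" "finite (curve f - U)" "\<And>P. P \<in> U \<Longrightarrow> reg h P"
    "\<And>P. P \<in> curve f \<Longrightarrow> ord_at h P (Poly_Mapping.lookup D P)" and D: "Poly_Mapping.keys D \<subseteq> curve f"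
    using assms(1) unfolding principal_divisor_iff by blast
  obtain V g where g: "V \<subseteq> curve f" "finite (curve f - V)" "\<And>P. P \<in> V \<Longrightarrow> reg g P"
    "\<And>P. P \<in> curve f \<Longrightarrow> ord_at g P (Poly_Mapping.lookup E P)" and E: "Poly_Mapping.keys E \<subseteq> curve f"
    using assms(2) unfolding principal_divisor_iff by blast
  have "Poly_Mapping.keys (D + E) \<subseteq> curve f" using D E keys_add[of D E] by blast
  moreover have "finite (curve f - U \<inter> V)" using h(2) g(2) by (simp add: Diff_Int)
  moreover have "\<forall>P\<in>U \<inter> V. reg (\<lambda>Q. h Q * g Q) P"
  proof
    fix P assume "P \<in> U \<inter> V"
    then show "reg (\<lambda>Q. h Q * g Q) P" by (intro reg_mult h(3) g(3)) simp_all
  qed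
  moreover have "\<forall>P\<in>curve f. ord_at (\<lambda>Q. h Q * g Q) P (Poly_Mapping.lookup (D + E) P)"
  proof
    fix P assume P: "P \<in> curve f"
    show "ord_at (\<lambda>Q. h Q * g Q) P (Poly_Mapping.lookup (D + E) P)"
      unfolding lookup_add by (rule ord_at_mult[OF h(4)[OF P] g(4)[OF P] P])
  qed
  moreover have "U \<inter> V \<subseteq> curve f" using h(1) by blast
  ultimately show ?thesis unfolding principal_divisor_iff
    by (intro conjI exI[of _ "U \<inter> V"] exI[of _ "\<lambda>Q. h Q * g Q"])
qed

lemma principal_uminus:
  assumes "principal_divisor f D"
  shows "principal_divisor f (- D)"
proof -
  obtain U h where h: "U \<subseteq> curve f" "finite (curve f - U)" "\<And>P. P \<in> U \<Longrightarrow> reg h P"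
    "\<And>P. P \<in> curve f \<Longrightarrow> ord_at h P (Poly_Mapping.lookup D P)" and D: "Poly_Mapping.keys D \<subseteq> curve f"
    using assms(1) unfolding principal_divisor_iff by blast
  \<comment> \<open>Zeros of \<open>h\<close> leave the domain: \<open>inverse\<close> returns 0
    there, while the rational function has a pole.\<close>
  let ?U = "U - {Q \<in> curve f. h Q = 0}"
  obtain P where P: "P \<in> curve f" using infinite_curve by fastforce
  have "curve f - ?U \<subseteq> (curve f - U) \<union> {Q \<in> curve f. h Q = 0}" by blast
  then have "finite (curve f - ?U)"
    by (rule finite_subset) (use h(2) ord_at_nonzero[OF h(4)[OF P] P] in simp)
  moreover have "\<forall>P\<in>?U. reg (\<lambda>Q. inverse (h Q)) P"
  proof
    fix P assume P: "P \<in> ?U"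
    then have "h P \<noteq> 0" using h(1) by blast
    with P show "reg (\<lambda>Q. inverse (h Q)) P" by (intro reg_inverse h(3)) simp_all
  qed
  moreover have "\<forall>P\<in>curve f. ord_at (\<lambda>Q. inverse (h Q)) P (Poly_Mapping.lookup (- D) P)"
    using ord_at_inverse[OF h(4)] by simp
  moreover have "?U \<subseteq> curve f" using h(1) by blast
  moreover have "Poly_Mapping.keys (- D) \<subseteq> curve f" using D by simp
  ultimately show ?thesis unfolding principal_divisor_iff
    by (intro conjI exI[of _ ?U] exI[of _ "\<lambda>Q. inverse (h Q)"])
qed

lemma normal_principal_divisors: "principal_divisors f \<lhd> degree_zero_divisors f"
proof -
  interpret D: comm_group "degree_zero_divisors f" by (rule comm_group_degree_zero_divisors)
  have "subgroup (principal_divisors f) (degree_zero_divisors f)"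
  proof (rule D.subgroupI)
    show "principal_divisors f \<subseteq> carrier (degree_zero_divisors f)"
      by (auto simp: principal_divisors_iff)
    show "principal_divisors f \<noteq> {}"
      using principal_zero D.one_closed by (auto simp: principal_divisors_iff degree_zero_divisors_simps(3))
  next
    fix E assume E: "E \<in> principal_divisors f"
    have "inv\<^bsub>degree_zero_divisors f\<^esub> E = - E"
      using E by (intro D.inv_equality)
        (auto simp: principal_divisors_iff degree_zero_divisors_simps divisor_degree_uminus)
    then show "inv\<^bsub>degree_zero_divisors f\<^esub> E \<in> principal_divisors f"
      using E principal_uminus[of E]
      by (simp add: principal_divisors_iff degree_zero_divisors_simps divisor_degree_uminus)
  next
    fix E F assume "E \<in> principal_divisors f" "F \<in> principal_divisors f"
    then show "E \<otimes>\<^bsub>degree_zero_divisors f\<^esub> F \<in> principal_divisors f"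
      using principal_add[of E F] D.m_closed[of E F] by (simp add: principal_divisors_iff degree_zero_divisors_simps(2))
  qed
  then show ?thesis by (simp add: D.normal_iff_subgroup)
qed

lemma ord_divisor_class_prime:
  assumes D: "D \<in> carrier (degree_zero_divisors f)" and p: "prime p"
    and 1: "\<not> principal_divisor f D" and 2: "principal_divisor f (frag_cmul (int p) D)"
  shows "group.ord (jacobian f) (divisor_class f D) = p"
proof -
  interpret G: comm_group "degree_zero_divisors f" by (rule comm_group_degree_zero_divisors)
  interpret N: normal "principal_divisors f" "degree_zero_divisors f" by (rule normal_principal_divisors)
  interpret J: group "jacobian f" unfolding jacobian_def by (rule N.factorgroup_is_group)
  have hom: "divisor_class f \<in> hom (degree_zero_divisors f) (jacobian f)"
    using N.r_coset_hom_Mod by (simp add: jacobian_def divisor_class_def[abs_def])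
  then interpret H: group_hom "degree_zero_divisors f" "jacobian f" "divisor_class f"
    by (simp add: group_hom_def group_hom_axioms_def G.is_group J.is_group)
  have pow: "D [^]\<^bsub>degree_zero_divisors f\<^esub> n = frag_cmul (int n) D" for n :: nat
    by (induction n) (simp_all add: degree_zero_divisors_simps frag_cmul_distrib add.commute)
  have cl: "divisor_class f D \<in> carrier (jacobian f)" using D by simp
  have one: "divisor_class f E = \<one>\<^bsub>jacobian f\<^esub> \<longleftrightarrow> principal_divisor f E"
    if "E \<in> carrier (degree_zero_divisors f)" for E
    using that G.coset_join1[OF _ that N.subgroup_axioms] G.coset_join2[OF that N.subgroup_axioms]
    by (auto simp: divisor_class_def jacobian_def FactGroup_def principal_divisors_iff)
  have "divisor_class f (D [^]\<^bsub>degree_zero_divisors f\<^esub> p) = \<one>\<^bsub>jacobian f\<^esub>"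
    using one[OF G.nat_pow_closed[OF D]] 2 unfolding pow by blast
  then have "divisor_class f D [^]\<^bsub>jacobian f\<^esub> p = \<one>\<^bsub>jacobian f\<^esub>"
    using H.hom_nat_pow[OF D, of p] by simp
  then have "J.ord (divisor_class f D) dvd p" using J.pow_eq_id[OF cl] by simp
  moreover have "J.ord (divisor_class f D) \<noteq> 1" using J.ord_eq_1[OF cl] one[OF D] 1 by simp
  ultimately show ?thesis using p by (metis prime_nat_iff)
qed

text \<open>The coordinate ring \<open>k[x,y]/(y\<^sup>2 - f)\<close> of a smooth affine curve is integrally closed:
  a denominator of minimal degree cannot vanish anywhere.\<close>

lemma regular_affine_imp_lin:
  assumes h: "\<And>P. P \<in> curve f \<Longrightarrow> in_chart XY_Chart P \<Longrightarrow>
    \<exists>r S. reg r P \<and> finite S \<and> (\<forall>Q\<in>curve f - S. h Q = r Q)"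
  shows "\<exists>A B S. finite S \<and> (\<forall>Q\<in>curve f - S. h Q = lin m A B XY_Chart Q)"
proof -
  let ?x = "fst_coord XY_Chart" and ?y = "snd_coord m XY_Chart"
  let ?R = "\<lambda>C. C \<noteq> 0 \<and> (\<exists>A B S. finite S \<and>
    (\<forall>Q\<in>curve f - S. h Q * poly C (?x Q) = lin m A B XY_Chart Q))"
  have affine: "Affine a b \<in> curve f \<longleftrightarrow> b ^ 2 = poly f a" for a b by (auto simp: curve_def)
  have hE: thesis
    if "Affine a b \<in> curve f"
      and "\<And>r S. reg r (Affine a b) \<Longrightarrow> finite S \<Longrightarrow> \<forall>Q\<in>curve f - S. h Q = r Q \<Longrightarrow> thesis"
    for a b thesis
    using h[OF that(1)] that(2) by (metis in_chart.simps(1))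
  have "\<exists>C. ?R C"
  proof -
    obtain b where "b ^ 2 = poly f 0" using nth_root_exists[of 2 "poly f 0"] by auto
    then have P: "Affine 0 b \<in> curve f" by (simp add: affine)
    obtain r S where r: "reg r (Affine 0 b)" "finite S" "\<forall>Q\<in>curve f - S. h Q = r Q" by (rule hE[OF P])
    have "reg_at f XY_Chart r (Affine 0 b)" using reg_in_chart[OF r(1), of XY_Chart] by simp
    then obtain A B C D where AD: "lin m C D XY_Chart (Affine 0 b) \<noteq> 0"
      "\<And>Q. Q \<in> curve f \<Longrightarrow> in_chart XY_Chart Q \<Longrightarrow> lin m C D XY_Chart Q \<noteq> 0 \<Longrightarrow>
        r Q = lin m A B XY_Chart Q / lin m C D XY_Chart Q" unfolding reg_at_iff by blast
    let ?T = "S \<union> {Q \<in> curve f. \<not> (in_chart XY_Chart Q \<and> lin m C D XY_Chart Q \<noteq> 0)}"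
    have T: "finite ?T" using lin_nonzero_cofinite[OF P _ AD(1)] r(2) by simp
    \<comment> \<open>Expanding by the conjugate \<open>C - D y\<close> leaves a denominator in
      \<open>x\<close> alone, the norm, which is nonzero by irreducibility.\<close>
    let ?C = "C * C - D * D * f"
    have "C \<noteq> 0 \<or> D \<noteq> 0" using AD(1) by (auto simp: lin_def)
    have "?C \<noteq> 0"
    proof
      assume "?C = 0"
      then have "C * C = D * D * chart_poly XY_Chart f" by (simp add: chart_poly_def)
      from norm_eq_0_imp[OF this] show False using \<open>C \<noteq> 0 \<or> D \<noteq> 0\<close> by simp
    qed
    obtain A' B' where AB': "\<And>Q. Q \<in> curve f \<Longrightarrow> in_chart XY_Chart Q \<Longrightarrow>
        lin m A B XY_Chart Q * lin m C (- D) XY_Chart Q = lin m A' B' XY_Chart Q"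
      using lin_mult by meson
    have "h Q * poly ?C (?x Q) = lin m A' B' XY_Chart Q" if "Q \<in> curve f - ?T" for Q
    proof -
      have Q: "Q \<in> curve f" "in_chart XY_Chart Q" "lin m C D XY_Chart Q \<noteq> 0" "Q \<notin> S" using that by auto
      have "poly ?C (?x Q) = lin m C D XY_Chart Q * lin m C (- D) XY_Chart Q"
        using snd_coord_sq[OF Q(1,2)] by (simp add: lin_def chart_poly_def algebra_simps power2_eq_square)
      then show ?thesis using AD(2)[OF Q(1-3)] r(3) Q(1,3,4) AB'[OF Q(1,2)] by simp
    qed
    then have "?R ?C"
      using T \<open>?C \<noteq> 0\<close> by (intro conjI exI[of _ A'] exI[of _ B'] exI[of _ ?T] ballI)
    then show ?thesis ..
  qed
  then obtain C0 where "?R C0" ..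
  from ex_has_least_nat[of ?R, OF this, of degree] obtain C where
    Cmin: "?R C \<and> (\<forall>C'. ?R C' \<longrightarrow> degree C \<le> degree C')" ..
  note C = conjunct1[OF Cmin] and min = conjunct2[OF Cmin]
  from C obtain A B S where AB: "C \<noteq> 0" "finite S"
    "\<forall>Q\<in>curve f - S. h Q * poly C (?x Q) = lin m A B XY_Chart Q" by (elim conjE exE)
  have "degree C = 0"
  proof (rule ccontr)
    assume "degree C \<noteq> 0"
    then obtain a where a: "poly C a = 0" using alg_closed_imp_poly_has_root by blast
    then obtain C1 where C1: "C = [:- a, 1:] * C1" unfolding poly_eq_0_iff_dvd by (elim dvdE)
    \<comment> \<open>\<open>h\<close> is regular at every point over the root \<open>a\<close> of
      \<open>C\<close>, so \<open>h C\<close>, and with it the numerator, vanishes there. The aim is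
      to cancel \<open>x - a\<close> against the minimality of \<open>C\<close>.\<close>
    have vanish: "poly A a + poly B a * b = 0" if b: "b ^ 2 = poly f a" for b
    proof -
      have P: "Affine a b \<in> curve f" using b by (simp add: affine)
      obtain r T where r: "reg r (Affine a b)" "finite T" "\<forall>Q\<in>curve f - T. h Q = r Q" by (rule hE[OF P])
      have "r (Affine a b) * lin m C 0 XY_Chart (Affine a b) = lin m A B XY_Chart (Affine a b)"
      proof (rule reg_eq[of _ "\<lambda>Q. r Q * lin m C 0 XY_Chart Q" "lin m A B XY_Chart" "S \<union> T"])
        show "reg (\<lambda>Q. r Q * lin m C 0 XY_Chart Q) (Affine a b)"
          by (rule reg_mult[OF r(1) reg_lin[OF P]]) simp
        show "reg (lin m A B XY_Chart) (Affine a b)" by (rule reg_lin[OF P]) simp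
        fix Q assume "Q \<in> curve f - (S \<union> T)"
        then show "r Q * lin m C 0 XY_Chart Q = lin m A B XY_Chart Q"
          using bspec[OF AB(3), of Q] bspec[OF r(3), of Q] by (simp add: lin_def)
      qed (use AB(2) r(2) in simp)
      then show ?thesis using a by (simp add: lin_def)
    qed
    obtain b where b: "b ^ 2 = poly f a" using nth_root_exists[of 2 "poly f a"] by auto
    have ab: "poly A a + poly B a * b = 0" "poly A a - poly B a * b = 0"
      using vanish[OF b] vanish[of "- b"] b by auto
    have zero: "poly A a = 0 \<and> poly B a = 0"
    proof (cases "b = 0")
      case False
      have "poly A a = - (poly B a * b)" "poly A a = poly B a * b" using ab by (simp_all add: add_eq_0_iff2)
      then have "2 * (poly B a * b) = 0" by (metis mult_2 add.left_inverse)
      then show ?thesis using False ab by simp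
    next
      \<comment> \<open>Over a branch point there is only one point, which yields
        \<open>A(a) = 0\<close> alone. Multiplying by \<open>F\<close> turns \<open>x - a\<close>
        into \<open>y^2\<close>, and cancelling one \<open>y\<close> exposes
        \<open>B(a) F(a) = 0\<close>.\<close>
      case True
      then have A0: "poly A a = 0" using ab by simp
      then obtain A1 where A1: "A = [:- a, 1:] * A1" unfolding poly_eq_0_iff_dvd by (elim dvdE)
      have "poly f a = 0" using b True by simp
      then obtain F where F: "f = [:- a, 1:] * F" "poly F a \<noteq> 0" by (rule simple_factor)
      have P: "Affine a 0 \<in> curve f" using b True by (simp add: affine)
      obtain r T where r: "reg r (Affine a 0)" "finite T" "\<forall>Q\<in>curve f - T. h Q = r Q" by (rule hE[OF P])
      let ?Y = "{Q \<in> curve f. \<not> in_chart XY_Chart Q} \<union> {Q \<in> curve f. in_chart XY_Chart Q \<and> lin m 0 1 XY_Chart Q = 0}"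
      have Y: "finite ?Y" using chart_infinity lin_zero_finite[of 0 1] by simp
      have "r (Affine a 0) * lin m 0 C1 XY_Chart (Affine a 0) = lin m (B * F) A1 XY_Chart (Affine a 0)"
      proof (rule reg_eq[of _ "\<lambda>Q. r Q * lin m 0 C1 XY_Chart Q" "lin m (B * F) A1 XY_Chart" "S \<union> T \<union> ?Y"])
        show "reg (\<lambda>Q. r Q * lin m 0 C1 XY_Chart Q) (Affine a 0)"
          by (rule reg_mult[OF r(1) reg_lin[OF P]]) simp
        show "reg (lin m (B * F) A1 XY_Chart) (Affine a 0)" by (rule reg_lin[OF P]) simp
        fix Q assume Q: "Q \<in> curve f - (S \<union> T \<union> ?Y)"
        then have y: "?y Q \<noteq> 0" and Qc: "Q \<in> curve f" "in_chart XY_Chart Q" by (auto simp: lin_def)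
        have "h Q = r Q" using r(3) Q by blast
        then have eq: "r Q * ((?x Q - a) * poly C1 (?x Q)) = (?x Q - a) * poly A1 (?x Q) + poly B (?x Q) * ?y Q"
          using bspec[OF AB(3), of Q] Q unfolding C1 A1 by (simp add: lin_def algebra_simps)
        have sq: "(?x Q - a) * poly F (?x Q) = ?y Q * ?y Q"
          using snd_coord_sq[OF Qc] by (simp add: F(1) chart_poly_def algebra_simps power2_eq_square)
        have "?y Q * (r Q * lin m 0 C1 XY_Chart Q) = (?y Q * ?y Q) * (r Q * poly C1 (?x Q))"
          by (simp add: lin_def mult_ac)
        also have "\<dots> = poly F (?x Q) * (r Q * ((?x Q - a) * poly C1 (?x Q)))"
          unfolding sq[symmetric] by (simp only: mult_ac)
        also have "\<dots> = (?x Q - a) * poly F (?x Q) * poly A1 (?x Q) + poly B (?x Q) * poly F (?x Q) * ?y Q"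
          unfolding eq by (simp add: algebra_simps)
        also have "\<dots> = ?y Q * lin m (B * F) A1 XY_Chart Q"
          unfolding sq by (simp add: lin_def algebra_simps)
        finally have "?y Q * (r Q * lin m 0 C1 XY_Chart Q) = ?y Q * lin m (B * F) A1 XY_Chart Q" .
        then show "r Q * lin m 0 C1 XY_Chart Q = lin m (B * F) A1 XY_Chart Q" using y by simp
      qed (use AB(2) r(2) Y in simp)
      then show ?thesis using A0 F(2) by (simp add: lin_def)
    qed
    then obtain A1 B1 where A1: "A = [:- a, 1:] * A1" "B = [:- a, 1:] * B1"
      unfolding poly_eq_0_iff_dvd by (elim conjE dvdE)
    have "C1 \<noteq> 0" using C1 AB(1) by auto
    let ?Y = "{Q \<in> curve f. \<not> in_chart XY_Chart Q} \<union>
      {Q \<in> curve f. in_chart XY_Chart Q \<and> lin m [:- a, 1:] 0 XY_Chart Q = 0}"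
    have Y: "finite (S \<union> ?Y)" using chart_infinity lin_zero_finite[of "[:- a, 1:]" 0] AB(2) by simp
    have "h Q * poly C1 (?x Q) = lin m A1 B1 XY_Chart Q" if Q: "Q \<in> curve f - (S \<union> ?Y)" for Q
    proof -
      have "?x Q - a \<noteq> 0" using Q by (auto simp: lin_def)
      moreover have "(?x Q - a) * (h Q * poly C1 (?x Q)) = (?x Q - a) * lin m A1 B1 XY_Chart Q"
        using bspec[OF AB(3), of Q] Q unfolding C1 A1 by (simp add: lin_def algebra_simps)
      ultimately show ?thesis by simp
    qed
    then have "?R C1"
      using \<open>C1 \<noteq> 0\<close> Y by (intro conjI exI[of _ A1] exI[of _ B1] exI[of _ "S \<union> ?Y"] ballI)
    then have "degree C \<le> degree C1" using min by simp
    moreover have "degree C = 1 + degree C1" unfolding C1 using \<open>C1 \<noteq> 0\<close> by (subst degree_mult_eq) auto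
    ultimately show False by simp
  qed
  then obtain c where c: "C = [:c:]" by (rule degree_eq_zeroE)
  then have "c \<noteq> 0" using AB(1) by auto
  have "h Q = lin m (smult (inverse c) A) (smult (inverse c) B) XY_Chart Q" if "Q \<in> curve f - S" for Q
    using bspec[OF AB(3) that] \<open>c \<noteq> 0\<close> unfolding c by (simp add: lin_def field_simps)
  with AB(2) show ?thesis by blast
qed

lemma lin_at_infinity:
  assumes "degree A \<le> n" "B = 0 \<or> degree B + m \<le> n" "in_chart XY_Chart Q" "in_chart ZW_Chart Q"
  shows "fst_coord ZW_Chart Q ^ n * lin m A B XY_Chart Q =
    lin m (monom 1 (n - degree A) * reflect_poly A) (monom 1 (n - (m + degree B)) * reflect_poly B) ZW_Chart Q"
proof -
  note c = chart_change[OF assms(4,3) chart.distinct(2)]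
  let ?z = "fst_coord ZW_Chart Q"
  have pow: "?z ^ n / ?z ^ d = ?z ^ (n - d)" if "d \<le> n" for d
    using c(1) that by (simp add: power_diff)
  \<comment> \<open>For \<open>B = 0\<close> the exponent \<open>n - (m + degree B)\<close> may be a
    truncated subtraction; the zero polynomial makes this harmless.\<close>
  have B: "(?z ^ n / ?z ^ (m + degree B)) * poly (reflect_poly B) ?z =
      ?z ^ (n - (m + degree B)) * poly (reflect_poly B) ?z"
  proof (cases "B = 0")
    case False
    then have "m + degree B \<le> n" using assms(2) by simp
    then show ?thesis by (simp only: pow)
  qed simp
  have "?z ^ n * lin m A B XY_Chart Q = (?z ^ n / ?z ^ degree A) * poly (reflect_poly A) ?z
      + (?z ^ n / ?z ^ (m + degree B)) * poly (reflect_poly B) ?z * snd_coord m ZW_Chart Q"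
    unfolding lin_def c(2,3) poly_inverse_arg[OF c(1)] by (simp add: algebra_simps power_add)
  also have "\<dots> = ?z ^ (n - degree A) * poly (reflect_poly A) ?z
      + ?z ^ (n - (m + degree B)) * poly (reflect_poly B) ?z * snd_coord m ZW_Chart Q"
    by (simp only: pow[OF assms(1)] B)
  finally show ?thesis by (simp add: lin_def poly_monom)
qed

lemma infinity_in_curve: "Infinity 1 \<in> curve f" "Infinity (- 1) \<in> curve f"
  using curve_infinity by auto

text \<open>If the pole order \<open>n\<close> of the expression exceeded \<open>k\<close>, the
  coefficients of \<open>z^(-n)\<close> at the two points at infinity, where \<open>w\<close> is 1
  and -1, would vanish. They are the sum and the difference of the contributions of \<open>A\<close>
  and \<open>B y\<close>, so both contributions would be zero. The summand \<open>m\<close> is the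
  pole order of \<open>y\<close>.\<close>

lemma degree_le_at_infinity:
  assumes S: "finite S" "\<And>Q. Q \<in> curve f - S \<Longrightarrow> h Q = lin m A B XY_Chart Q"
    and r: "\<And>c. c = 1 \<or> c = -1 \<Longrightarrow> \<exists>r T. reg r (Infinity c) \<and> finite T \<and>
      (\<forall>Q\<in>curve f - T. fst_coord ZW_Chart Q ^ k * h Q = r Q)"
  shows "degree A \<le> k \<and> (B = 0 \<or> degree B + m \<le> k)"
proof (rule ccontr)
  assume neg: "\<not> ?thesis"
  define n where "n = max (degree A) (if B = 0 then 0 else degree B + m)"
  have nk: "k < n" using neg by (auto simp: n_def)
  have n: "degree A \<le> n" "B = 0 \<or> degree B + m \<le> n" by (auto simp: n_def)
  let ?A = "monom 1 (n - degree A) * reflect_poly A"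
  let ?B = "monom 1 (n - (m + degree B)) * reflect_poly B"
  let ?C = "{Q \<in> curve f. \<not> in_chart XY_Chart Q} \<union> {Q \<in> curve f. \<not> in_chart ZW_Chart Q}"
  have C: "finite ?C" using chart_infinity by simp
  have vanish: "poly ?A 0 + poly ?B 0 * c = 0" if c: "c = 1 \<or> c = -1" for c
  proof -
    have P: "Infinity c \<in> curve f" using c curve_infinity by simp
    obtain r T where rT: "reg r (Infinity c)" "finite T"
      "\<forall>Q\<in>curve f - T. fst_coord ZW_Chart Q ^ k * h Q = r Q" using r[OF c] by metis
    let ?g = "\<lambda>Q. lin m (monom 1 (n - k)) 0 ZW_Chart Q * r Q"
    have "?g (Infinity c) = lin m ?A ?B ZW_Chart (Infinity c)"
    proof (rule reg_eq[of _ ?g "lin m ?A ?B ZW_Chart" "S \<union> T \<union> ?C"])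
      show "reg ?g (Infinity c)" by (rule reg_mult[OF reg_lin[OF P] rT(1)]) simp
      show "reg (lin m ?A ?B ZW_Chart) (Infinity c)" by (rule reg_lin[OF P]) simp
      show "finite (S \<union> T \<union> ?C)" using S(1) rT(2) C by simp
      fix Q assume Q: "Q \<in> curve f - (S \<union> T \<union> ?C)"
      then have "lin m ?A ?B ZW_Chart Q = fst_coord ZW_Chart Q ^ n * lin m A B XY_Chart Q"
        by (intro lin_at_infinity[OF n, symmetric]) auto
      also have "\<dots> = fst_coord ZW_Chart Q ^ (n - k) * (fst_coord ZW_Chart Q ^ k * h Q)"
        using S(2)[of Q] Q nk by (simp flip: power_add)
      also have "\<dots> = ?g Q" using rT(3) Q by (simp add: lin_def poly_monom)
      finally show "?g Q = lin m ?A ?B ZW_Chart Q" ..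
    qed
    moreover have "n - k > 0" using nk by simp
    ultimately show ?thesis by (simp add: lin_def poly_monom zero_power)
  qed
  have "poly ?A 0 + poly ?B 0 = 0" "poly ?A 0 = poly ?B 0" using vanish[of 1] vanish[of "-1"] by simp_all
  then have A0: "poly ?A 0 = 0" and B0: "poly ?B 0 = 0" by (simp_all flip: mult_2)
  show False
  proof (cases "n = degree A")
    case True
    then show False using A0 nk by (auto simp: poly_reflect_poly_0 poly_monom)
  next
    case False
    then have "B \<noteq> 0" "n = m + degree B" by (auto simp: n_def split: if_splits)
    then show False using B0 by (simp add: poly_reflect_poly_0 poly_monom)
  qed
qed

lemma lookup_infinity:
  "Poly_Mapping.lookup divisor_at_infinity P =
    (if P = Infinity (1 :: 'a) then 1 else if P = Infinity (-1) then -1 else 0)"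
  by (auto simp: divisor_at_infinity_def lookup_minus)

lemma keys_infinity: "Poly_Mapping.keys (divisor_at_infinity :: 'a point \<Rightarrow>\<^sub>0 int) = {Infinity 1, Infinity (- 1)}"
  by (auto simp: in_keys_iff lookup_infinity split: if_splits)

lemma infinity_degree_zero: "divisor_at_infinity \<in> carrier (degree_zero_divisors f)"
  using infinity_in_curve
  by (simp add: degree_zero_divisors_simps keys_infinity divisor_degree_def lookup_infinity)

text \<open>A function with divisor \<open>P - Q\<close> would be a polynomial in \<open>x\<close> of degree at most one.\<close>

lemma infinity_not_principal:
  assumes "m \<ge> 2"
  shows "\<not> principal_divisor f divisor_at_infinity"
proof
  assume "principal_divisor f divisor_at_infinity"
  then obtain h where ord: "\<forall>P\<in>curve f. ord_at h P (Poly_Mapping.lookup divisor_at_infinity P)"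
    unfolding principal_divisor_iff by (elim conjE exE)
  let ?z = "fst_coord ZW_Chart"
  have z: "unif m (Infinity c) = ?z" for c :: 'a by (rule ext) simp
  have ordI: "\<exists>e S. reg e (Infinity c) \<and> finite S \<and> (\<forall>Q\<in>curve f - S. h Q = e Q * ?z Q powi c')"
    if "c = 1 \<and> c' = 1 \<or> c = -1 \<and> c' = -1" for c c'
  proof -
    have P: "Infinity c \<in> curve f" using infinity_in_curve that by blast
    have "ord_at h (Infinity c) (Poly_Mapping.lookup divisor_at_infinity (Infinity c))"
      by (rule bspec[OF ord P])
    moreover have "Poly_Mapping.lookup divisor_at_infinity (Infinity c) = c'"
      using that by (auto simp: lookup_infinity)
    ultimately have "ord_at h (Infinity c) c'" by simp
    then show ?thesis unfolding ord_at_def z by metis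
  qed
  obtain e S where e: "reg e (Infinity 1)" "finite S" "\<forall>Q\<in>curve f - S. h Q = e Q * ?z Q powi 1"
    using ordI[of 1 1] by metis
  obtain e' S' where e': "reg e' (Infinity (-1))" "finite S'" "\<forall>Q\<in>curve f - S'. h Q = e' Q * ?z Q powi (-1)"
    using ordI[of "-1" "-1"] by metis
  have "\<exists>A B S. finite S \<and> (\<forall>Q\<in>curve f - S. h Q = lin m A B XY_Chart Q)"
  proof (rule regular_affine_imp_lin)
    fix P assume P: "P \<in> curve f" "in_chart XY_Chart P"
    then have "Poly_Mapping.lookup divisor_at_infinity P = 0"
      by (cases P) (simp_all add: lookup_infinity)
    then have "ord_at h P 0" using bspec[OF ord P(1)] by simp
    then obtain e S where "reg e P" "finite S" "\<forall>Q\<in>curve f - S. h Q = e Q * unif m P Q powi 0"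
      unfolding ord_at_def by metis
    then show "\<exists>r S. reg r P \<and> finite S \<and> (\<forall>Q\<in>curve f - S. h Q = r Q)"
      by (intro exI[of _ e] exI[of _ S]) simp
  qed
  then obtain A B T where AB: "finite T" "\<forall>Q\<in>curve f - T. h Q = lin m A B XY_Chart Q"
    by (elim exE conjE)
  have zreg: "reg ?z (Infinity c)" if "c = 1 \<or> c = -1" for c
    using unif_reg[of "Infinity c"] that curve_infinity unfolding z by simp
  let ?Z = "{Q \<in> curve f. ?z Q = 0}"
  have Z: "finite ?Z" using unif_nonzero[OF infinity_in_curve(1)] unfolding z .
  have deg: "degree A \<le> 1 \<and> (B = 0 \<or> degree B + m \<le> 1)"
  proof (rule degree_le_at_infinity)
    show "finite T" by fact
    show "h Q = lin m A B XY_Chart Q" if "Q \<in> curve f - T" for Q using AB(2) that by blast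
    fix c :: 'a assume c: "c = 1 \<or> c = -1"
    show "\<exists>r T. reg r (Infinity c) \<and> finite T \<and> (\<forall>Q\<in>curve f - T. ?z Q ^ 1 * h Q = r Q)"
    proof (cases "c = 1")
      case True
      have "reg (\<lambda>Q. ?z Q * (e Q * ?z Q)) (Infinity c)"
        using zreg[OF c] e(1) unfolding True by (intro reg_mult)
      then show ?thesis using e(2,3) by (intro exI[of _ "\<lambda>Q. ?z Q * (e Q * ?z Q)"] exI[of _ S]) simp
    next
      case False
      then have c': "c = -1" using c by simp
      have "\<forall>Q\<in>curve f - (S' \<union> ?Z). ?z Q ^ 1 * h Q = e' Q"
      proof
        fix Q assume Q: "Q \<in> curve f - (S' \<union> ?Z)"
        then have "h Q = e' Q * ?z Q powi (-1)" using e'(3) by blast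
        then show "?z Q ^ 1 * h Q = e' Q" using Q by simp
      qed
      then show ?thesis using e'(1,2) Z unfolding c' by (intro exI[of _ e'] exI[of _ "S' \<union> ?Z"]) simp
    qed
  qed
  then have B: "B = 0" using assms by auto
  obtain a A' where A': "A = pCons a A'" by (cases A)
  have "degree A' = 0" using deg by (cases "A' = 0") (simp_all add: A')
  then obtain b where "A' = [:b:]" by (rule degree_eq_zeroE)
  with A' have A: "A = [:a, b:]" by simp
  let ?C = "{Q \<in> curve f. \<not> in_chart XY_Chart Q} \<union> {Q \<in> curve f. \<not> in_chart ZW_Chart Q}"
  have C: "finite ?C" using chart_infinity by simp
  have zh: "a * ?z Q + b = ?z Q * (e Q * ?z Q)" if Q: "Q \<in> curve f - (S \<union> T \<union> ?C)" for Q
  proof -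
    have "in_chart ZW_Chart Q" "in_chart XY_Chart Q" using Q by blast+
    note c = chart_change[OF this chart.distinct(2)]
    have "h Q = a + b / ?z Q" using AB(2) Q unfolding A B by (simp add: lin_def c(2))
    then have "?z Q * h Q = a * ?z Q + b" using c(1) by (simp add: algebra_simps)
    moreover have "h Q = e Q * ?z Q" using e(3) Q by simp
    ultimately show ?thesis by simp
  qed
  have P: "Infinity 1 \<in> curve f" by (rule infinity_in_curve)
  have fin: "finite (S \<union> T \<union> ?C \<union> ?Z)" using e(2) AB(1) C Z by simp
  \<comment> \<open>Here \<open>h = a + b/z\<close> has a zero at \<open>Infinity 1\<close>.
    Evaluating \<open>z h\<close> gives \<open>b = 0\<close>; after cancelling \<open>z\<close>,
    evaluating \<open>h\<close> gives \<open>a = 0\<close>.\<close>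
  have "a * ?z (Infinity 1) + b = ?z (Infinity 1) * (e (Infinity 1) * ?z (Infinity 1))"
  proof (rule reg_eq[of _ "\<lambda>Q. a * ?z Q + b" "\<lambda>Q. ?z Q * (e Q * ?z Q)" "S \<union> T \<union> ?C \<union> ?Z"])
    show "reg (\<lambda>Q. a * ?z Q + b) (Infinity 1)"
      using reg_lin[OF P, of ZW_Chart "[:b, a:]" 0] by (simp add: lin_def[abs_def] algebra_simps)
    show "reg (\<lambda>Q. ?z Q * (e Q * ?z Q)) (Infinity 1)"
      using zreg[of 1] e(1) by (intro reg_mult) simp_all
  qed (use fin zh in auto)
  then have b: "b = 0" by simp
  have "a = e (Infinity 1) * ?z (Infinity 1)"
  proof (rule reg_eq[of _ "\<lambda>Q. a" "\<lambda>Q. e Q * ?z Q" "S \<union> T \<union> ?C \<union> ?Z"])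
    show "reg (\<lambda>Q. a) (Infinity 1)" by (rule reg_const[OF P])
    show "reg (\<lambda>Q. e Q * ?z Q) (Infinity 1)"
      using zreg[of 1] e(1) by (intro reg_mult) simp_all
    fix Q assume Q: "Q \<in> curve f - (S \<union> T \<union> ?C \<union> ?Z)"
    then have "?z Q \<noteq> 0" by blast
    moreover have "a * ?z Q = (e Q * ?z Q) * ?z Q" using zh[of Q] Q b by (simp add: mult.commute)
    ultimately show "a = e Q * ?z Q" by simp
  qed (fact fin)
  then have "a = 0" by simp
  then have "h Q = 0" if "Q \<in> curve f - T" for Q using AB(2) that unfolding A B b by (simp add: lin_def)
  then have "curve f \<subseteq> T \<union> {Q \<in> curve f. h Q = 0}" by blast
  moreover have "ord_at h (Infinity 1) 1" using bspec[OF ord P] by (simp add: lookup_infinity)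
  then have "finite (T \<union> {Q \<in> curve f. h Q = 0})" using ord_at_nonzero[OF _ P] AB(1) by simp
  ultimately show False using infinite_curve finite_subset by blast
qed

lemma ord_atI:
  assumes "reg e P" "e P \<noteq> 0" "finite S" "\<And>Q. Q \<in> curve f - S \<Longrightarrow> h Q = e Q * unif m P Q powi n"
  shows "ord_at h P n"
  unfolding ord_at_def using assms by (intro exI[of _ e] exI[of _ S]) simp

text \<open>A solution of the Pell equation \<open>A\<^sup>2 - f B\<^sup>2 = c\<close> is a unit \<open>A + B y\<close> of the affine
  coordinate ring, so its divisor is supported at infinity.\<close>

lemma pell_principal_signed:
  assumes pell: "A * A - B * B * f = [:c:]" and c: "c \<noteq> 0" and n: "degree A = n" "n > 0"
    and B: "B \<noteq> 0" "degree B + m = n" and lc: "lead_coeff A + lead_coeff B = 0"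
  shows "principal_divisor f (frag_cmul (int n) divisor_at_infinity)"
proof -
  let ?h = "lin m A B XY_Chart" and ?z = "fst_coord ZW_Chart"
  let ?E = "lin m (reflect_poly A) (reflect_poly B) ZW_Chart"
  let ?F = "lin m (reflect_poly A) (- reflect_poly B) ZW_Chart"
  let ?U = "{P \<in> curve f. in_chart XY_Chart P}"
  let ?C = "{Q \<in> curve f. \<not> in_chart XY_Chart Q} \<union> {Q \<in> curve f. \<not> in_chart ZW_Chart Q}"
  have C: "finite ?C" using chart_infinity by simp
  have z: "unif m (Infinity a) = ?z" for a :: 'a by (rule ext) simp
  have norm: "lin m A B XY_Chart Q * lin m A (- B) XY_Chart Q = c" if "Q \<in> ?U" for Q
  proof -
    have "lin m A B XY_Chart Q * lin m A (- B) XY_Chart Q = poly (A * A - B * B * f) (fst_coord XY_Chart Q)"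
      using snd_coord_sq[of Q XY_Chart] that by (simp add: lin_def chart_poly_def algebra_simps power2_eq_square)
    then show ?thesis unfolding pell by simp
  qed
  have E: "?z Q \<noteq> 0" "?z Q ^ n * ?h Q = ?E Q" "?z Q ^ n * lin m A (- B) XY_Chart Q = ?F Q"
    if Q: "Q \<in> curve f - ?C" for Q
  proof -
    have ch: "in_chart XY_Chart Q" "in_chart ZW_Chart Q" using Q by auto
    show "?z Q \<noteq> 0" using chart_change(1)[OF ch(2,1)] by simp
    show "?z Q ^ n * ?h Q = ?E Q" using lin_at_infinity[of A n B Q] n(1) B(2) ch by (simp add: add.commute)
    show "?z Q ^ n * lin m A (- B) XY_Chart Q = ?F Q"
      using lin_at_infinity[of A n "- B" Q] n(1) B(2) ch reflect_poly_smult[of "-1" B]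
      by (simp add: add.commute)
  qed
  \<comment> \<open>The sign condition \<open>lc\<close> cancels the leading terms of
    \<open>A + B y\<close> at \<open>Infinity 1\<close> but not at \<open>Infinity (- 1)\<close>;
    for \<open>A - B y\<close> it is the reverse.\<close>
  have lcA: "lead_coeff A \<noteq> 0" using n by auto
  moreover have "lead_coeff B = - lead_coeff A" using lc by (simp add: add_eq_0_iff)
  ultimately have "lead_coeff A - lead_coeff B \<noteq> 0" by simp
  then have inf: "?F (Infinity 1) \<noteq> 0" "?E (Infinity (- 1)) \<noteq> 0"
    by (simp_all add: lin_def poly_reflect_poly_0)
  have "reg ?h P" if "P \<in> ?U" for P using that by (intro reg_lin) simp_all
  moreover have "finite (curve f - ?U)" using chart_infinity[of XY_Chart] by (rule rev_finite_subset) blast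
  moreover have "ord_at ?h P (Poly_Mapping.lookup (frag_cmul (int n) divisor_at_infinity) P)"
    if P: "P \<in> curve f" for P
  proof (cases P)
    case (Affine a b)
    have "reg ?h P" using P Affine by (intro reg_lin) simp_all
    moreover have "?h P \<noteq> 0" using norm[of P] P Affine c by force
    ultimately have "ord_at ?h P 0" unfolding ord_at_def by (intro exI[of _ ?h] exI[of _ "{}"]) simp
    then show ?thesis by (simp add: Affine lookup_infinity)
  next
    case (Infinity a)
    then consider "a = 1" | "a = -1" using P curve_infinity by auto
    then show ?thesis
    proof cases
      case 1
      \<comment> \<open>The order of the zero at \<open>Infinity 1\<close> is not visible in the
        leading terms. The norm equation writes \<open>A + B y\<close> as \<open>c\<close> divided
        by its conjugate, which has a pole of order \<open>n\<close> there.\<close>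
      let ?e = "\<lambda>Q. c * inverse (?F Q)"
      let ?S = "?C \<union> {Q \<in> curve f. ?F Q = 0}"
      have F: "reg ?F P" by (rule reg_lin[OF P]) (simp add: Infinity)
      have F0: "?F P \<noteq> 0" using inf(1) unfolding Infinity 1 .
      have "reg ?e P" by (rule reg_mult[OF reg_const[OF P] reg_inverse[OF F F0]])
      moreover have "?e P \<noteq> 0" using F0 c by simp
      moreover have "finite ?S" using C reg_nonzero_cofinite[OF F F0] by simp
      moreover have "?h Q = ?e Q * unif m P Q powi int n" if Q: "Q \<in> curve f - ?S" for Q
      proof -
        have Q': "Q \<in> curve f - ?C" "Q \<in> ?U" "?F Q \<noteq> 0" using Q by blast+
        have "?h Q * ?F Q = ?z Q ^ n * c"
          unfolding E(3)[OF Q'(1), symmetric] using norm[OF Q'(2)] by (simp add: mult.left_commute)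
        then show ?thesis using Q'(3) unfolding Infinity z by (simp add: field_simps)
      qed
      ultimately have "ord_at ?h P (int n)" by (rule ord_atI)
      then show ?thesis by (simp add: Infinity 1 lookup_infinity)
    next
      case 2
      have "reg ?E P" by (rule reg_lin[OF P]) (simp add: Infinity)
      moreover have "?E P \<noteq> 0" using inf(2) unfolding Infinity 2 .
      moreover note C
      moreover have "?h Q = ?E Q * unif m P Q powi (- int n)" if Q: "Q \<in> curve f - ?C" for Q
        using E(1)[OF Q] unfolding Infinity z E(2)[OF Q, symmetric]
        by (simp add: power_int_minus field_simps)
      ultimately have "ord_at ?h P (- int n)" by (rule ord_atI)
      then show ?thesis by (simp add: Infinity 2 lookup_infinity)
    qed
  qed
  moreover have "Poly_Mapping.keys (frag_cmul (int n) divisor_at_infinity) \<subseteq> curve f"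
    using infinity_in_curve keys_cmul[of "int n" "divisor_at_infinity :: 'a point \<Rightarrow>\<^sub>0 int"]
    unfolding keys_infinity by blast
  ultimately show ?thesis unfolding principal_divisor_iff
    by (intro conjI exI[of _ ?U] exI[of _ ?h] ballI) auto
qed

text \<open>Comparing top coefficients in \<open>A^2 = B^2 f + c\<close> makes the leading
  coefficients of \<open>A\<close> and \<open>B\<close> equal up to sign; replacing \<open>B\<close>
  by \<open>- B\<close>, that is \<open>y\<close> by \<open>- y\<close>, selects the required
  sign.\<close>

lemma pell_principal:
  assumes pell: "A * A - B * B * f = [:c:]" and c: "c \<noteq> 0" and n: "degree A = n" "n > 0"
  shows "principal_divisor f (frag_cmul (int n) divisor_at_infinity)"
proof -
  have f0: "f \<noteq> 0" using monic by auto
  have eq: "A * A = B * B * f + [:c:]" using pell by (simp add: algebra_simps)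
  have degA: "degree (A * A) = 2 * n" using n by (subst degree_mult_eq) auto
  then have B: "B \<noteq> 0" using eq n by auto
  have degB: "degree (B * B * f) = 2 * (degree B + m)"
    using B f0 degree_f by (simp add: degree_mult_eq)
  then have "degree (B * B * f + [:c:]) = 2 * (degree B + m)"
    using m_pos by (subst degree_add_eq_left) auto
  then have deg: "degree B + m = n" using eq degA by simp
  have "coeff (A * A) (2 * n) = coeff (B * B * f) (2 * n)"
    unfolding eq using n(2) by (cases n) (auto simp: coeff_pCons split: nat.splits)
  moreover have "coeff (A * A) (2 * n) = lead_coeff A * lead_coeff A"
    using degA by (metis lead_coeff_mult)
  moreover have "coeff (B * B * f) (2 * n) = lead_coeff B * lead_coeff B"
    using degB deg monic by (metis lead_coeff_mult mult.right_neutral)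
  ultimately have "(lead_coeff A + lead_coeff B) * (lead_coeff A - lead_coeff B) = 0"
    by (simp add: algebra_simps)
  then consider "lead_coeff A + lead_coeff B = 0" | "lead_coeff A - lead_coeff B = 0" by auto
  then show ?thesis
  proof cases
    case 1
    show ?thesis by (rule pell_principal_signed[OF pell c n B deg 1])
  next
    case 2
    then show ?thesis using B deg pell
      by (intro pell_principal_signed[of A "- B", OF _ c n]) simp_all
  qed
qed

theorem ord_infinity:
  assumes "m \<ge> 2" "prime p" "A * A - B * B * f = [:c:]" "c \<noteq> 0" "degree A = p"
  shows "group.ord (jacobian f) (divisor_class f divisor_at_infinity) = p"
proof (rule ord_divisor_class_prime)
  show "principal_divisor f (frag_cmul (int p) divisor_at_infinity)"
    by (rule pell_principal) (use assms prime_gt_0_nat in auto)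
qed (use assms infinity_degree_zero infinity_not_principal in auto)

end

section \<open>Isomorphisms and branch points\<close>

lemma (in even_curve) finite_fibre: "finite {P \<in> curve f. in_chart XY_Chart P \<and> fst_coord XY_Chart P = a}"
proof -
  have "{P \<in> curve f. in_chart XY_Chart P \<and> fst_coord XY_Chart P = a} \<subseteq> Affine a ` {y. y ^ 2 = poly f a}"
  proof
    fix P assume P: "P \<in> {P \<in> curve f. in_chart XY_Chart P \<and> fst_coord XY_Chart P = a}"
    then show "P \<in> Affine a ` {y. y ^ 2 = poly f a}" by (cases P) (auto simp: curve_def)
  qed
  moreover have "finite {y. y ^ 2 = poly f a}"
    using poly_roots_finite[of "[:- poly f a, 0, 1:]"] by (simp add: power2_eq_square algebra_simps)
  then have "finite (Affine a ` {y. y ^ 2 = poly f a})" by simp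
  ultimately show ?thesis by (rule finite_subset)
qed

lemma (in even_curve) germI:
  assumes "reg r P" "finite S" "\<And>Q. Q \<in> curve f - S \<Longrightarrow> h Q = r Q"
  shows "\<exists>r S. reg r P \<and> finite S \<and> (\<forall>Q\<in>curve f - S. h Q = r Q)"
  using assms by (intro exI[of _ r] exI[of _ S]) simp

text \<open>Smoothness is asked of the source alone, since \<open>F_curve t\<close> may be singular.
  The target inherits the cofiniteness of its open sets through the homeomorphism.\<close>

locale curve_isomorphism = F: smooth_curve f m + G: even_curve g n
  for f g :: "'a::{alg_closed_field, field_char_0} poly" and m n :: nat +
  fixes \<phi> :: "'a point \<Rightarrow> 'a point"
  assumes homeo: "homeomorphic_map (zariski f) (zariski g) \<phi>"
    and sheaf: "openin (zariski g) V \<Longrightarrow>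
      regular_on g V h \<longleftrightarrow> regular_on f {P \<in> curve f. \<phi> P \<in> V} (h \<circ> \<phi>)"
begin

lemma image: "\<phi> ` curve f = curve g"
  using homeomorphic_imp_surjective_map[OF homeo] by (simp add: topspace_zariski)

lemma inj: "inj_on \<phi> (curve f)"
  using homeomorphic_imp_injective_map[OF homeo] by (simp add: topspace_zariski)

lemma image_preimage: "V \<subseteq> curve g \<Longrightarrow> \<phi> ` {P \<in> curve f. \<phi> P \<in> V} = V"
  unfolding image[symmetric] by auto

sublocale G: cofinite_curve g n
proof
  fix V assume V: "openin (zariski g) V" "V \<noteq> {}"
  let ?U = "{P \<in> curve f. \<phi> P \<in> V}"
  have sub: "V \<subseteq> curve g" using openin_subset[OF V(1)] by (simp add: topspace_zariski)
  have "?U \<subseteq> topspace (zariski f)" by (simp add: topspace_zariski)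
  from homeomorphic_map_openness[OF homeo this] have "openin (zariski f) ?U"
    unfolding image_preimage[OF sub] using V(1) by simp
  moreover have "?U \<noteq> {}"
  proof
    assume "?U = {}"
    then have "\<phi> ` ?U = {}" by simp
    then show False using V(2) unfolding image_preimage[OF sub] by simp
  qed
  ultimately have "finite (curve f - ?U)" by (rule F.finite_complement)
  then have fin: "finite (\<phi> ` (curve f - ?U))" by simp
  have "curve g - V \<subseteq> \<phi> ` (curve f - ?U)"
  proof
    fix T assume T: "T \<in> curve g - V"
    then have "T \<in> \<phi> ` curve f" by (simp add: image)
    with T show "T \<in> \<phi> ` (curve f - ?U)" by auto
  qed
  then show "finite (curve g - V)" using fin by (rule finite_subset)
qed

lemma finite_preimage: "finite S \<Longrightarrow> finite {P \<in> curve f. \<phi> P \<in> S}"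
  using finite_inverse_image_gen[OF _ inj] .

lemma reg_pullback:
  assumes "G.reg h (\<phi> P)" "P \<in> curve f"
  shows "F.reg (h \<circ> \<phi>) P"
proof -
  obtain V where V: "\<phi> P \<in> V" "regular_on g V h" by (rule G.reg_imp_regular_on[OF assms(1)])
  then have "regular_on f {P \<in> curve f. \<phi> P \<in> V} (h \<circ> \<phi>)"
    using sheaf[of V h] by (simp add: regular_on_def)
  then show ?thesis by (rule F.regular_on_imp_reg) (use V assms in simp)
qed

lemma reg_pushforward:
  assumes "F.reg (h \<circ> \<phi>) P"
  shows "G.reg h (\<phi> P)"
proof -
  obtain W where W: "P \<in> W" "regular_on f W (h \<circ> \<phi>)"
  proof -
    show thesis if "\<And>W. P \<in> W \<Longrightarrow> regular_on f W (h \<circ> \<phi>) \<Longrightarrow> thesis"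
      by (rule F.reg_imp_regular_on[where h = "h \<circ> \<phi>" and P = P, OF assms that])
  qed
  have opn: "openin (zariski f) W" using W(2) by (simp add: regular_on_def)
  then have sub: "W \<subseteq> curve f" by (rule F.openin_subset_curve)
  have "openin (zariski g) (\<phi> ` W)"
    using homeomorphic_map_openness[OF homeo, of W] opn sub by (simp add: topspace_zariski)
  moreover have "{P \<in> curve f. \<phi> P \<in> \<phi> ` W} = W" using inj sub by (auto simp: inj_on_def)
  ultimately have "regular_on g (\<phi> ` W) h" using sheaf[of "\<phi> ` W" h] W(2) by simp
  then show ?thesis by (rule G.regular_on_imp_reg) (use W(1) in simp)
qed

end

text \<open>Over \<open>c\<close> the value is the convention \<open>1 / 0 = 0\<close>; the value at
  infinity is a genuine zero of the function.\<close>

fun pole_fun :: "'a::field \<Rightarrow> 'a point \<Rightarrow> 'a" where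
  "pole_fun c (Affine x y) = 1 / (x - c)"
| "pole_fun c (Infinity w) = 0"

lemma (in cofinite_curve) reg_pole_fun:
  assumes P: "P \<in> curve f" and c: "in_chart XY_Chart P \<Longrightarrow> fst_coord XY_Chart P \<noteq> c"
  shows "reg (pole_fun c) P"
proof (cases P)
  case (Affine x y)
  let ?l = "lin m [:- c, 1:] 0 XY_Chart"
  have l: "reg ?l P" by (rule reg_lin[OF P]) (simp add: Affine)
  have l0: "?l P \<noteq> 0" using c by (simp add: lin_def Affine)
  show ?thesis
  proof (rule reg_cong[OF reg_inverse[OF l l0]])
    show "finite {Q \<in> curve f. \<not> in_chart XY_Chart Q}" by (rule chart_infinity)
    show "P \<notin> {Q \<in> curve f. \<not> in_chart XY_Chart Q}" by (simp add: Affine)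
    fix Q assume "Q \<in> curve f - {Q \<in> curve f. \<not> in_chart XY_Chart Q}"
    then show "pole_fun c Q = inverse (?l Q)" by (cases Q) (simp_all add: lin_def inverse_eq_divide)
  qed
next
  case (Infinity w)
  let ?l = "lin m [:1, - c:] 0 ZW_Chart" and ?z = "lin m [:0, 1:] 0 ZW_Chart"
  have l: "reg ?l P" by (rule reg_lin[OF P]) (simp add: Infinity)
  have z: "reg ?z P" by (rule reg_lin[OF P]) (simp add: Infinity)
  have l0: "?l P \<noteq> 0" by (simp add: lin_def Infinity)
  show ?thesis
  proof (rule reg_cong[OF reg_mult[OF z reg_inverse[OF l l0]]])
    show "finite {Q \<in> curve f. \<not> in_chart ZW_Chart Q}" by (rule chart_infinity)
    show "P \<notin> {Q \<in> curve f. \<not> in_chart ZW_Chart Q}" by (simp add: Infinity)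
    fix Q assume Q: "Q \<in> curve f - {Q \<in> curve f. \<not> in_chart ZW_Chart Q}"
    show "pole_fun c Q = ?z Q * inverse (?l Q)"
    proof (cases Q)
      case (Affine x y)
      with Q have "x \<noteq> 0" by simp
      then show ?thesis using Affine by (cases "x = c") (simp_all add: lin_def divide_simps)
    qed (simp add: lin_def)
  qed
qed

text \<open>Local data of the pole: the preimages \<open>R1\<close>, \<open>R2\<close> of the two points over \<open>c\<close> are assumed to be
  affine and unramified, which excludes finitely many \<open>c\<close>.\<close>

locale isomorphism_pole = curve_isomorphism +
  fixes c d a1 b1 a2 b2
  assumes m3: "m \<ge> 3"
    and d: "d ^ 2 = poly g c" "d \<noteq> 0"
    and R1: "Affine a1 b1 \<in> curve f" "\<phi> (Affine a1 b1) = Affine c d" "b1 \<noteq> 0"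
    and R2: "Affine a2 b2 \<in> curve f" "\<phi> (Affine a2 b2) = Affine c (- d)" "b2 \<noteq> 0"
begin

abbreviation "x \<equiv> fst_coord XY_Chart"
abbreviation "z \<equiv> fst_coord ZW_Chart"

definition xi ::  "'a point \<Rightarrow> 'a" where "xi = pole_fun c \<circ> \<phi>"

lemma over_c: "Affine c y \<in> curve g \<longleftrightarrow> y = d \<or> y = - d"
  using d(1)[symmetric] by (auto simp: curve_def power2_eq_iff)

lemma R_neq: "Affine a1 b1 \<noteq> Affine a2 b2"
proof
  assume "Affine a1 b1 = Affine a2 b2"
  then have "Affine c d = Affine c (- d)" using R1(2) R2(2) by simp
  then have "2 * d = 0" by simp
  then show False using d(2) by simp
qed

lemma reg_X:
  assumes P: "P \<in> curve f" "P \<noteq> Affine a1 b1" "P \<noteq> Affine a2 b2"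
  shows "F.reg xi P"
  unfolding xi_def
proof (rule reg_pullback[OF G.reg_pole_fun])
  show "\<phi> P \<in> curve g" using image P(1) by blast
  show "x (\<phi> P) \<noteq> c" if ch: "in_chart XY_Chart (\<phi> P)"
  proof
    assume "x (\<phi> P) = c"
    then obtain y where y: "\<phi> P = Affine c y" using ch by (cases "\<phi> P") auto
    then have "\<phi> P = \<phi> (Affine a1 b1) \<or> \<phi> P = \<phi> (Affine a2 b2)"
      using over_c R1(2) R2(2) \<open>\<phi> P \<in> curve g\<close> by simp
    then show False using inj P R1(1) R2(1) by (auto simp: inj_on_def)
  qed
qed (fact P(1))

text \<open>Pushed forward to the target, \<open>x - a\<close> becomes a germ vanishing at
  \<open>(c, e)\<close>. As \<open>e\<close> is nonzero, \<open>x - c\<close> divides it there, and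
  the quotient pulled back is the product of \<open>x - a\<close> with \<open>xi\<close>.\<close>

lemma pole_simple:
  assumes R: "Affine a b \<in> curve f" "\<phi> (Affine a b) = Affine c e" "e \<noteq> 0"
  shows "\<exists>r S. F.reg r (Affine a b) \<and> finite S \<and> (\<forall>Q\<in>curve f - S. (x Q - a) * xi Q = r Q)"
proof -
  let ?R = "Affine a b"
  let ?s = "\<lambda>T. x (inv_into (curve f) \<phi> T) - a"
  have inv: "inv_into (curve f) \<phi> (\<phi> P) = P" if "P \<in> curve f" for P
    using inv_into_f_f[OF inj that] .
  have "F.reg (lin m [:- a, 1:] 0 XY_Chart) ?R" by (rule F.reg_lin[OF R(1)]) simp
  then have "F.reg (?s \<circ> \<phi>) ?R"
    by (rule F.reg_cong[where S = "{}"]) (simp_all add: lin_def inv)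
  then have s: "G.reg ?s (\<phi> ?R)" by (rule reg_pushforward)
  have "?s (\<phi> ?R) = 0" using R(1) by (simp add: inv)
  moreover have "in_chart XY_Chart (\<phi> ?R)" "snd_coord n XY_Chart (\<phi> ?R) \<noteq> 0" using R by simp_all
  ultimately have "\<exists>r S. G.reg r (\<phi> ?R) \<and> finite S \<and> \<phi> ?R \<notin> S \<and>
      (\<forall>T\<in>curve g - S. ?s T = (x T - x (\<phi> ?R)) * r T)"
    by (intro G.fst_coord_divides[OF s])
  then obtain r S where r: "G.reg r (\<phi> ?R)" "finite S"
    "\<forall>T\<in>curve g - S. ?s T = (x T - x (\<phi> ?R)) * r T" by metis
  let ?S = "S \<union> {T \<in> curve g. \<not> in_chart XY_Chart T} \<union> {T \<in> curve g. in_chart XY_Chart T \<and> x T = c}"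
  have fin: "finite {P \<in> curve f. \<phi> P \<in> ?S}"
    using r(2) G.chart_infinity G.finite_fibre by (intro finite_preimage) simp
  have "(x Q - a) * xi Q = (r \<circ> \<phi>) Q" if Q: "Q \<in> curve f - {P \<in> curve f. \<phi> P \<in> ?S}" for Q
  proof -
    have T: "\<phi> Q \<in> curve g" "\<phi> Q \<notin> ?S" using Q image by blast+
    then have xc: "x (\<phi> Q) \<noteq> c" "in_chart XY_Chart (\<phi> Q)" by auto
    then have "xi Q = 1 / (x (\<phi> Q) - c)" by (cases "\<phi> Q") (simp_all add: xi_def)
    moreover have "?s (\<phi> Q) = (x (\<phi> Q) - x (\<phi> ?R)) * r (\<phi> Q)" using r(3) T by blast
    then have "x Q - a = (x (\<phi> Q) - c) * r (\<phi> Q)" using Q R(2) by (simp add: inv)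
    ultimately show ?thesis using xc(1) by simp
  qed
  moreover have "F.reg (r \<circ> \<phi>) ?R" by (rule reg_pullback[OF r(1) R(1)])
  ultimately show ?thesis using fin
    by (intro exI[of _ "r \<circ> \<phi>"] exI[of _ "{P \<in> curve f. \<phi> P \<in> ?S}"]) simp
qed

lemma X_not_const:
  assumes "finite S"
  shows "\<not> (\<forall>Q\<in>curve f - S. xi Q = k)"
proof
  assume xi: "\<forall>Q\<in>curve f - S. xi Q = k"
  \<comment> \<open>At images outside \<open>?T\<close> the value of \<open>pole_fun c\<close> is
    never \<open>k\<close>. For \<open>k = 0\<close> the last fibre is again the one over
    \<open>c\<close>, by \<open>1 / 0 = 0\<close>.\<close>
  let ?T = "{T \<in> curve g. \<not> in_chart XY_Chart T} \<union> {T \<in> curve g. in_chart XY_Chart T \<and> x T = c} \<union>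
    {T \<in> curve g. in_chart XY_Chart T \<and> x T = c + 1 / k}"
  have "finite (S \<union> {P \<in> curve f. \<phi> P \<in> ?T})"
    using assms G.chart_infinity G.finite_fibre by (intro finite_UnI finite_preimage) simp_all
  moreover have "curve f \<subseteq> S \<union> {P \<in> curve f. \<phi> P \<in> ?T}"
  proof
    fix Q assume Q: "Q \<in> curve f"
    have T: "\<phi> Q \<in> curve g" using Q image by blast
    show "Q \<in> S \<union> {P \<in> curve f. \<phi> P \<in> ?T}"
    proof (cases "Q \<in> S")
      case False
      then have k: "pole_fun c (\<phi> Q) = k" using xi Q by (simp add: xi_def)
      have "\<phi> Q \<in> ?T"
      proof (cases "\<phi> Q")
        case (Affine s e)
        then have "k = 1 / (s - c)" using k by simp
        then show ?thesis using T Affine by (cases "s = c") simp_all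
      qed (use T in simp)
      then show ?thesis using Q by simp
    qed simp
  qed
  ultimately show False using F.infinite_curve finite_subset by blast
qed

lemma reg_affine_factor: "P \<in> curve f \<Longrightarrow> in_chart XY_Chart P \<Longrightarrow> F.reg (\<lambda>Q. x Q - a) P"
  by (rule F.reg_fst_coord)

lemma reg_infinity_factor:
  assumes "w = 1 \<or> w = -1"
  shows "F.reg (\<lambda>Q. 1 - a * z Q) (Infinity w)"
proof -
  have P: "Infinity w \<in> curve f" using assms F.curve_infinity by simp
  have "F.reg (lin m [:1, - a:] 0 ZW_Chart) (Infinity w)" by (rule F.reg_lin[OF P]) simp
  then show ?thesis by (rule F.reg_cong[where S = "{}"]) (simp_all add: lin_def)
qed

lemma reg_X_infinity:
  assumes "w = 1 \<or> w = -1"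
  shows "F.reg xi (Infinity w)"
  using assms F.curve_infinity by (intro reg_X) simp_all

abbreviation "off_charts \<equiv> {Q \<in> curve f. \<not> in_chart XY_Chart Q} \<union> {Q \<in> curve f. \<not> in_chart ZW_Chart Q}"

lemma finite_off_charts: "finite off_charts"
  using F.chart_infinity by simp

lemma zx: "Q \<in> curve f - off_charts \<Longrightarrow> z Q * (x Q - a) = 1 - a * z Q"
  using F.chart_change[of ZW_Chart Q XY_Chart] by (auto simp: algebra_simps)

text \<open>If the abscissae differed, clearing both poles would give a function with poles of order
  at most 2 at infinity, hence, as \<open>m \<ge> 3\<close>, a polynomial in \<open>x\<close> of
  degree at most 2. It vanishes at the conjugates of the two poles, where \<open>xi\<close> is
  regular, so it is a multiple of \<open>(x - a1) (x - a2)\<close> and \<open>xi\<close> is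
  constant.\<close>

lemma a_eq: "a1 = a2"
proof (rule ccontr)
  assume neq: "a1 \<noteq> a2"
  let ?R1 = "Affine a1 b1" and ?R2 = "Affine a2 b2"
  let ?H = "\<lambda>Q. (x Q - a1) * (x Q - a2) * xi Q"
  obtain r1 S1 where r1: "F.reg r1 ?R1" "finite S1" "\<forall>Q\<in>curve f - S1. (x Q - a1) * xi Q = r1 Q"
    using pole_simple[OF R1(1,2) d(2)] by metis
  obtain r2 S2 where r2: "F.reg r2 ?R2" "finite S2" "\<forall>Q\<in>curve f - S2. (x Q - a2) * xi Q = r2 Q"
    using pole_simple[OF R2(1,2)] d(2) by (metis neg_equal_0_iff_equal)
  have "\<exists>A B S. finite S \<and> (\<forall>Q\<in>curve f - S. ?H Q = lin m A B XY_Chart Q)"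
  proof (rule F.regular_affine_imp_lin)
    fix P assume P: "P \<in> curve f" "in_chart XY_Chart P"
    consider "P = ?R1" | "P = ?R2" | "P \<noteq> ?R1" "P \<noteq> ?R2" by blast
    then show "\<exists>r S. F.reg r P \<and> finite S \<and> (\<forall>Q\<in>curve f - S. ?H Q = r Q)"
    proof cases
      case 1
      have "F.reg (\<lambda>Q. (x Q - a2) * r1 Q) P"
        using r1(1) reg_affine_factor[OF P] unfolding 1 by (intro F.reg_mult)
      then show ?thesis using r1(2,3)
        by (intro exI[of _ "\<lambda>Q. (x Q - a2) * r1 Q"] exI[of _ S1]) (simp add: mult_ac)
    next
      case 2
      have "F.reg (\<lambda>Q. (x Q - a1) * r2 Q) P"
        using r2(1) reg_affine_factor[OF P] unfolding 2 by (intro F.reg_mult)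
      then show ?thesis using r2(2,3)
        by (intro exI[of _ "\<lambda>Q. (x Q - a1) * r2 Q"] exI[of _ S2]) (simp add: mult_ac)
    next
      case 3
      have "F.reg ?H P"
        by (rule F.reg_mult[OF F.reg_mult[OF reg_affine_factor[OF P] reg_affine_factor[OF P]] reg_X[OF P(1) 3]])
      then show ?thesis by (intro exI[of _ ?H] exI[of _ "{}"]) simp
    qed
  qed
  then obtain A B S where AB: "finite S" "\<forall>Q\<in>curve f - S. ?H Q = lin m A B XY_Chart Q"
    by (elim exE conjE)
  have deg: "degree A \<le> 2 \<and> (B = 0 \<or> degree B + m \<le> 2)"
  proof (rule F.degree_le_at_infinity)
    show "finite S" by fact
    show "?H Q = lin m A B XY_Chart Q" if "Q \<in> curve f - S" for Q using AB(2) that by blast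
    fix w :: 'a assume w: "w = 1 \<or> w = -1"
    let ?r = "\<lambda>Q. (1 - a1 * z Q) * (1 - a2 * z Q) * xi Q"
    have "F.reg ?r (Infinity w)"
      by (rule F.reg_mult[OF F.reg_mult[OF reg_infinity_factor[OF w] reg_infinity_factor[OF w]] reg_X_infinity[OF w]])
    moreover note finite_off_charts
    moreover have "z Q ^ 2 * ?H Q = ?r Q" if Q: "Q \<in> curve f - off_charts" for Q
      unfolding zx[OF Q, symmetric] by (simp add: power2_eq_square mult_ac)
    ultimately show "\<exists>r T. F.reg r (Infinity w) \<and> finite T \<and> (\<forall>Q\<in>curve f - T. z Q ^ 2 * ?H Q = r Q)"
      by (rule F.germI)
  qed
  then have B: "B = 0" using m3 by auto
  have zero: "poly A a = 0" if P: "Affine a b \<in> curve f" "Affine a b \<noteq> ?R1" "Affine a b \<noteq> ?R2" "a = a1 \<or> a = a2" for a b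
  proof -
    have "?H (Affine a b) = lin m A 0 XY_Chart (Affine a b)"
    proof (rule F.reg_eq[of _ ?H "lin m A 0 XY_Chart" S])
      have ch: "in_chart XY_Chart (Affine a b)" by simp
      show "F.reg ?H (Affine a b)"
        by (rule F.reg_mult[OF F.reg_mult[OF reg_affine_factor[OF P(1) ch] reg_affine_factor[OF P(1) ch]] reg_X[OF P(1-3)]])
      show "F.reg (lin m A 0 XY_Chart) (Affine a b)" by (rule F.reg_lin[OF P(1) ch])
    qed (use AB B in auto)
    then show ?thesis using P(4) by (auto simp: lin_def)
  qed
  have flip: "Affine a (- b) \<in> curve f" if "Affine a b \<in> curve f" for a b
    using that by (simp add: curve_def)
  have "b1 \<noteq> - b1" "b2 \<noteq> - b2" using R1(3) R2(3) by (simp_all add: eq_neg_iff_add_eq_0 flip: mult_2)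
  then have "poly A a1 = 0" "poly A a2 = 0"
    using zero[OF flip[OF R1(1)]] zero[OF flip[OF R2(1)]] neq by auto
  then obtain A1 where A1: "A = [:- a1, 1:] * A1" unfolding poly_eq_0_iff_dvd by (elim dvdE)
  have "poly A1 a2 = 0" using \<open>poly A a2 = 0\<close> neq unfolding A1 by simp
  then obtain A2 where A2: "A = [:- a1, 1:] * ([:- a2, 1:] * A2)"
    unfolding A1 poly_eq_0_iff_dvd by (elim dvdE) simp
  have "degree A2 = 0"
  proof (cases "A2 = 0")
    case False
    then have nz: "[:- a2, 1:] * A2 \<noteq> 0" by (intro no_zero_divisors) simp_all
    have "degree A = 1 + degree ([:- a2, 1:] * A2)" unfolding A2 by (subst degree_mult_eq[OF _ nz]) simp_all
    also have "degree ([:- a2, 1:] * A2) = 1 + degree A2" using False by (subst degree_mult_eq) simp_all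
    finally have "degree A = 2 + degree A2" by simp
    then show ?thesis using deg by simp
  qed simp
  then obtain k where k: "A2 = [:k:]" by (rule degree_eq_zeroE)
  let ?S = "S \<union> {P \<in> curve f. \<not> in_chart XY_Chart P} \<union>
    {P \<in> curve f. in_chart XY_Chart P \<and> x P = a1} \<union> {P \<in> curve f. in_chart XY_Chart P \<and> x P = a2}"
  have "finite ?S" using AB(1) F.chart_infinity F.finite_fibre by simp
  moreover have "\<forall>Q\<in>curve f - ?S. xi Q = k"
  proof
    fix Q assume Q: "Q \<in> curve f - ?S"
    have "?H Q = lin m A B XY_Chart Q" using AB(2) Q by blast
    also have "\<dots> = (x Q - a1) * (x Q - a2) * k" unfolding A2 B k by (simp add: lin_def algebra_simps)
    finally show "xi Q = k" using Q by auto
  qed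
  ultimately show False by (rule notE[OF X_not_const])
qed

lemma b_eq: "b2 = - b1"
proof -
  have "b2 ^ 2 = b1 ^ 2" using R1(1) R2(1) a_eq by (simp add: curve_def)
  then show ?thesis using R_neq a_eq by (auto simp: power2_eq_iff)
qed

text \<open>With both poles over the same abscissa a single factor \<open>x - a1\<close> clears
  them, and the pole order at infinity drops to at most 1. A vanishing determinant
  \<open>\<alpha> * a1 + \<beta>\<close> would make \<open>xi\<close> constant.\<close>

lemma X_moebius:
  obtains \<alpha> \<beta> where "\<alpha> * a1 + \<beta> \<noteq> 0"
    "\<And>p q. Affine p q \<in> curve f \<Longrightarrow> Affine p q \<noteq> Affine a1 b1 \<Longrightarrow> Affine p q \<noteq> Affine a2 b2 \<Longrightarrow>
      p \<noteq> a1 \<and> xi (Affine p q) = (\<alpha> * p + \<beta>) / (p - a1)"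
    "\<And>w. w = 1 \<or> w = -1 \<Longrightarrow> xi (Infinity w) = \<alpha>"
proof -
  let ?R1 = "Affine a1 b1" and ?R2 = "Affine a2 b2"
  let ?H = "\<lambda>Q. (x Q - a1) * xi Q"
  obtain r1 S1 where r1: "F.reg r1 ?R1" "finite S1" "\<forall>Q\<in>curve f - S1. (x Q - a1) * xi Q = r1 Q"
    using pole_simple[OF R1(1,2) d(2)] by metis
  obtain r2 S2 where r2: "F.reg r2 ?R2" "finite S2" "\<forall>Q\<in>curve f - S2. (x Q - a2) * xi Q = r2 Q"
    using pole_simple[OF R2(1,2)] d(2) by (metis neg_equal_0_iff_equal)
  have "\<exists>A B S. finite S \<and> (\<forall>Q\<in>curve f - S. ?H Q = lin m A B XY_Chart Q)"
  proof (rule F.regular_affine_imp_lin)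
    fix P assume P: "P \<in> curve f" "in_chart XY_Chart P"
    consider "P = ?R1" | "P = ?R2" | "P \<noteq> ?R1" "P \<noteq> ?R2" by blast
    then show "\<exists>r S. F.reg r P \<and> finite S \<and> (\<forall>Q\<in>curve f - S. ?H Q = r Q)"
    proof cases
      case 1
      show ?thesis unfolding 1 by (rule F.germI[OF r1(1,2)]) (use r1(3) in blast)
    next
      case 2
      show ?thesis unfolding 2 a_eq by (rule F.germI[OF r2(1,2)]) (use r2(3) in blast)
    next
      case 3
      have "F.reg ?H P" by (rule F.reg_mult[OF reg_affine_factor[OF P] reg_X[OF P(1) 3]])
      then show ?thesis by (intro exI[of _ ?H] exI[of _ "{}"]) simp
    qed
  qed
  then obtain A B S where AB: "finite S" "\<forall>Q\<in>curve f - S. ?H Q = lin m A B XY_Chart Q"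
    by (elim exE conjE)
  have zH: "z Q * ?H Q = (1 - a1 * z Q) * xi Q" if Q: "Q \<in> curve f - off_charts" for Q
    unfolding zx[OF Q, symmetric] by (simp add: mult_ac)
  have reg_inf: "F.reg (\<lambda>Q. (1 - a1 * z Q) * xi Q) (Infinity w)" if w: "w = 1 \<or> w = -1" for w
    by (rule F.reg_mult[OF reg_infinity_factor[OF w] reg_X_infinity[OF w]])
  have deg: "degree A \<le> 1 \<and> (B = 0 \<or> degree B + m \<le> 1)"
  proof (rule F.degree_le_at_infinity)
    show "finite S" by fact
    show "?H Q = lin m A B XY_Chart Q" if "Q \<in> curve f - S" for Q using AB(2) that by blast
    fix w :: 'a assume w: "w = 1 \<or> w = -1"
    have "z Q ^ 1 * ?H Q = (1 - a1 * z Q) * xi Q" if "Q \<in> curve f - off_charts" for Q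
      using zH[OF that] by simp
    with reg_inf[OF w] finite_off_charts show "\<exists>r T. F.reg r (Infinity w) \<and> finite T \<and> (\<forall>Q\<in>curve f - T. z Q ^ 1 * ?H Q = r Q)"
      by (rule F.germI)
  qed
  then have B: "B = 0" using m3 by auto
  obtain \<beta> A' where A': "A = pCons \<beta> A'" by (cases A)
  have "degree A' = 0" using deg by (cases "A' = 0") (simp_all add: A')
  then obtain \<alpha> where "A' = [:\<alpha>:]" by (rule degree_eq_zeroE)
  with A' have A: "A = [:\<beta>, \<alpha>:]" by simp
  have H: "?H Q = \<alpha> * x Q + \<beta>" if "Q \<in> curve f - S" for Q
    using bspec[OF AB(2) that] unfolding A B by (simp add: lin_def algebra_simps)
  show thesis
  proof (rule that)
    show "\<alpha> * a1 + \<beta> \<noteq> 0"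
    proof
      assume 0: "\<alpha> * a1 + \<beta> = 0"
      let ?S = "S \<union> {P \<in> curve f. \<not> in_chart XY_Chart P} \<union> {P \<in> curve f. in_chart XY_Chart P \<and> x P = a1}"
      have "finite ?S" using AB(1) F.chart_infinity F.finite_fibre by simp
      moreover have "\<forall>Q\<in>curve f - ?S. xi Q = \<alpha>"
      proof
        fix Q assume Q: "Q \<in> curve f - ?S"
        have "\<beta> = - (\<alpha> * a1)" using 0 by (simp add: add_eq_0_iff)
        then have "(x Q - a1) * xi Q = (x Q - a1) * \<alpha>" using H[of Q] Q by (simp add: algebra_simps)
        then show "xi Q = \<alpha>" using Q by auto
      qed
      ultimately show False by (rule notE[OF X_not_const])
    qed
  next
    fix p q assume P: "Affine p q \<in> curve f" "Affine p q \<noteq> ?R1" "Affine p q \<noteq> ?R2"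
    have pa: "p \<noteq> a1"
    proof
      assume "p = a1"
      then have "q ^ 2 = b1 ^ 2" using P(1) R1(1) by (simp add: curve_def)
      then show False using P \<open>p = a1\<close> a_eq b_eq by (auto simp: power2_eq_iff)
    qed
    have ch: "in_chart XY_Chart (Affine p q)" by simp
    have "?H (Affine p q) = lin m [:\<beta>, \<alpha>:] 0 XY_Chart (Affine p q)"
    proof (rule F.reg_eq[of _ ?H "lin m [:\<beta>, \<alpha>:] 0 XY_Chart" S])
      show "F.reg ?H (Affine p q)" by (rule F.reg_mult[OF reg_affine_factor[OF P(1) ch] reg_X[OF P]])
      show "F.reg (lin m [:\<beta>, \<alpha>:] 0 XY_Chart) (Affine p q)" by (rule F.reg_lin[OF P(1) ch])
    qed (use AB A B in auto)
    then show "p \<noteq> a1 \<and> xi (Affine p q) = (\<alpha> * p + \<beta>) / (p - a1)"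
      using pa by (simp add: lin_def field_simps)
  next
    fix w :: 'a assume w: "w = 1 \<or> w = -1"
    have P: "Infinity w \<in> curve f" using w F.curve_infinity by simp
    have "(1 - a1 * z (Infinity w)) * xi (Infinity w) = lin m [:\<alpha>, \<beta>:] 0 ZW_Chart (Infinity w)"
    proof (rule F.reg_eq[of _ "\<lambda>Q. (1 - a1 * z Q) * xi Q" "lin m [:\<alpha>, \<beta>:] 0 ZW_Chart" "S \<union> off_charts"])
      show "F.reg (\<lambda>Q. (1 - a1 * z Q) * xi Q) (Infinity w)" by (rule reg_inf[OF w])
      show "F.reg (lin m [:\<alpha>, \<beta>:] 0 ZW_Chart) (Infinity w)" by (rule F.reg_lin[OF P]) simp
      show "finite (S \<union> off_charts)" using AB(1) finite_off_charts by simp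
      fix Q assume Q: "Q \<in> curve f - (S \<union> off_charts)"
      then have Q': "Q \<in> curve f - S" "Q \<in> curve f - off_charts" by blast+
      have "z Q * x Q = 1" using zx[OF Q'(2), of 0] by simp
      then have "z Q * ?H Q = \<alpha> + \<beta> * z Q" unfolding H[OF Q'(1)]
        by (simp add: distrib_left mult.left_commute[of "z Q"] mult.commute)
      then show "(1 - a1 * z Q) * xi Q = lin m [:\<alpha>, \<beta>:] 0 ZW_Chart Q"
        using zH[OF Q'(2)] by (simp add: lin_def mult.commute)
    qed
    then show "xi (Infinity w) = \<alpha>" by (simp add: lin_def)
  qed
qed

text \<open>Branch points are characterised by having a one-point fibre under \<open>x\<close>.\<close>

lemma branch_points:
  "\<exists>\<alpha> \<beta>. \<alpha> * a1 + \<beta> \<noteq> 0 \<and> (\<forall>r. poly f r = 0 \<longrightarrow>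
    r \<noteq> a1 \<and> \<alpha> * r + \<beta> \<noteq> 0 \<and> poly g (c + (r - a1) / (\<alpha> * r + \<beta>)) = 0)"
proof -
  obtain \<alpha> \<beta> where ab: "\<alpha> * a1 + \<beta> \<noteq> 0"
    and aff: "\<And>p q. Affine p q \<in> curve f \<Longrightarrow> Affine p q \<noteq> Affine a1 b1 \<Longrightarrow> Affine p q \<noteq> Affine a2 b2 \<Longrightarrow>
      p \<noteq> a1 \<and> xi (Affine p q) = (\<alpha> * p + \<beta>) / (p - a1)"
    and inf: "\<And>w. w = 1 \<or> w = -1 \<Longrightarrow> xi (Infinity w) = \<alpha>" by (rule X_moebius, rule that)
  have "r \<noteq> a1 \<and> \<alpha> * r + \<beta> \<noteq> 0 \<and> poly g (c + (r - a1) / (\<alpha> * r + \<beta>)) = 0" if r: "poly f r = 0" for r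
  proof -
    let ?Q = "Affine r 0"
    have Q: "?Q \<in> curve f" "?Q \<noteq> Affine a1 b1" "?Q \<noteq> Affine a2 b2"
      using r R1(3) R2(3) by (simp_all add: curve_def)
    note XQ = aff[OF Q]
    have phiQ: "\<phi> ?Q \<in> curve g" using Q(1) image by blast
    have not_c: "\<phi> P \<noteq> Affine c e" if "P \<in> curve f" "P \<noteq> Affine a1 b1" "P \<noteq> Affine a2 b2" for P e
    proof
      assume e: "\<phi> P = Affine c e"
      then have "Affine c e \<in> curve g" using that(1) image by (metis imageI)
      then have "\<phi> P = \<phi> (Affine a1 b1) \<or> \<phi> P = \<phi> (Affine a2 b2)"
        using e over_c R1(2) R2(2) by simp
      then show False using inj that R1(1) R2(1) by (auto simp: inj_on_def)
    qed
    have one_point: "T = \<phi> ?Q"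
      if T: "T \<in> curve g" "pole_fun c T = pole_fun c (\<phi> ?Q)" "\<And>e. T \<noteq> Affine c e" for T
    proof -
      have "T \<in> \<phi> ` curve f" using T(1) by (simp add: image)
      then obtain Q' where Q': "Q' \<in> curve f" "\<phi> Q' = T" by auto
      have ne: "Q' \<noteq> Affine a1 b1" "Q' \<noteq> Affine a2 b2" using T(3) Q'(2) R1(2) R2(2) by auto
      have eq: "xi Q' = (\<alpha> * r + \<beta>) / (r - a1)" using T(2) Q'(2) XQ by (simp add: xi_def)
      have "Q' = ?Q"
      proof (cases Q')
        case (Affine p q)
        have "p \<noteq> a1" "(\<alpha> * p + \<beta>) / (p - a1) = (\<alpha> * r + \<beta>) / (r - a1)"
          using aff[of p q] Q' ne eq Affine by simp_all
        then have "(\<alpha> * p + \<beta>) * (r - a1) = (\<alpha> * r + \<beta>) * (p - a1)" using XQ by (simp add: frac_eq_eq)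
        then have "(p - r) * (\<alpha> * a1 + \<beta>) = 0" by (simp add: algebra_simps)
        then have "p = r" using ab by simp
        then show ?thesis using Q'(1) Affine r by (simp add: curve_def)
      next
        case (Infinity w)
        then have "\<alpha> = (\<alpha> * r + \<beta>) / (r - a1)" using inf[of w] eq Q'(1) F.curve_infinity by simp
        then have "\<alpha> * a1 + \<beta> = 0" using XQ by (simp add: field_simps)
        then show ?thesis using ab by simp
      qed
      then show ?thesis using Q'(2) by simp
    qed
    \<comment> \<open>\<open>pole_fun c\<close> ignores the sign of the second coordinate, so the
      conjugate of \<open>\<phi> ?Q\<close> lies in the same fibre and coincides with it. At
      infinity this is absurd, since the conjugates 1 and -1 are distinct.\<close>
    obtain s where s: "\<phi> ?Q = Affine s 0"
    proof (cases "\<phi> ?Q")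
      case (Affine s e)
      have "Affine s (- e) = \<phi> ?Q"
        using not_c[OF Q] phiQ Affine by (intro one_point) (auto simp: curve_def)
      then have "- e = e" using Affine by simp
      then have "2 * e = 0" by (metis add.right_inverse mult_2)
      then show ?thesis using that Affine by simp
    next
      case (Infinity w)
      then have w: "w = 1 \<or> w = -1" using phiQ G.curve_infinity by simp
      have "Infinity (- w) = \<phi> ?Q"
        using w Infinity G.curve_infinity by (intro one_point) auto
      then have "- w = w" using Infinity by simp
      then show ?thesis using w by auto
    qed
    have gs: "poly g s = 0" using phiQ s by (simp add: curve_def)
    have "s \<noteq> c" using not_c[OF Q] s by auto
    have xi: "1 / (s - c) = (\<alpha> * r + \<beta>) / (r - a1)" using XQ s by (simp add: xi_def)
    then have nz: "\<alpha> * r + \<beta> \<noteq> 0" using \<open>s \<noteq> c\<close> by auto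
    then have "s = c + (r - a1) / (\<alpha> * r + \<beta>)"
      using xi XQ \<open>s \<noteq> c\<close> by (simp add: field_simps)
    then show ?thesis using gs nz XQ by simp
  qed
  then show ?thesis using ab by blast
qed

end

theorem isomorphic_curves_moebius:
  fixes f g :: "'a::{alg_closed_field, field_char_0} poly"
  assumes f: "smooth_curve f m" "m \<ge> 3" and g: "even_curve g n" and iso: "isomorphic_curves f g"
  shows "\<exists>a c \<alpha> \<beta>. \<alpha> * a + \<beta> \<noteq> 0 \<and> (\<forall>r. poly f r = 0 \<longrightarrow>
    r \<noteq> a \<and> \<alpha> * r + \<beta> \<noteq> 0 \<and> poly g (c + (r - a) / (\<alpha> * r + \<beta>)) = 0)"
proof -
  from iso[unfolded isomorphic_curves_def] obtain \<phi> where
    \<phi>: "homeomorphic_map (zariski f) (zariski g) \<phi> \<and> (\<forall>V h. openin (zariski g) V \<longrightarrow>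
      (regular_on g V h \<longleftrightarrow> regular_on f {P \<in> curve f. \<phi> P \<in> V} (h \<circ> \<phi>)))" ..
  interpret F: smooth_curve f m by fact
  interpret G: even_curve g n by fact
  interpret curve_isomorphism f g m n \<phi> proof
    show "homeomorphic_map (zariski f) (zariski g) \<phi>" by (rule conjunct1[OF \<phi>])
    show "regular_on g V h \<longleftrightarrow> regular_on f {P \<in> curve f. \<phi> P \<in> V} (h \<circ> \<phi>)"
      if "openin (zariski g) V" for V h
      using conjunct2[OF \<phi>] that by simp
  qed
  \<comment> \<open>\<open>?B\<close> collects the points at infinity and the branch points.
    Choosing \<open>c\<close> off the abscissae of their images and off the roots of
    \<open>g\<close> makes the two preimages affine and unramified; the default abscissa 0 at
    infinity merely excludes one more value.\<close>
  let ?B = "{P \<in> curve f. \<not> in_chart XY_Chart P} \<union>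
    {P \<in> curve f. in_chart XY_Chart P \<and> lin m 0 1 XY_Chart P = 0}"
  have "g \<noteq> 0" using G.monic by auto
  then have "finite (fst_coord XY_Chart ` \<phi> ` ?B \<union> {r. poly g r = 0})"
    by (intro finite_UnI finite_imageI F.chart_infinity F.lin_zero_finite poly_roots_finite) simp_all
  from ex_new_if_finite[OF infinite_UNIV_char_0 this]
  obtain c where "c \<notin> fst_coord XY_Chart ` \<phi> ` ?B \<union> {r. poly g r = 0}" ..
  then have c: "c \<notin> fst_coord XY_Chart ` \<phi> ` ?B" "poly g c \<noteq> 0" by simp_all
  obtain d where d: "d ^ 2 = poly g c" using nth_root_exists[of 2 "poly g c"] by auto
  then have d0: "d \<noteq> 0" using c(2) by auto
  have ex: "\<exists>a b. Affine a b \<in> curve f \<and> \<phi> (Affine a b) = Affine c e \<and> b \<noteq> 0"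
    if e: "e ^ 2 = poly g c" for e
  proof -
    have "Affine c e \<in> curve g" using e by (simp add: curve_def)
    then have "Affine c e \<in> \<phi> ` curve f" by (simp add: image)
    then obtain R where R: "R \<in> curve f" "\<phi> R = Affine c e" by auto
    have "R \<notin> ?B"
    proof
      assume "R \<in> ?B"
      then have "fst_coord XY_Chart (\<phi> R) \<in> fst_coord XY_Chart ` \<phi> ` ?B" by (intro imageI)
      then show False using c(1) R(2) by simp
    qed
    then show ?thesis using R by (cases R) (auto simp: lin_def)
  qed
  obtain a1 b1 where R1: "Affine a1 b1 \<in> curve f" "\<phi> (Affine a1 b1) = Affine c d" "b1 \<noteq> 0"
    using ex[OF d] by blast
  obtain a2 b2 where R2: "Affine a2 b2 \<in> curve f" "\<phi> (Affine a2 b2) = Affine c (- d)" "b2 \<noteq> 0"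
    using ex[of "- d"] d by auto
  interpret isomorphism_pole f g m n \<phi> c d a1 b1 a2 b2
    by unfold_locales (fact f(2) d d0 R1 R2)+
  from branch_points show ?thesis by metis
qed

section \<open>Invariants of binary sextics\<close>

lemma (in smooth_curve) card_roots: "card {r. poly f r = 0} = degree f"
proof -
  have f0: "f \<noteq> 0" using monic by auto
  obtain A where A: "size A = degree f" "f = (\<Prod>x\<in>#A. [:- x, 1:])"
    using alg_closed_imp_factorization[OF f0] monic by auto
  have "count A r = 1" if "r \<in># A" for r
  proof (rule ccontr)
    assume "count A r \<noteq> 1"
    then have "count A r \<ge> 2" using that by (metis Suc_1 Suc_leI count_greater_zero_iff le_neq_implies_less One_nat_def)
    then have "{#r, r#} \<subseteq># A" by (intro mset_subset_eqI) (auto simp: numeral_eq_Suc)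
    then obtain B where B: "A = {#r, r#} + B" by (metis subset_mset.add_diff_inverse)
    have eq: "f = [:- r, 1:] * ([:- r, 1:] * (\<Prod>x\<in>#B. [:- x, 1:]))"
      unfolding A(2) B by (simp only: image_mset_union image_mset_add_mset image_mset_empty
          prod_mset.union prod_mset.add_mset prod_mset.empty mult_1_right mult.assoc)
    then have r: "poly f r = 0" by simp
    have "poly (pderiv f) r = 0" unfolding eq pderiv_mult by (simp add: pderiv_pCons)
    then show False using simple_root[OF r] by simp
  qed
  then have "size A = card (set_mset A)" by (simp add: size_multiset_overloaded_eq)
  moreover have "set_mset A = {r. poly f r = 0}" unfolding A(2) by (auto simp: poly_prod_mset)
  ultimately show ?thesis using A(1) by simp
qed

lemma monic_eq_prod_roots:
  fixes p :: "'a::field poly"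
  assumes "lead_coeff p = 1" "degree p = card S" "finite S" "\<And>r. r \<in> S \<Longrightarrow> poly p r = 0"
  shows "p = (\<Prod>r\<in>S. [:- r, 1:])"
proof -
  have deg: "degree (\<Prod>r\<in>S. [:- r, 1:]) = card S" by (simp add: degree_prod_eq_sum_degree)
  moreover have "lead_coeff (\<Prod>r\<in>S. [:- r, 1:]) = 1" by (simp add: lead_coeff_prod)
  ultimately show ?thesis using assms
    by (intro poly_eqI_degree_lead_coeff[where n = "card S" and A = S]) (auto simp: poly_prod)
qed

text \<open>The coefficients \<open>cov0\<close>, \dots, \<open>cov4\<close> are those of the covariant
  \<open>(f,f)\<^sub>4\<close>, a binary quartic, and \<open>inv4\<close>, \<open>inv6\<close> are its two invariants; \<open>inv2\<close> is \<open>(f,f)\<^sub>6\<close>.\<close>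

definition cov0 :: "'a::comm_ring_1 poly \<Rightarrow> 'a" where
  "cov0 p = 10 * coeff p 0 * coeff p 4 - 5 * coeff p 1 * coeff p 3 + 2 * coeff p 2 ^ 2"
definition cov1 :: "'a::comm_ring_1 poly \<Rightarrow> 'a" where
  "cov1 p = 50 * coeff p 0 * coeff p 5 - 10 * coeff p 1 * coeff p 4 + 2 * coeff p 2 * coeff p 3"
definition cov2 :: "'a::comm_ring_1 poly \<Rightarrow> 'a" where
  "cov2 p = 150 * coeff p 0 * coeff p 6 - 6 * coeff p 2 * coeff p 4 + 3 * coeff p 3 ^ 2"
definition cov3 :: "'a::comm_ring_1 poly \<Rightarrow> 'a" where
  "cov3 p = 50 * coeff p 1 * coeff p 6 - 10 * coeff p 2 * coeff p 5 + 2 * coeff p 3 * coeff p 4"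
definition cov4 :: "'a::comm_ring_1 poly \<Rightarrow> 'a" where
  "cov4 p = 10 * coeff p 2 * coeff p 6 - 5 * coeff p 3 * coeff p 5 + 2 * coeff p 4 ^ 2"
definition inv2 :: "'a::comm_ring_1 poly \<Rightarrow> 'a" where
  "inv2 p = 120 * coeff p 0 * coeff p 6 - 20 * coeff p 1 * coeff p 5 + 8 * coeff p 2 * coeff p 4
    - 3 * coeff p 3 ^ 2"
definition inv4 :: "'a::comm_ring_1 poly \<Rightarrow> 'a" where
  "inv4 p = 12 * cov0 p * cov4 p - 3 * cov1 p * cov3 p + cov2 p ^ 2"
definition inv6 :: "'a::comm_ring_1 poly \<Rightarrow> 'a" where
  "inv6 p = 72 * cov0 p * cov2 p * cov4 p + 9 * cov1 p * cov2 p * cov3 p - 27 * cov0 p * cov3 p ^ 2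
    - 27 * cov1 p ^ 2 * cov4 p - 2 * cov2 p ^ 3"

lemmas cov_defs = cov0_def cov1_def cov2_def cov3_def cov4_def
lemmas inv_defs = inv2_def inv4_def inv6_def

text \<open>Equality in weighted projective space, the weights being half the degrees of the
  invariants. With an explicit factor it stays meaningful when invariants vanish.\<close>

definition same_invariants :: "'a::field poly \<Rightarrow> 'a poly \<Rightarrow> bool" where
  "same_invariants p q \<longleftrightarrow>
    (\<exists>k. k \<noteq> 0 \<and> inv2 q = k * inv2 p \<and> inv4 q = k ^ 2 * inv4 p \<and> inv6 q = k ^ 3 * inv6 p)"

lemma same_invariants_trans:
  "same_invariants p q \<Longrightarrow> same_invariants q r \<Longrightarrow> same_invariants p r"
  unfolding same_invariants_def
proof (elim exE conjE)
  fix k l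
  assume "k \<noteq> 0" "inv2 q = k * inv2 p" "inv4 q = k ^ 2 * inv4 p" "inv6 q = k ^ 3 * inv6 p"
    "l \<noteq> 0" "inv2 r = l * inv2 q" "inv4 r = l ^ 2 * inv4 q" "inv6 r = l ^ 3 * inv6 q"
  then show "\<exists>k. k \<noteq> 0 \<and> inv2 r = k * inv2 p \<and> inv4 r = k ^ 2 * inv4 p \<and> inv6 r = k ^ 3 * inv6 p"
    by (intro exI[of _ "l * k"]) (simp add: power_mult_distrib)
qed

lemma sextic_eq:
  assumes "degree p \<le> 6"
  shows "p = [:coeff p 0, coeff p 1, coeff p 2, coeff p 3, coeff p 4, coeff p 5, coeff p 6:]"
proof (rule poly_eqI)
  fix n :: nat
  consider "n = 0" | "n = 1" | "n = 2" | "n = 3" | "n = 4" | "n = 5" | "n = 6" | "n > 6" by linarith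
  then show "coeff p n = coeff [:coeff p 0, coeff p 1, coeff p 2, coeff p 3, coeff p 4, coeff p 5, coeff p 6:] n"
  proof cases
    case 8
    then have "coeff p n = 0" using assms by (intro coeff_eq_0) simp
    moreover obtain k where "n = Suc (Suc (Suc (Suc (Suc (Suc (Suc k))))))"
      using le_Suc_ex[of 7 n] 8 by (auto simp: numeral_eq_Suc)
    ultimately show ?thesis by simp
  qed (simp_all add: numeral_eq_Suc)
qed

lemma coeffs_shift:
  fixes a0 :: "'a::comm_ring_1"
  assumes "p = [:a0, a1, a2, a3, a4, a5, a6:]"
  shows "coeff (pcompose p [:s, 1:]) 6 = a6"
    "coeff (pcompose p [:s, 1:]) 5 = a5 + 6 * a6 * s"
    "coeff (pcompose p [:s, 1:]) 4 = a4 + 5 * a5 * s + 15 * a6 * s ^ 2"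
    "coeff (pcompose p [:s, 1:]) 3 = a3 + 4 * a4 * s + 10 * a5 * s ^ 2 + 20 * a6 * s ^ 3"
    "coeff (pcompose p [:s, 1:]) 2 = a2 + 3 * a3 * s + 6 * a4 * s ^ 2 + 10 * a5 * s ^ 3 + 15 * a6 * s ^ 4"
    "coeff (pcompose p [:s, 1:]) 1 = a1 + 2 * a2 * s + 3 * a3 * s ^ 2 + 4 * a4 * s ^ 3 + 5 * a5 * s ^ 4 + 6 * a6 * s ^ 5"
    "coeff (pcompose p [:s, 1:]) 0 = a0 + a1 * s + a2 * s ^ 2 + a3 * s ^ 3 + a4 * s ^ 4 + a5 * s ^ 5 + a6 * s ^ 6"
  unfolding assms by (simp_all add: pcompose_pCons numeral_eq_Suc algebra_simps)

text \<open>The quartic covariant of the shifted sextic is the shifted quartic covariant, so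
  translation invariance of \<open>inv4\<close> and \<open>inv6\<close> reduces to that of the two
  invariants of a quartic.\<close>

lemma cov_shift:
  fixes p :: "'a::comm_ring_1 poly" and s :: 'a
  assumes "degree p \<le> 6"
  defines "q \<equiv> pcompose p [:s, 1:]"
  shows "cov4 q = cov4 p" "cov3 q = cov3 p + 4 * cov4 p * s"
    "cov2 q = cov2 p + 3 * cov3 p * s + 6 * cov4 p * s ^ 2"
    "cov1 q = cov1 p + 2 * cov2 p * s + 3 * cov3 p * s ^ 2 + 4 * cov4 p * s ^ 3"
    "cov0 q = cov0 p + cov1 p * s + cov2 p * s ^ 2 + cov3 p * s ^ 3 + cov4 p * s ^ 4"
    "inv2 q = inv2 p"
proof -
  define a0 a1 a2 a3 a4 a5 a6 where a: "a0 = coeff p 0" "a1 = coeff p 1" "a2 = coeff p 2"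
    "a3 = coeff p 3" "a4 = coeff p 4" "a5 = coeff p 5" "a6 = coeff p 6"
  note c = coeffs_shift[OF sextic_eq[OF assms(1)], of s, folded a]
  show "cov4 q = cov4 p" "cov3 q = cov3 p + 4 * cov4 p * s"
    "cov2 q = cov2 p + 3 * cov3 p * s + 6 * cov4 p * s ^ 2"
    "cov1 q = cov1 p + 2 * cov2 p * s + 3 * cov3 p * s ^ 2 + 4 * cov4 p * s ^ 3"
    "cov0 q = cov0 p + cov1 p * s + cov2 p * s ^ 2 + cov3 p * s ^ 3 + cov4 p * s ^ 4"
    "inv2 q = inv2 p"
    unfolding cov_defs inv2_def q_def c a[symmetric] by (simp_all add: algebra_simps eval_nat_numeral)
qed

lemma same_invariants_shift:
  fixes p :: "'a::field poly"
  assumes "degree p \<le> 6"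
  shows "same_invariants p (pcompose p [:s, 1:])"
  unfolding same_invariants_def
proof (intro exI[of _ 1] conjI)
  show "inv4 (pcompose p [:s, 1:]) = 1 ^ 2 * inv4 p" "inv6 (pcompose p [:s, 1:]) = 1 ^ 3 * inv6 p"
    unfolding inv4_def inv6_def cov_shift[OF assms] by (simp_all add: algebra_simps eval_nat_numeral)
qed (simp_all add: cov_shift[OF assms])

lemma coeff_pcompose_linear:
  fixes p :: "'a::comm_ring_1 poly"
  shows "coeff (pcompose p [:0, s:]) k = coeff p k * s ^ k"
  by (induction p arbitrary: k) (auto simp: pcompose_pCons coeff_pCons mult_ac split: nat.splits)

lemma same_invariants_scale:
  fixes p :: "'a::field poly"
  assumes "s \<noteq> 0"
  shows "same_invariants p (pcompose p [:0, s:])"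
  unfolding same_invariants_def
proof (intro exI[of _ "s ^ 6"] conjI)
  define a0 a1 a2 a3 a4 a5 a6 where a: "a0 = coeff p 0" "a1 = coeff p 1" "a2 = coeff p 2"
    "a3 = coeff p 3" "a4 = coeff p 4" "a5 = coeff p 5" "a6 = coeff p 6"
  let ?q = "pcompose p [:0, s:]"
  have cov: "cov0 ?q = s ^ 4 * cov0 p" "cov1 ?q = s ^ 5 * cov1 p" "cov2 ?q = s ^ 6 * cov2 p"
    "cov3 ?q = s ^ 7 * cov3 p" "cov4 ?q = s ^ 8 * cov4 p"
    unfolding cov_defs coeff_pcompose_linear a[symmetric] by (simp_all add: algebra_simps eval_nat_numeral)
  show "inv2 ?q = s ^ 6 * inv2 p" unfolding inv2_def coeff_pcompose_linear a[symmetric] by (simp add: algebra_simps eval_nat_numeral)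
  show "inv4 ?q = (s ^ 6) ^ 2 * inv4 p" unfolding inv4_def cov by (simp add: algebra_simps eval_nat_numeral)
  show "inv6 ?q = (s ^ 6) ^ 3 * inv6 p" unfolding inv6_def cov by (simp add: algebra_simps eval_nat_numeral)
qed (use assms in simp)

lemma same_invariants_smult:
  fixes p :: "'a::field poly"
  assumes "s \<noteq> 0"
  shows "same_invariants p (smult s p)"
  unfolding same_invariants_def
proof (intro exI[of _ "s ^ 2"] conjI)
  define a0 a1 a2 a3 a4 a5 a6 where a: "a0 = coeff p 0" "a1 = coeff p 1" "a2 = coeff p 2"
    "a3 = coeff p 3" "a4 = coeff p 4" "a5 = coeff p 5" "a6 = coeff p 6"
  let ?q = "smult s p"
  have cov: "cov0 ?q = s ^ 2 * cov0 p" "cov1 ?q = s ^ 2 * cov1 p" "cov2 ?q = s ^ 2 * cov2 p"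
    "cov3 ?q = s ^ 2 * cov3 p" "cov4 ?q = s ^ 2 * cov4 p"
    unfolding cov_defs coeff_smult a[symmetric] by (simp_all add: algebra_simps eval_nat_numeral)
  show "inv2 ?q = s ^ 2 * inv2 p" unfolding inv2_def coeff_smult a[symmetric] by (simp add: algebra_simps eval_nat_numeral)
  show "inv4 ?q = (s ^ 2) ^ 2 * inv4 p" unfolding inv4_def cov by (simp add: algebra_simps eval_nat_numeral)
  show "inv6 ?q = (s ^ 2) ^ 3 * inv6 p" unfolding inv6_def cov by (simp add: algebra_simps eval_nat_numeral)
qed (use assms in simp)

lemma same_invariants_reflect:
  fixes p :: "'a::field poly"
  assumes "degree p = 6"
  shows "same_invariants p (reflect_poly p)"
  unfolding same_invariants_def
proof (intro exI[of _ 1] conjI)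
  let ?q = "reflect_poly p"
  have c: "coeff ?q 0 = coeff p 6" "coeff ?q 1 = coeff p 5" "coeff ?q 2 = coeff p 4" "coeff ?q 3 = coeff p 3"
    "coeff ?q 4 = coeff p 2" "coeff ?q 5 = coeff p 1" "coeff ?q 6 = coeff p 0"
    using assms by (simp_all add: coeff_reflect_poly)
  have cov: "cov0 ?q = cov4 p" "cov1 ?q = cov3 p" "cov2 ?q = cov2 p" "cov3 ?q = cov1 p" "cov4 ?q = cov0 p"
    unfolding cov_defs c by (simp_all add: mult_ac)
  show "inv2 ?q = 1 * inv2 p" unfolding inv2_def c by (simp add: mult_ac)
  show "inv4 ?q = 1 ^ 2 * inv4 p" unfolding inv4_def cov by (simp add: mult_ac)
  show "inv6 ?q = 1 ^ 3 * inv6 p" unfolding inv6_def cov by (simp add: algebra_simps eval_nat_numeral)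
qed simp

text \<open>The index set stays fixed while \<open>\<theta>\<close> moves the roots, so that a
  Moebius map can be applied in elementary stages to the same six indices.\<close>

definition root_poly :: "'b set \<Rightarrow> ('b \<Rightarrow> 'a::field) \<Rightarrow> 'a poly" where
  "root_poly S \<theta> = (\<Prod>r\<in>S. [:- \<theta> r, 1:])"

lemma degree_root_poly: "finite S \<Longrightarrow> degree (root_poly S \<theta>) = card S"
  by (simp add: root_poly_def degree_prod_eq_sum_degree)

lemma root_poly_shift:
  assumes "card S = 6"
  shows "same_invariants (root_poly S \<theta>) (root_poly S (\<lambda>r. \<theta> r + s))"
proof -
  have "finite S" using assms by (metis card.infinite zero_neq_numeral)
  have "root_poly S (\<lambda>r. \<theta> r + s) = pcompose (root_poly S \<theta>) [:- s, 1:]"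
    unfolding root_poly_def pcompose_prod by (intro prod.cong) (simp_all add: pcompose_pCons)
  then show ?thesis
    using same_invariants_shift[of "root_poly S \<theta>" "- s"] assms \<open>finite S\<close> by (simp add: degree_root_poly)
qed

lemma root_poly_scale:
  assumes "card S = 6" "s \<noteq> 0"
  shows "same_invariants (root_poly S \<theta>) (root_poly S (\<lambda>r. s * \<theta> r))"
proof -
  have "root_poly S (\<lambda>r. s * \<theta> r) = (\<Prod>r\<in>S. smult s (pcompose [:- \<theta> r, 1:] [:0, inverse s:]))"
    unfolding root_poly_def using assms(2) by (intro prod.cong) (simp_all add: pcompose_pCons)
  also have "\<dots> = smult (s ^ card S) (pcompose (root_poly S \<theta>) [:0, inverse s:])"
    unfolding prod_smult root_poly_def pcompose_prod by simp
  finally have eq: "root_poly S (\<lambda>r. s * \<theta> r) =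
    smult (s ^ card S) (pcompose (root_poly S \<theta>) [:0, inverse s:])" .
  show ?thesis unfolding eq
    by (rule same_invariants_trans[OF same_invariants_scale same_invariants_smult]) (use assms(2) in simp_all)
qed

lemma root_poly_inverse:
  assumes "card S = 6" "\<And>r. r \<in> S \<Longrightarrow> \<theta> r \<noteq> 0"
  shows "same_invariants (root_poly S \<theta>) (root_poly S (\<lambda>r. inverse (\<theta> r)))"
proof -
  have fin: "finite S" using assms by (metis card.infinite zero_neq_numeral)
  have "root_poly S (\<lambda>r. inverse (\<theta> r)) = (\<Prod>r\<in>S. smult (- inverse (\<theta> r)) (reflect_poly [:- \<theta> r, 1:]))"
    unfolding root_poly_def using assms(2) by (intro prod.cong) (simp_all add: reflect_poly_pCons)
  also have "\<dots> = smult (\<Prod>r\<in>S. - inverse (\<theta> r)) (reflect_poly (root_poly S \<theta>))"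
    unfolding prod_smult root_poly_def reflect_poly_prod ..
  finally have eq: "root_poly S (\<lambda>r. inverse (\<theta> r)) =
    smult (\<Prod>r\<in>S. - inverse (\<theta> r)) (reflect_poly (root_poly S \<theta>))" .
  have "(\<Prod>r\<in>S. - inverse (\<theta> r)) \<noteq> 0" using assms(2) fin by simp
  then show ?thesis unfolding eq
    using same_invariants_trans[OF same_invariants_reflect same_invariants_smult] degree_root_poly[OF fin, of \<theta>] assms(1)
    by metis
qed

text \<open>The map \<open>r \<mapsto> c + (r - a)/(\<alpha> r + \<beta>)\<close> is a composition of translations, scalings and inversions
  through \<open>1/(r - a)\<close>, since \<open>(\<alpha> r + \<beta>)/(r - a) = \<alpha> + (\<alpha> a + \<beta>)/(r - a)\<close>.\<close>

lemma root_poly_moebius: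
  fixes S :: "'a::field set"
  assumes S: "card S = 6" and nz: "\<alpha> * a + \<beta> \<noteq> 0"
    and r: "\<And>r. r \<in> S \<Longrightarrow> r \<noteq> a \<and> \<alpha> * r + \<beta> \<noteq> 0"
  shows "same_invariants (root_poly S (\<lambda>r. r)) (root_poly S (\<lambda>r. c + (r - a) / (\<alpha> * r + \<beta>)))"
proof -
  have 1: "same_invariants (root_poly S (\<lambda>r. r)) (root_poly S (\<lambda>r. r - a))"
    using root_poly_shift[OF S, of "\<lambda>r. r" "- a"] by simp
  have 2: "same_invariants (root_poly S (\<lambda>r. r - a)) (root_poly S (\<lambda>r. inverse (r - a)))"
    using r by (intro root_poly_inverse[OF S]) simp
  have 3: "same_invariants (root_poly S (\<lambda>r. inverse (r - a)))
      (root_poly S (\<lambda>r. (\<alpha> * a + \<beta>) * inverse (r - a)))"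
    by (rule root_poly_scale[OF S nz])
  have 4: "same_invariants (root_poly S (\<lambda>r. (\<alpha> * a + \<beta>) * inverse (r - a)))
      (root_poly S (\<lambda>r. (\<alpha> * a + \<beta>) * inverse (r - a) + \<alpha>))"
    by (rule root_poly_shift[OF S])
  have eq: "(\<alpha> * a + \<beta>) * inverse (r - a) + \<alpha> = (\<alpha> * r + \<beta>) / (r - a)" if "r \<in> S" for r
    using r[OF that] by (simp add: field_simps)
  have 5: "same_invariants (root_poly S (\<lambda>r. (\<alpha> * a + \<beta>) * inverse (r - a) + \<alpha>))
      (root_poly S (\<lambda>r. inverse ((\<alpha> * a + \<beta>) * inverse (r - a) + \<alpha>)))"
    by (rule root_poly_inverse[OF S]) (use eq r in simp)
  have 6: "same_invariants (root_poly S (\<lambda>r. inverse ((\<alpha> * a + \<beta>) * inverse (r - a) + \<alpha>)))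
      (root_poly S (\<lambda>r. inverse ((\<alpha> * a + \<beta>) * inverse (r - a) + \<alpha>) + c))"
    by (rule root_poly_shift[OF S])
  have "root_poly S (\<lambda>r. inverse ((\<alpha> * a + \<beta>) * inverse (r - a) + \<alpha>) + c) =
      root_poly S (\<lambda>r. c + (r - a) / (\<alpha> * r + \<beta>))"
    unfolding root_poly_def by (intro prod.cong refl) (simp add: eq)
  with same_invariants_trans[OF 1 same_invariants_trans[OF 2 same_invariants_trans[OF 3
        same_invariants_trans[OF 4 same_invariants_trans[OF 5 6]]]]]
  show ?thesis by simp
qed

text \<open>The Moebius map is injective on the six roots of \<open>f\<close>, so their images
  exhaust the roots of the monic sextic \<open>g\<close>; that \<open>g\<close> has simple roots is
  thus a conclusion. The cardinality is what rules out the singular curve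
  \<open>F_curve 0\<close>.\<close>

theorem isomorphic_curves_invariants:
  fixes f g :: "'a::{alg_closed_field, field_char_0} poly"
  assumes f: "smooth_curve f 3" and g: "even_curve g 3" and iso: "isomorphic_curves f g"
  shows "same_invariants f g \<and> card {r. poly g r = 0} = 6"
proof -
  interpret F: smooth_curve f 3 by fact
  interpret G: even_curve g 3 by fact
  let ?S = "{r. poly f r = 0}"
  obtain a c \<alpha> \<beta> where nz: "\<alpha> * a + \<beta> \<noteq> 0" and r: "\<forall>r. poly f r = 0 \<longrightarrow>
      r \<noteq> a \<and> \<alpha> * r + \<beta> \<noteq> 0 \<and> poly g (c + (r - a) / (\<alpha> * r + \<beta>)) = 0"
    using isomorphic_curves_moebius[OF f order.refl g iso] by (elim exE conjE)
  let ?M = "\<lambda>r. c + (r - a) / (\<alpha> * r + \<beta>)"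
  have S: "card ?S = 6" using F.card_roots F.degree_f by simp
  then have fin: "finite ?S" by (metis card.infinite zero_neq_numeral)
  have inj: "inj_on ?M ?S"
  proof (rule inj_onI)
    fix p q assume pq: "p \<in> ?S" "q \<in> ?S" "?M p = ?M q"
    then have "(p - a) * (\<alpha> * q + \<beta>) = (q - a) * (\<alpha> * p + \<beta>)" using r by (simp add: frac_eq_eq)
    then have "(p - q) * (\<alpha> * a + \<beta>) = 0" by (simp add: algebra_simps)
    then show "p = q" using nz by simp
  qed
  have card: "card (?M ` ?S) = 6" using S inj by (simp add: card_image)
  have "g = (\<Prod>s\<in>?M ` ?S. [:- s, 1:])"
  proof (rule monic_eq_prod_roots[OF G.monic])
    show "degree g = card (?M ` ?S)" using G.degree_f card by simp
    show "finite (?M ` ?S)" using fin by simp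
    show "poly g s = 0" if "s \<in> ?M ` ?S" for s using that r by blast
  qed
  also have "\<dots> = root_poly ?S ?M" unfolding root_poly_def prod.reindex[OF inj] by simp
  finally have gM: "g = root_poly ?S ?M" .
  have "f = root_poly ?S (\<lambda>r. r)" unfolding root_poly_def
    by (rule monic_eq_prod_roots[OF F.monic _ fin]) (simp_all add: F.degree_f S)
  moreover have "same_invariants (root_poly ?S (\<lambda>r. r)) (root_poly ?S ?M)"
    using r by (intro root_poly_moebius[OF S nz]) simp
  ultimately have "same_invariants f g" using gM by simp
  moreover have "{r. poly g r = 0} = ?M ` ?S"
  proof -
    have lin: "poly [:- k, 1:] x = x - k" for k x :: 'a by simp
    have "poly g x = (\<Prod>r\<in>?S. x - ?M r)" for x unfolding gM root_poly_def poly_prod lin ..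
    then show ?thesis using fin by (auto simp: prod_zero_iff)
  qed
  ultimately show ?thesis using card by simp
qed

section \<open>The continued fraction\<close>

definition h_poly :: "'a::field \<Rightarrow> 'a poly" where
  "h_poly v =
     [: - ((v^5 + 46 * v^4 + 736 * v^3 + 5248 * v^2 + 18432 * v + 24576) / (2 * v^2 * (v + 8)^4)),
        - ((v^5 + 80 * v^4 + 1664 * v^3 + 12288 * v^2 + 36864 * v + 32768) / (2 * v^2 * (v + 8)^4)),
        (v^6 + 112 * v^5 + 2880 * v^4 + 25600 * v^3 + 106496 * v^2 + 262144 * v + 262144)
           / (16 * v^2 * (v + 8)^4),
        (6 * v^3 + 224 * v^2 + 1536 * v + 3072) / (v * (v + 8)^3),
        - ((v^3 + 40 * v^2 + 128 * v + 512) / (2 * v * (v + 8)^2)),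
        - (16 / (v + 8)),
        1 :]"

text \<open>A state of the continued fraction algorithm: \<open>(A, B)\<close> and
  \<open>(A', B')\<close> are successive convergents, whose norms and mixed product carry the
  denominators \<open>Q\<close>, \<open>Q'\<close> and the term \<open>P\<close>; \<open>s\<close>
  is the alternating sign. The degree \<open>d\<close> is tracked because it becomes the pole order
  at infinity.\<close>

definition pell_state :: "'a::field poly \<Rightarrow> 'a poly \<Rightarrow> 'a poly \<Rightarrow> 'a poly \<Rightarrow> nat \<Rightarrow> bool" where
  "pell_state f P Q Q' d \<longleftrightarrow> (\<exists>A B A' B' s. s * s = 1 \<and> A * A - B * B * f = s * Q \<and>
     A' * A' - B' * B' * f = - s * Q' \<and> A' * A - B' * B * f = s * P \<and> degree A' = d \<and> degree A < d)"

lemma pell_step: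
  fixes f :: "'a::field poly"
  assumes "pell_state f P Q Q' d" "degree a > 0"
    and P': "P + P' = a * Q'" and Q'': "Q'' = Q + a * (P - P')"
  shows "pell_state f P' Q' Q'' (d + degree a)"
proof -
  obtain A B A' B' s where 1: "s * s = 1" "A * A - B * B * f = s * Q"
    "A' * A' - B' * B' * f = - s * Q'" "A' * A - B' * B * f = s * P" "degree A' = d" "degree A < d"
    using assms(1) unfolding pell_state_def by blast
  have P'_eq: "P' = a * Q' - P" using P' by (simp add: algebra_simps)
  let ?A = "a * A' + A" and ?B = "a * B' + B"
  have "?A * ?A - ?B * ?B * f = a * a * (A' * A' - B' * B' * f) + 2 * a * (A' * A - B' * B * f)
      + (A * A - B * B * f)" by (simp add: algebra_simps)
  also have "\<dots> = s * Q''" unfolding 1 Q'' P'_eq by (simp add: algebra_simps)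
  finally have N: "?A * ?A - ?B * ?B * f = - (- s) * Q''" by simp
  have "?A * A' - ?B * B' * f = a * (A' * A' - B' * B' * f) + (A' * A - B' * B * f)"
    by (simp add: algebra_simps)
  also have "\<dots> = - s * P'" unfolding 1 P'_eq by (simp add: algebra_simps)
  finally have I: "?A * A' - ?B * B' * f = - s * P'" .
  have "A' \<noteq> 0" "a \<noteq> 0" using 1(5,6) assms(2) by auto
  then have "degree (a * A') = d + degree a" using 1(5) by (simp add: degree_mult_eq)
  then have deg: "degree ?A = d + degree a" using 1(6) by (subst degree_add_eq_left) simp_all
  show ?thesis unfolding pell_state_def
    by (rule exI[of _ A'], rule exI[of _ B'], rule exI[of _ ?A], rule exI[of _ ?B], rule exI[of _ "- s"])
      (use 1 N I deg assms(2) in simp)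
qed

text \<open>The continued fraction of the square root of \<open>h_poly v\<close>: partial quotients \<open>a\<^sub>1, \<dots>, a\<^sub>7\<close>, with
  complete quotients \<open>(P\<^sub>n + y)/Q\<^sub>n\<close>. It is symmetric about the linear polynomial \<open>Q\<^sub>4\<close>.\<close>

lemma h_poly_pell:
  fixes v :: "'a::field_char_0"
  assumes v: "v \<noteq> 0" "v + 8 \<noteq> 0"
  shows "\<exists>P Q. pell_state (h_poly v) P Q 1 11"
proof -
  define w where "w = v + 8"
  have w: "w \<noteq> 0" and vw: "v = w - 8" using v by (simp_all add: w_def)
  define P1 where "P1 = [:(v^2 + 24 * v + 64) / (v * w^2), - (v^3 + 40 * v^2 + 256 * v + 512) / (4 * v * w^2), - 8 / w, 1:]"
  define P2 where "P2 = [:(v^2 + 24 * v + 64) / (v * w^2), - (v^3 + 24 * v^2 + 128 * v + 512) / (4 * v * w^2), - 8 / w, 1:]"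
  define P3 where "P3 = [:(v^2 + 8 * v + 64) / (v * w^2), - (v^3 + 24 * v^2 + 128 * v + 512) / (4 * v * w^2), - 8 / w, 1:]"
  define P4 where "P4 = [:- (v^2 + 8 * v + 64) / (v * w^2), - (v^3 + 40 * v^2 + 256 * v + 512) / (4 * v * w^2), - 8 / w, 1:]"
  define Q1 where "Q1 = [:- (v^2 + 24 * v + 64) / (2 * v^2 * w), - 8 / (v * w), 2 / v:]"
  define Q2 where "Q2 = [:1, 16 * v / w^2, - 4 * v / w:]"
  define Q3 where "Q3 = [:- (v^3 + 32 * v^2 + 192 * v + 512) / (2 * v^2 * w^2), - 16 / (v * w), 2 / v:]"
  define Q4 where "Q4 = [:1, 2 :: 'a:]"
  define a1 where "a1 = [:- 4 * v / w, v:]"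
  define a2 where "a2 = [:2 / v, - w / (2 * v):]"
  define a3 where "a3 = [:0, v:]"
  define a4 where "a4 = [:- 2 * (v^2 + 8 * v + 64) / (v * w^2), - (v + 24) / (2 * w), 1:]"
  note defs = P1_def P2_def P3_def P4_def Q1_def Q2_def Q3_def Q4_def a1_def a2_def a3_def a4_def
  have s0: "P1 * P1 + Q1 = h_poly v" unfolding h_poly_def w_def[symmetric] defs
    using v(1) w by (simp add: divide_simps) (simp add: vw algebra_simps eval_nat_numeral)
  have s1: "P1 + P2 = a1 * Q1" "Q2 = 1 + a1 * (P1 - P2)" unfolding defs one_pCons
    using v(1) w by (simp_all add: divide_simps) (simp_all add: vw algebra_simps eval_nat_numeral)
  have s2: "P2 + P3 = a2 * Q2" "Q3 = Q1 + a2 * (P2 - P3)" unfolding defs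
    using v(1) w by (simp_all add: divide_simps) (simp_all add: vw algebra_simps eval_nat_numeral)
  have s3: "P3 + P4 = a3 * Q3" "Q4 = Q2 + a3 * (P3 - P4)" unfolding defs
    using v(1) w by (simp_all add: divide_simps) (simp_all add: vw algebra_simps eval_nat_numeral)
  have s4: "P4 + P4 = a4 * Q4" unfolding defs
    using v(1) w by (simp_all add: divide_simps) (simp_all add: vw algebra_simps eval_nat_numeral)
  have deg: "degree a1 = 1" "degree a2 = 1" "degree a3 = 1" "degree a4 = 2"
    unfolding defs using v(1) w by simp_all
  \<comment> \<open>The expansion starts from the convergents \<open>1/0\<close> and
    \<open>P1/1\<close>; \<open>P1\<close> is the polynomial part of the square root, as the
    remainder \<open>Q1\<close> has degree 2.\<close>
  have "pell_state (h_poly v) P1 1 Q1 3"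
    unfolding pell_state_def
    by (rule exI[of _ 1], rule exI[of _ 0], rule exI[of _ P1], rule exI[of _ 1], rule exI[of _ 1])
      (simp add: s0[symmetric], simp add: P1_def)
  from pell_step[OF this _ s1] have "pell_state (h_poly v) P2 Q1 Q2 4" using deg by simp
  from pell_step[OF this _ s2] have "pell_state (h_poly v) P3 Q2 Q3 5" using deg by simp
  from pell_step[OF this _ s3] have "pell_state (h_poly v) P4 Q3 Q4 6" using deg by simp
  \<comment> \<open>The middle step has the same \<open>P\<close> on both sides, so
    \<open>Q3\<close> recurs and the remaining steps run the relations backwards. The degrees add up
    to 3 + 1 + 1 + 1 + 2 + 1 + 1 + 1 = 11, and the last denominator is 1.\<close>
  from pell_step[OF this _ s4, of Q3] have "pell_state (h_poly v) P4 Q4 Q3 8" using deg by simp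
  from pell_step[OF this, of a3 P3 Q2] have "pell_state (h_poly v) P3 Q3 Q2 9"
    using deg s3 by (simp add: algebra_simps)
  from pell_step[OF this, of a2 P2 Q1] have "pell_state (h_poly v) P2 Q2 Q1 10"
    using deg s2 by (simp add: algebra_simps)
  from pell_step[OF this, of a1 P1 1] have "pell_state (h_poly v) P1 Q1 1 11"
    using deg s1 by (simp add: algebra_simps)
  then show ?thesis by blast
qed

section \<open>The invariants of the two families\<close>

text \<open>Two combinations of the invariants that factor on both families. In the names of the factors
  below, the number is the degree.\<close>

definition sub4 :: "'a::comm_ring_1 poly \<Rightarrow> 'a" where
  "sub4 p = 4 * inv4 p - 9 * inv2 p ^ 2"

definition sub8 :: "'a::comm_ring_1 poly \<Rightarrow> 'a" where
  "sub8 p = 32 * inv2 p * inv6 p + 360 * inv2 p ^ 2 * inv4 p - 351 * inv2 p ^ 4 - 48 * inv4 p ^ 2"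

definition a8 :: "int poly" where
  "a8 = [:-16777216, -101187584, -87228416, -29859840, -5047296, -449920, -20368, -384, -1:]"

definition x11 :: "int poly" where
  "x11 = [:-8589934592, -30870077440, -35894853632, -20372783104, -6532628480, -1269215232, -154891776,
    -11976640, -574608, -16048, -224, -1:]"

definition y21 :: "int poly" where
  "y21 = [:18446744073709551616, 68598829524107395072, 119477120414418731008, 128376479568707452928,
    94766708461286719488, 50850190637280526336, 20526770729135374336, 6377912583566917632,
    1549883046465896448, 297882001644453888, 45621439622021120, 5591683825270784, 549203190235136,
    43150390980608, 2698291299328, 133078801664, 5103526080, 148936848, 3198892, 47839, 448, 2:]"

definition a3 :: "int poly" where
  "a3 = [:3, -16, 56, 4:]"

definition q3 :: "int poly" where
  "q3 = [:-1, 2, 27, -86:]"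

definition q7 :: "int poly" where
  "q7 = [:-1, 23, -234, 1305, -4285, 6807, -1447, -1:]"

text \<open>Besides \<open>v\<close> and \<open>v + 8\<close>, the only factor at whose zeros
  \<open>H_form\<close> can acquire a multiple root.\<close>

definition d7 :: "int poly" where
  "d7 = [:-4194304, 2883584, 2846720, 462848, 13760, -1328, -44, 1:]"

text \<open>The inner variable is \<open>v\<close>, the outer one is \<open>X\<close> rescaled by
  \<open>v + 8\<close>. This rescaling and the factor \<open>16 v^2 (v + 8)^6\<close> clear all
  denominators of \<open>h_poly v\<close> while the coefficients stay of degree at most 7 in
  \<open>v\<close>.\<close>

definition H_form :: "int poly poly" where
  "H_form = [:[:-12582912, -12582912, -5242880, -1196032, -159744, -12288, -496, -8:],
    [:-2097152, -2621440, -1081344, -204800, -18432, -704, -8:],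
    [:262144, 262144, 106496, 25600, 2880, 112, 1:],
    [:0, 49152, 24576, 3584, 96:],
    [:0, -4096, -1024, -320, -8:],
    [:0, 0, -256:],
    [:0, 0, 16:]:]"

definition F_form :: "int poly poly" where
  "F_form = [:[:0, 0, 1:],
    [:0, 2, -2:],
    [:1, 0, 1:],
    [:2:],
    [:3, 2:],
    [:2:],
    [:1:]:]"

lemma coeff_H_form:
  shows "coeff H_form 0 = [:-12582912, -12582912, -5242880, -1196032, -159744, -12288, -496, -8:]"
    "coeff H_form 1 = [:-2097152, -2621440, -1081344, -204800, -18432, -704, -8:]"
    "coeff H_form 2 = [:262144, 262144, 106496, 25600, 2880, 112, 1:]"
    "coeff H_form 3 = [:0, 49152, 24576, 3584, 96:]"
    "coeff H_form 4 = [:0, -4096, -1024, -320, -8:]"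
    "coeff H_form 5 = [:0, 0, -256:]"
    "coeff H_form 6 = [:0, 0, 16:]"
  unfolding H_form_def by (simp_all add: numeral_eq_Suc)

text \<open>Expanded tables let each layer of the invariants be evaluated on literal polynomials
  instead of nested products.\<close>

lemma cov_H_form:
  shows "cov0 H_form = [:137438953472, 1305670057984, 1795296329728, 1147830009856, 427684790272, 100948508672, 15668871168,
      1613758464, 108437504, 4526080, 105728, 1088, 2:]"
    "cov1 H_form = [:0, -60129542144, 70866960384, 108447924224, 48771366912, 11142168576, 1441792000, 105545728,
      3944448, 49152, -448:]"
    "cov2 H_form = [:0, 6442450944, -14898167808, -18220056576, -7914651648, -1868562432, -255983616, -19955712,
      -803328, -11904, 48:]"
    "cov3 H_form = [:0, 0, -1409286144, -1728053248, -703594496, -122945536, -10256384, -395264, -5376:]"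
    "cov4 H_form = [:0, 0, 75497472, 121634816, 55836672, 10125312, 821248, 28160, 288:]"
  unfolding cov_defs coeff_H_form by (simp_all add: power2_eq_square numeral_poly)

lemma inv_H_form:
  shows "inv2 H_form = [:0, -8589934592, -52881784832, -51136954368, -20870856704, -4495245312, -553385984, -39223296,
    -1500160, -25088, -64:]"
    "inv4 H_form = [:0, 0, 166020696663385964544, 937325183245366591488, 3599438951781085741056, 5691775309860399218688,
    4865319742241639497728, 2609786866677766422528, 952723271846323027968, 248198811449875759104,
    47468732682929700864, 6770621973383872512, 724566841170591744, 58009472735379456, 3430683645050880,
    146106734346240, 4283678588928, 79806332928, 810123264, 3293184, 9216:]"
    "inv6 H_form = [:0, 0, 0, 4278320775770274230051373318144, 36232029069804509885747567788032,
    -94946132450565900271403768217600, -593061718994956879488585308307456,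
    -1192086099499565393763398068469760, -1400945297089770860983875601956864,
    -1120266388413715243097323273715712, -654332653647772433477603841540096,
    -290983182508369273651101702291456, -101235921994103430915309189464064,
    -28079296836814837963555520643072, -6292236124634042387500678250496,
    -1149749618633405774209335951360, -172336280108709804002192130048, -21256876279230473574706839552,
    -2158805513588484622056947712, -180149401510900546223996928, -12293065643532916453539840,
    -680449230655068517171200, -30184321955969466630144, -1054289879715840786432, -28252633176119181312,
    -557990546497339392, -7579092614381568, -61064620277760, -165141282816, 948436992, 1769472:]"
  unfolding inv_defs coeff_H_form cov_H_form by (simp_all add: power2_eq_square power3_eq_cube numeral_poly)


lemma coeff_F_form:
  shows "coeff F_form 0 = [:0, 0, 1:]"
    "coeff F_form 1 = [:0, 2, -2:]"
    "coeff F_form 2 = [:1, 0, 1:]"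
    "coeff F_form 3 = [:2:]"
    "coeff F_form 4 = [:3, 2:]"
    "coeff F_form 5 = [:2:]"
    "coeff F_form 6 = [:1:]"
  unfolding F_form_def by (simp_all add: numeral_eq_Suc)

lemma cov_F_form:
  shows "cov0 F_form = [:2, -20, 54, 20, 2:]"
    "cov1 F_form = [:4, -60, 124, 40:]"
    "cov2 F_form = [:-6, -12, 132, -12:]"
    "cov3 F_form = [:-8, 108, -120:]"
    "cov4 F_form = [:8, 24, 18:]"
  unfolding cov_defs coeff_F_form by (simp_all add: power2_eq_square numeral_poly)

lemma inv_F_form:
  shows "inv2 F_form = [:12, -64, 224, 16:]"
    "inv4 F_form = [:324, -3936, 22272, -50688, 67008, 16128, 576:]"
    "inv6 F_form = [:-11664, 212544, -1924992, 10824192, -40970880, 72880128, -26047872, -12953088, -1161216, -27648:]"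
  unfolding inv_defs coeff_F_form cov_F_form by (simp_all add: power2_eq_square power3_eq_cube numeral_poly)


text \<open>The powers of \<open>v\<close> and \<open>v + 8\<close> are nonzero on the family and
  later cancel up to small leftovers, which isolates the factors to be reduced modulo 11.\<close>

lemma absolute_H_form:
  "inv2 H_form = smult 64 ([:0, 1:] * [:8, 1:] * a8)"
  "sub4 H_form = smult 15728640 ([:0, 1:] ^ 3 * [:8, 1:] ^ 5 * x11)"
  "sub8 H_form = smult 47498902319923200 ([:0, 1:] ^ 7 * [:8, 1:] ^ 9 * y21)"
  unfolding sub4_def sub8_def inv_H_form a8_def x11_def y21_def
  by (simp_all add: eval_nat_numeral numeral_poly)

lemma absolute_F_form:
  "inv2 F_form = smult 4 a3"
  "sub4 F_form = smult 1920 ([:0, 1:] * q3)"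
  "sub8 F_form = smult 44236800 ([:0, 1:] ^ 2 * q7)"
  unfolding sub4_def sub8_def inv_F_form a3_def q3_def q7_def
  by (simp_all add: eval_nat_numeral numeral_poly)

text \<open>An elimination certificate: a common zero of \<open>H_form\<close> and its derivative
  after specialisation forces the right-hand side to vanish. Its cofactors have integral
  coefficients, so it specialises to every \<open>v\<close>.\<close>

lemma H_form_bezout: "\<exists>U V. U * H_form + V * pderiv H_form = [:[:0, 0, 16777216:] * [:8, 1:] ^ 6 * d7:]"
proof -
  have "
    [:[:35184372088832, 18691697672192, -34772055228416, -40029095198720, -14759655112704, -1961189441536,
      128362479616, 72100085760, 8666480640, 363495424, -9089024, -1227264, -25472, 288, 8:],
    [:-8796093022208, -5222680231936, 8469675507712, 11085310590976, 4696815173632, 680987197440,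
      -46934261760, -27378319360, -3318022144, -130793472, 4387840, 465024, 7264, -136, -2:],
    [:0, -1511828488192, 468151435264, 1226750033920, 370239602688, 36356227072, -2216689664, -350486528,
      40943616, 5052416, -50432, -12224, -48, 4:],
    [:0, 206158430208, 19327352832, -266153754624, -115326582784, -13040091136, 1752170496, 455606272,
      22790144, -774656, -68480, -224, 24:],
    [:0, 0, -9663676416, 9361686528, 5372903424, 569376768, -113246208, -22831104, -660480, 63744, 2112,
      -48:]:] * H_form +
    [:[:-211106232532992, -59373627899904, 200385994162176, 183309204193280, 69071664054272,
      12242267406336, 336248963072, -290170339328, -61055959040, -5627248640, -207765504, 5407744, 763136,
      20800, -80, -8:],
    [:-35184372088832, -2199023255552, 30477087932416, 22376779612160, 6628208279552, 793293881344,
      -21684551680, -14615052288, -920780800, 61751296, 7854080, 35840, -16384, -256, 8:],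
    [:4398046511104, 2336462209024, -4655744548864, -5245228810240, -2074334986240, -311452237824,
      11333009408, 10008395776, 1270841344, 53039104, -1477632, -177600, -3216, 44, 1:],
    [:0, 206158430208, -27917287424, -168309030912, -43788533760, -1837105152, 531628032, -74973184,
      -30564352, -1920000, 49792, 5600, 24, -2:],
    [:0, -34359738368, -7516192768, 48519708672, 21609054208, 2426404864, -342360064, -86081536,
      -4091904, 157440, 12352, 16, -4:],
    [:0, 0, 1610612736, -1560281088, -895483904, -94896128, 18874368, 3805184, 110080, -10624, -352, 8:]:] * pderiv H_form =
    [:[:0, 0, 16777216:] * [:8, 1:] ^ 6 * d7:]"
    unfolding H_form_def d7_def by (simp add: pderiv_pCons eval_nat_numeral)
  then show ?thesis by blast
qed

section \<open>Evaluation and specialisation of integral forms\<close>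

lemma hom_sum_coeff:
  fixes \<phi> :: "'a::comm_ring_1 \<Rightarrow> 'b::comm_ring_1"
  assumes "\<phi> 0 = 0" "\<And>a b. \<phi> (a + b) = \<phi> a + \<phi> b"
  shows "\<phi> (sum f S) = (\<Sum>i\<in>S. \<phi> (f i))"
  by (induction S rule: infinite_finite_induct) (simp_all add: assms)

lemma map_poly_hom_mult:
  fixes \<phi> :: "'a::comm_ring_1 \<Rightarrow> 'b::comm_ring_1"
  assumes "\<phi> 0 = 0" "\<And>a b. \<phi> (a + b) = \<phi> a + \<phi> b" "\<And>a b. \<phi> (a * b) = \<phi> a * \<phi> b"
  shows "map_poly \<phi> (p * q) = map_poly \<phi> p * map_poly \<phi> q"
  by (rule poly_eqI) (simp add: coeff_map_poly coeff_mult assms hom_sum_coeff)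

lemma map_poly_hom_add:
  fixes \<phi> :: "'a::comm_ring_1 \<Rightarrow> 'b::comm_ring_1"
  assumes "\<phi> 0 = 0" "\<And>a b. \<phi> (a + b) = \<phi> a + \<phi> b"
  shows "map_poly \<phi> (p + q) = map_poly \<phi> p + map_poly \<phi> q"
  by (rule poly_eqI) (simp add: coeff_map_poly assms)

text \<open>Values may lie in any commutative ring, so that one identity over the integers serves
  the integers, the rationals and their algebraic closure.\<close>

definition ipoly :: "int poly \<Rightarrow> 'a::comm_ring_1 \<Rightarrow> 'a" where
  "ipoly p x = poly (map_poly of_int p) x"

lemma ipoly_simps [simp]:
  "ipoly (p + q) x = ipoly p x + ipoly q x" "ipoly (p * q) x = ipoly p x * ipoly q x"
  "ipoly 0 x = 0" "ipoly (pCons a p) x = of_int a + x * ipoly p x"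
  by (simp_all add: ipoly_def map_poly_hom_add map_poly_hom_mult map_poly_pCons)

lemma ipoly_1 [simp]: "ipoly 1 x = 1"
  by (simp add: one_pCons)

lemma ipoly_smult [simp]: "ipoly (smult c p) x = of_int c * ipoly p x"
  using ipoly_simps(2)[of "[:c:]" p x] by simp

lemma ipoly_minus [simp]: "ipoly (- p) x = - ipoly p x" "ipoly (p - q) x = ipoly p x - ipoly q x"
proof -
  show "ipoly (- p) x = - ipoly p x" for p using ipoly_smult[of "-1" p x] by simp
  then show "ipoly (p - q) x = ipoly p x - ipoly q x" using ipoly_simps(1)[of p "- q" x] by simp
qed

lemma ipoly_power [simp]: "ipoly (p ^ n) x = ipoly p x ^ n"
  by (induction n) simp_all

lemma ipoly_numeral [simp]: "ipoly (numeral n) x = numeral n"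
  by (simp add: numeral_poly)

lemma ipoly_of_nat [simp]: "ipoly (of_nat n) x = of_nat n"
  by (induction n) simp_all

lemma ipoly_of_int: "ipoly p (of_int n) = of_int (poly p n)"
  by (induction p) simp_all

lemma ipoly_to_ac: "ipoly p (to_ac x) = to_ac (ipoly p x)"
  by (induction p) simp_all

definition specialize :: "int poly poly \<Rightarrow> 'a::comm_ring_1 \<Rightarrow> 'a poly" where
  "specialize P v = map_poly (\<lambda>c. ipoly c v) P"

lemma coeff_specialize: "coeff (specialize P v) k = ipoly (coeff P k) v"
  by (simp add: specialize_def coeff_map_poly)

lemma specialize_simps:
  "specialize (P + Q) v = specialize P v + specialize Q v"
  "specialize (P * Q) v = specialize P v * specialize Q v"
  "specialize [:c:] v = [:ipoly c v:]"
  by (simp_all add: specialize_def map_poly_hom_add map_poly_hom_mult map_poly_pCons)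

lemma specialize_pderiv: "specialize (pderiv P) v = pderiv (specialize P v)"
  by (rule poly_eqI) (simp add: coeff_specialize coeff_pderiv del: of_nat_Suc)

lemma invariants_specialize:
  "inv2 (specialize P v) = ipoly (inv2 P) v" "inv4 (specialize P v) = ipoly (inv4 P) v"
  "inv6 (specialize P v) = ipoly (inv6 P) v" "sub4 (specialize P v) = ipoly (sub4 P) v"
  "sub8 (specialize P v) = ipoly (sub8 P) v"
  by (simp_all add: inv_defs cov_defs sub4_def sub8_def coeff_specialize)

lemma same_invariants_sym: "same_invariants p q \<Longrightarrow> same_invariants q p"
  unfolding same_invariants_def by (elim exE conjE, rule_tac x = "inverse k" in exI) (simp add: field_simps)

text \<open>\<open>sub4\<close> and \<open>sub8\<close> have weights 2 and 4, so
  \<open>inv2^2 / sub4\<close> and \<open>sub8 / sub4^2\<close> are absolute invariants.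
  Cross-multiplication covers vanishing denominators as well.\<close>

lemma same_invariants_absolute:
  assumes "same_invariants p q"
  shows "inv2 p ^ 2 * sub4 q = inv2 q ^ 2 * sub4 p" "sub8 p * sub4 q ^ 2 = sub8 q * sub4 p ^ 2"
proof -
  obtain k where k: "inv2 q = k * inv2 p" "inv4 q = k ^ 2 * inv4 p" "inv6 q = k ^ 3 * inv6 p"
    using assms unfolding same_invariants_def by blast
  have "sub4 q = k ^ 2 * sub4 p" "sub8 q = k ^ 4 * sub8 p"
    unfolding sub4_def sub8_def k by (simp_all add: algebra_simps eval_nat_numeral)
  then show "inv2 p ^ 2 * sub4 q = inv2 q ^ 2 * sub4 p" "sub8 p * sub4 q ^ 2 = sub8 q * sub4 p ^ 2"
    unfolding k by (simp_all add: algebra_simps eval_nat_numeral)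
qed

section \<open>The invariants modulo 11\<close>

text \<open>The homogenisation of \<open>p\<close> in degree \<open>n\<close>, which may exceed the
  degree of \<open>p\<close>. It lets a rational argument \<open>a / b\<close> be reduced modulo 11
  even if 11 divides \<open>b\<close>.\<close>

definition hform :: "int poly \<Rightarrow> nat \<Rightarrow> int \<Rightarrow> int \<Rightarrow> int" where
  "hform p n a b = (\<Sum>i\<le>n. coeff p i * a ^ i * b ^ (n - i))"

lemma ipoly_altdef:
  assumes "degree p \<le> n"
  shows "ipoly p (x::'a::comm_ring_1) = (\<Sum>i\<le>n. of_int (coeff p i) * x ^ i)"
proof -
  have "degree (map_poly of_int p :: 'a poly) \<le> n" using assms
    by (intro degree_le) (auto simp: coeff_map_poly coeff_eq_0)
  then have "ipoly p x = (\<Sum>i\<le>n. coeff (map_poly of_int p) i * x ^ i)"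
    unfolding ipoly_def poly_altdef by (intro sum.mono_neutral_left) (auto simp: coeff_eq_0)
  then show ?thesis by (simp add: coeff_map_poly)
qed

lemma ipoly_fraction:
  assumes "degree p \<le> n" "b \<noteq> 0"
  shows "ipoly p (of_int a / of_int b :: 'a::field_char_0) = of_int (hform p n a b) / of_int b ^ n"
proof -
  have "of_int (coeff p i) * (of_int a / of_int b) ^ i =
      of_int (coeff p i * a ^ i * b ^ (n - i)) / (of_int b ^ n :: 'a)" if "i \<le> n" for i
  proof -
    have "of_int b ^ n = of_int b ^ i * (of_int b ^ (n - i) :: 'a)" using that by (simp flip: power_add)
    then show ?thesis using assms(2) by (simp add: power_divide)
  qed
  then show ?thesis unfolding ipoly_altdef[OF assms(1)] hform_def of_int_sum sum_divide_distrib
    by (intro sum.cong) simp_all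
qed

text \<open>By homogeneity a common factor \<open>s\<close> comes out; when \<open>s\<close> is
  prime to 11, divisibility by 11 depends only on the projective point
  \<open>(i : j)\<close>.\<close>

lemma hform_cong:
  assumes "[a = s * i] (mod k)" "[b = s * j] (mod k)"
  shows "[hform p n a b = s ^ n * hform p n i j] (mod k)"
proof -
  have "hform p n (s * i) (s * j) = s ^ n * hform p n i j"
    unfolding hform_def sum_distrib_left
  proof (rule sum.cong)
    fix t assume "t \<in> {..n}"
    then have "s ^ n = s ^ t * s ^ (n - t)" by (simp flip: power_add)
    then show "coeff p t * (s * i) ^ t * (s * j) ^ (n - t) = s ^ n * (coeff p t * i ^ t * j ^ (n - t))"
      by (simp add: power_mult_distrib)
  qed simp
  moreover have "[hform p n a b = hform p n (s * i) (s * j)] (mod k)"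
    unfolding hform_def by (intro cong_sum cong_mult cong_pow cong_refl assms)
  ultimately show ?thesis by simp
qed

text \<open>The units modulo 11 form a cyclic group of order 10, so their fifth powers form the
  subgroup of order 2.\<close>

lemma fifth_power_mod_11: "[a ^ 5 = 0] (mod 11) \<or> [a ^ 5 = 1] (mod 11) \<or> [a ^ 5 = -1] (mod (11::int))"
proof -
  have "a mod 11 \<in> {0..10}" by simp
  then have "a mod 11 \<in> {0,1,2,3,4,5,6,7,8,9,10}" by (simp add: atLeastAtMost_iff) presburger
  moreover have "[a ^ 5 = (a mod 11) ^ 5] (mod 11)" by (intro cong_pow) (simp add: cong_def)
  ultimately show ?thesis by (auto simp: cong_def)
qed

text \<open>Coprimality excludes a pair of zeros, and dividing by a common sign leaves four points
  of the projective line over the field with 11 elements.\<close>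

lemma projective_fifth_power_mod_11:
  assumes "coprime a (b::int)"
  obtains s i j where "\<not> 11 dvd s" "[a ^ 5 = s * i] (mod 11)" "[b ^ 5 = s * j] (mod 11)"
    "(i, j) \<in> {(0, 1), (1, 0), (1, 1), (-1, 1)}"
proof -
  have *: "11 dvd x" if "[x ^ 5 = 0] (mod 11)" for x :: int
    using that by (simp add: cong_0_iff prime_dvd_power_iff)
  have "\<not> ([a ^ 5 = 0] (mod 11) \<and> [b ^ 5 = 0] (mod 11))"
    using *[of a] *[of b] assms not_coprimeI[of 11 a b] by auto
  then consider "[a ^ 5 = 0] (mod 11)" "[b ^ 5 = 1] (mod 11)" | "[a ^ 5 = 0] (mod 11)" "[b ^ 5 = -1] (mod 11)"
    | "[a ^ 5 = 1] (mod 11)" "[b ^ 5 = 0] (mod 11)" | "[a ^ 5 = -1] (mod 11)" "[b ^ 5 = 0] (mod 11)"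
    | "[a ^ 5 = 1] (mod 11)" "[b ^ 5 = 1] (mod 11)" | "[a ^ 5 = -1] (mod 11)" "[b ^ 5 = 1] (mod 11)"
    | "[a ^ 5 = 1] (mod 11)" "[b ^ 5 = -1] (mod 11)" | "[a ^ 5 = -1] (mod 11)" "[b ^ 5 = -1] (mod 11)"
    using fifth_power_mod_11[of a] fifth_power_mod_11[of b] by blast
  then show ?thesis
  proof cases
    case 1 then show ?thesis by (intro that[of 1 0 1]) simp_all
  next
    case 2 then show ?thesis by (intro that[of "-1" 0 1]) simp_all
  next
    case 3 then show ?thesis by (intro that[of 1 1 0]) simp_all
  next
    case 4 then show ?thesis by (intro that[of "-1" 1 0]) simp_all
  next
    case 5 then show ?thesis by (intro that[of 1 1 1]) simp_all
  next
    case 6 then show ?thesis by (intro that[of 1 "-1" 1]) simp_all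
  next
    case 7 then show ?thesis by (intro that[of "-1" "-1" 1]) simp_all
  next
    case 8 then show ?thesis by (intro that[of "-1" 1 1]) simp_all
  qed
qed

text \<open>The parameter \<open>t\<close> is an arbitrary rational, so all twelve points of the
  projective line are listed; dividing by a unit \<open>d\<close> normalises the second
  coordinate.\<close>

lemma projective_mod_11:
  assumes "coprime c (d::int)"
  obtains s k l where "\<not> 11 dvd s" "[c = s * k] (mod 11)" "[d = s * l] (mod 11)"
    "(k, l) \<in> insert (1, 0) ((\<lambda>k. (k, 1)) ` {0..10})"
proof (cases "11 dvd d")
  case True
  then have "\<not> 11 dvd c" using assms not_coprimeI[of 11 c d] by auto
  then show ?thesis using True by (intro that[of c 1 0]) (simp_all add: cong_0_iff)
next
  case False
  moreover have "prime (11::int)" by simp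
  ultimately have "coprime d 11" using prime_imp_coprime coprime_commute by blast
  then obtain e where e: "[d * e = 1] (mod 11)" using cong_solve_coprime_int by blast
  have "[d * ((c * e) mod 11) = d * (c * e)] (mod 11)" by (intro cong_mult) (simp_all add: cong_def)
  also have "d * (c * e) = c * (d * e)" by simp
  also have "[c * (d * e) = c * 1] (mod 11)" by (intro cong_mult e) simp
  finally have "[c = d * ((c * e) mod 11)] (mod 11)" by (simp add: cong_sym)
  then show ?thesis using False by (intro that[of d "(c * e) mod 11" 1]) simp_all
qed

lemma degrees: "degree a8 \<le> 8" "degree x11 \<le> 11" "degree y21 \<le> 21" "degree a3 \<le> 3" "degree q3 \<le> 3"
  "degree q7 \<le> 7" "degree d7 \<le> 7"
  unfolding a8_def x11_def y21_def a3_def q3_def q7_def d7_def by (simp_all add: degree_pCons_eq_if)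


lemma hform_affine: "degree p \<le> n \<Longrightarrow> hform p n k 1 = poly p k"
  using ipoly_altdef[of p n k] ipoly_of_int[of p k, where 'a = int] by (simp add: hform_def)

lemma hform_infinity: "hform p n 1 0 = coeff p n"
proof -
  have "hform p n 1 0 = (\<Sum>i\<in>{n}. coeff p i * 1 ^ i * 0 ^ (n - i))"
    unfolding hform_def by (intro sum.mono_neutral_right) auto
  then show ?thesis by simp
qed

lemma hform_infinity_values:
  "hform a8 8 1 0 = -1" "hform x11 11 1 0 = -1" "hform y21 21 1 0 = 2"
  "hform a3 3 1 0 = 4" "hform q3 3 1 0 = -86" "hform q7 7 1 0 = -1" "hform d7 7 1 0 = 1"
  unfolding hform_infinity a8_def x11_def y21_def a3_def q3_def q7_def d7_def
  by (simp_all add: numeral_eq_Suc)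

lemmas hform_affine_values = degrees[THEN hform_affine]

text \<open>The congruences are homogeneous of degrees 16 and 23 in \<open>(i, j)\<close> and of
  degrees 6 and 7 in \<open>(k, l)\<close>, so representatives suffice: four points for
  \<open>v\<close> times twelve for \<open>t\<close>.\<close>

lemma no_solution_mod_11:
  assumes ij: "(i, j) \<in> {(0, 1), (1, 0), (1, 1), (-1, 1)}"
    and kl: "k \<in> {0,1,2,3,4,5,6,7,8,9,10} \<and> l = 1 \<or> k = 1 \<and> l = 0"
    and 1: "11 dvd 32 * i * j * (i + 8 * j) ^ 3 * hform a3 3 k l ^ 2 * hform x11 11 i j
      - hform a8 8 i j ^ 2 * k * l ^ 2 * hform q3 3 k l"
    and 2: "11 dvd 16 * i * j * hform y21 21 i j * l * hform q3 3 k l ^ 2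
      - (i + 8 * j) * hform q7 7 k l * hform x11 11 i j ^ 2"
  shows False
proof -
  have h: "poly a8 0 = -16777216" "poly x11 0 = -8589934592" "poly y21 0 = 18446744073709551616"
    "poly a8 1 = -240571025" "poly x11 1 = -103696951777" "poly y21 1 = 509320329353977337501"
    "poly a8 (-1) = 22424431" "poly x11 (-1) = 1351185153" "poly y21 (-1) = 306470788475770299"
    by (simp_all add: a8_def x11_def y21_def)
  show False using ij
  proof (elim insertE emptyE Pair_inject)
    assume "i = 0" "j = 1"
    then show False using kl 1 2
      by (elim disjE conjE insertE emptyE)
        (simp_all add: hform_affine_values hform_infinity_values h, simp_all add: a3_def q3_def q7_def)
  next
    assume "i = 1" "j = 0"
    then show False using kl 1 2
      by (elim disjE conjE insertE emptyE)
        (simp_all add: hform_affine_values hform_infinity_values h, simp_all add: a3_def q3_def q7_def)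
  next
    assume "i = 1" "j = 1"
    then show False using kl 1 2
      by (elim disjE conjE insertE emptyE)
        (simp_all add: hform_affine_values hform_infinity_values h, simp_all add: a3_def q3_def q7_def)
  next
    assume "i = -1" "j = 1"
    then show False using kl 1 2
      by (elim disjE conjE insertE emptyE)
        (simp_all add: hform_affine_values hform_infinity_values h, simp_all add: a3_def q3_def q7_def)
  qed
qed

lemma no_rational_solution:
  fixes u t :: rat
  assumes 1: "32 * u ^ 5 * (u ^ 5 + 8) ^ 3 * ipoly a3 t ^ 2 * ipoly x11 (u ^ 5) = ipoly a8 (u ^ 5) ^ 2 * t * ipoly q3 t"
    and 2: "16 * u ^ 5 * ipoly y21 (u ^ 5) * ipoly q3 t ^ 2 = (u ^ 5 + 8) * ipoly q7 t * ipoly x11 (u ^ 5) ^ 2"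
  shows False
proof -
  obtain a b where ab: "u = of_int a / of_int b" "b > 0" "coprime a b"
    by (metis quotient_of_coprime quotient_of_denom_pos quotient_of_div surj_pair)
  obtain c d where cd: "t = of_int c / of_int d" "d > 0" "coprime c d"
    by (metis quotient_of_coprime quotient_of_denom_pos quotient_of_div surj_pair)
  define V B where VB: "V = a ^ 5" "B = b ^ 5"
  define v where "v = u ^ 5"
  note 1 = 1[folded v_def] and 2 = 2[folded v_def]
  have v: "v = of_int V / of_int B" and B: "B \<noteq> 0" and d: "d \<noteq> 0"
    using ab cd by (simp_all add: v_def VB power_divide)
  define A8 X11 Y21 A3 Q3 Q7 where h: "A8 = hform a8 8 V B" "X11 = hform x11 11 V B" "Y21 = hform y21 21 V B"
    "A3 = hform a3 3 c d" "Q3 = hform q3 3 c d" "Q7 = hform q7 7 c d"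
  have Bd: "rat_of_int B \<noteq> 0" "rat_of_int d \<noteq> 0" using B d by simp_all
  have e: "of_int V = v * of_int B" "of_int (V + 8 * B) = (v + 8) * of_int B" "of_int c = t * of_int d"
    "of_int A8 = ipoly a8 (v) * of_int B ^ 8" "of_int X11 = ipoly x11 (v) * of_int B ^ 11"
    "of_int Y21 = ipoly y21 (v) * of_int B ^ 21" "of_int A3 = ipoly a3 t * of_int d ^ 3"
    "of_int Q3 = ipoly q3 t * of_int d ^ 3" "of_int Q7 = ipoly q7 t * of_int d ^ 7"
    using Bd by (simp_all add: h v cd(1) ipoly_fraction[OF degrees(1) B] ipoly_fraction[OF degrees(2) B]
        ipoly_fraction[OF degrees(3) B] ipoly_fraction[OF degrees(4) d] ipoly_fraction[OF degrees(5) d]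
        ipoly_fraction[OF degrees(6) d] algebra_simps)
  \<comment> \<open>The larger of the two sides has degree 16 in \<open>v\<close> and 6 in
    \<open>t\<close>, which gives the powers of \<open>B\<close> and \<open>d\<close> that clear
    denominators; for the second equation they are 23 and 7.\<close>
  have "rat_of_int (32 * V * B * (V + 8 * B) ^ 3 * A3 ^ 2 * X11) =
      (32 * v * (v + 8) ^ 3 * ipoly a3 t ^ 2 * ipoly x11 (v)) * (of_int B ^ 16 * of_int d ^ 6)"
    unfolding of_int_mult of_int_power of_int_numeral e
    by (simp add: power_mult_distrib eval_nat_numeral mult_ac)
  also have "\<dots> = (ipoly a8 (v) ^ 2 * t * ipoly q3 t) * (of_int B ^ 16 * of_int d ^ 6)" unfolding 1 ..
  also have "\<dots> = rat_of_int (A8 ^ 2 * c * d ^ 2 * Q3)"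
    unfolding of_int_mult of_int_power of_int_numeral e
    by (simp add: power_mult_distrib eval_nat_numeral mult_ac)
  finally have I1: "32 * V * B * (V + 8 * B) ^ 3 * A3 ^ 2 * X11 = A8 ^ 2 * c * d ^ 2 * Q3"
    by (simp only: of_int_eq_iff)
  have "rat_of_int (16 * V * B * Y21 * d * Q3 ^ 2) =
      (16 * v * ipoly y21 (v) * ipoly q3 t ^ 2) * (of_int B ^ 23 * of_int d ^ 7)"
    unfolding of_int_mult of_int_power of_int_numeral e
    by (simp add: power_mult_distrib eval_nat_numeral mult_ac)
  also have "\<dots> = ((v + 8) * ipoly q7 t * ipoly x11 (v) ^ 2) * (of_int B ^ 23 * of_int d ^ 7)" unfolding 2 ..
  also have "\<dots> = rat_of_int ((V + 8 * B) * Q7 * X11 ^ 2)"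
    unfolding of_int_mult of_int_power of_int_numeral e
    by (simp add: power_mult_distrib eval_nat_numeral mult_ac)
  finally have I2: "16 * V * B * Y21 * d * Q3 ^ 2 = (V + 8 * B) * Q7 * X11 ^ 2"
    by (simp only: of_int_eq_iff)
  obtain s i j where s: "\<not> 11 dvd s" "[V = s * i] (mod 11)" "[B = s * j] (mod 11)"
    "(i, j) \<in> {(0, 1), (1, 0), (1, 1), (-1, 1)}"
    using projective_fifth_power_mod_11[OF ab(3)] unfolding VB .
  obtain r k l where r: "\<not> 11 dvd r" "[c = r * k] (mod 11)" "[d = r * l] (mod 11)"
    "(k, l) \<in> insert (1, 0) ((\<lambda>k. (k, 1)) ` {0..10})"
    using projective_mod_11[OF cd(3)] .
  have w': "[V + 8 * B = s * (i + 8 * j)] (mod 11)"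
    using cong_add[OF s(2) cong_mult[OF cong_refl s(3), of 8]] by (simp add: algebra_simps)
  note H = hform_cong[OF s(2,3)] and K = hform_cong[OF r(2,3)]
  let ?L1 = "32 * i * j * (i + 8 * j) ^ 3 * hform a3 3 k l ^ 2 * hform x11 11 i j
    - hform a8 8 i j ^ 2 * k * l ^ 2 * hform q3 3 k l"
  let ?L2 = "16 * i * j * hform y21 21 i j * l * hform q3 3 k l ^ 2
    - (i + 8 * j) * hform q7 7 k l * hform x11 11 i j ^ 2"
  have "[32 * V * B * (V + 8 * B) ^ 3 * A3 ^ 2 * X11 - A8 ^ 2 * c * d ^ 2 * Q3 =
      32 * (s * i) * (s * j) * (s * (i + 8 * j)) ^ 3 * (r ^ 3 * hform a3 3 k l) ^ 2 * (s ^ 11 * hform x11 11 i j)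
      - (s ^ 8 * hform a8 8 i j) ^ 2 * (r * k) * (r * l) ^ 2 * (r ^ 3 * hform q3 3 k l)] (mod 11)"
    unfolding h by (intro cong_diff cong_mult cong_pow cong_refl s r w' H K)
  also have "32 * (s * i) * (s * j) * (s * (i + 8 * j)) ^ 3 * (r ^ 3 * hform a3 3 k l) ^ 2 * (s ^ 11 * hform x11 11 i j)
      - (s ^ 8 * hform a8 8 i j) ^ 2 * (r * k) * (r * l) ^ 2 * (r ^ 3 * hform q3 3 k l) = s ^ 16 * r ^ 6 * ?L1"
    by (simp add: right_diff_distrib power_mult_distrib eval_nat_numeral mult_ac)
  finally have "11 dvd s ^ 16 * r ^ 6 * ?L1" using I1 by (simp add: cong_0_iff cong_sym_eq[of 0])
  then have L1: "11 dvd ?L1" using s(1) r(1) by (simp add: prime_dvd_mult_iff prime_dvd_power_iff)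
  have "[16 * V * B * Y21 * d * Q3 ^ 2 - (V + 8 * B) * Q7 * X11 ^ 2 =
      16 * (s * i) * (s * j) * (s ^ 21 * hform y21 21 i j) * (r * l) * (r ^ 3 * hform q3 3 k l) ^ 2
      - (s * (i + 8 * j)) * (r ^ 7 * hform q7 7 k l) * (s ^ 11 * hform x11 11 i j) ^ 2] (mod 11)"
    unfolding h by (intro cong_diff cong_mult cong_pow cong_refl s r w' H K)
  also have "16 * (s * i) * (s * j) * (s ^ 21 * hform y21 21 i j) * (r * l) * (r ^ 3 * hform q3 3 k l) ^ 2
      - (s * (i + 8 * j)) * (r ^ 7 * hform q7 7 k l) * (s ^ 11 * hform x11 11 i j) ^ 2 = s ^ 23 * r ^ 7 * ?L2"
    by (simp add: right_diff_distrib power_mult_distrib eval_nat_numeral mult_ac)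
  finally have "11 dvd s ^ 23 * r ^ 7 * ?L2" using I2 by (simp add: cong_0_iff cong_sym_eq[of 0])
  then have L2: "11 dvd ?L2" using s(1) r(1) by (simp add: prime_dvd_mult_iff prime_dvd_power_iff)
  have "0 \<le> k \<and> k \<le> 10 \<and> l = 1 \<or> k = 1 \<and> l = 0" using r(4) by auto
  then have "k \<in> {0,1,2,3,4,5,6,7,8,9,10} \<and> l = 1 \<or> k = 1 \<and> l = 0"
    by (simp only: insert_iff empty_iff) presburger
  with s(4) show False using L1 L2 by (rule no_solution_mod_11)
qed


text \<open>A fifth power reduces to one of four projective points, so nonvanishing there modulo 11
  excludes zeros of the form \<open>u^5\<close>; the point at infinity contributes the coefficient
  at \<open>n\<close>.\<close>

lemma hform_nonzero_mod_11:
  assumes "degree p \<le> n" "\<not> 11 dvd poly p 0" "\<not> 11 dvd poly p 1" "\<not> 11 dvd poly p (-1)" "\<not> 11 dvd coeff p n"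
  shows "ipoly p ((u::rat) ^ 5) \<noteq> 0"
proof
  assume 0: "ipoly p (u ^ 5) = 0"
  obtain a b where ab: "u = of_int a / of_int b" "b > 0" "coprime a b"
    by (metis quotient_of_coprime quotient_of_denom_pos quotient_of_div surj_pair)
  have v: "u ^ 5 = of_int (a ^ 5) / of_int (b ^ 5)" and b: "b ^ 5 \<noteq> 0" using ab by (simp_all add: power_divide)
  have "hform p n (a ^ 5) (b ^ 5) = 0"
    using 0 b unfolding v ipoly_fraction[OF assms(1) b] by simp
  moreover obtain s i j where s: "\<not> 11 dvd s" "[a ^ 5 = s * i] (mod 11)" "[b ^ 5 = s * j] (mod 11)"
    "(i, j) \<in> {(0, 1), (1, 0), (1, 1), (-1, 1)}"
    using projective_fifth_power_mod_11[OF ab(3)] .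
  ultimately have "11 dvd s ^ n * hform p n i j"
    using hform_cong[OF s(2,3), of p n] by (simp add: cong_0_iff cong_sym_eq[of 0])
  moreover have prime: "prime (11::int)" by simp
  ultimately have "11 dvd hform p n i j"
    using s(1) prime_dvd_power[OF prime] prime_dvd_mult_iff[OF prime] by blast
  then show False using s(4) assms by (auto simp: hform_affine hform_infinity)
qed

lemma fifth_power_plus_8_nonzero: "(u::rat) ^ 5 + 8 \<noteq> 0"
  using hform_nonzero_mod_11[of "[:8, 1:]" 1 u] by (simp add: add.commute)

lemma d7_nonzero: "ipoly d7 ((u::rat) ^ 5) \<noteq> 0"
  by (rule hform_nonzero_mod_11[OF degrees(7)]) (simp_all add: d7_def numeral_eq_Suc)

text \<open>Both families are specialisations of integral forms up to an affine change of the variable,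
  with \<open>X = x/u\<close> and \<open>Y = (v + 8) X\<close> for \<open>v = u\<^sup>5\<close>.\<close>

lemma G_curve_h_poly:
  assumes "u \<noteq> 0"
  shows "G_curve u = smult (to_ac u ^ 6) (pcompose (h_poly (to_ac u ^ 5)) [:0, 1 / to_ac u:])"
proof -
  define U where "U = to_ac u"
  have eq: "U ^ 5 + 8 = to_ac (u ^ 5 + 8)" by (simp add: U_def)
  have nz: "U \<noteq> 0" "U ^ 5 + 8 \<noteq> 0"
    unfolding eq to_ac_eq_0_iff using assms fifth_power_plus_8_nonzero[of u] by (simp_all add: U_def)
  define w where "w = U ^ 5 + 8"
  have w: "w \<noteq> 0" using nz by (simp add: w_def)
  define N0 N1 N2 N3 N4 where N:
    "N0 = U^25 + 46 * U^20 + 736 * U^15 + 5248 * U^10 + 18432 * U^5 + 24576"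
    "N1 = U^25 + 80 * U^20 + 1664 * U^15 + 12288 * U^10 + 36864 * U^5 + 32768"
    "N2 = U^30 + 112 * U^25 + 2880 * U^20 + 25600 * U^15 + 106496 * U^10 + 262144 * U^5 + 262144"
    "N3 = 6 * U^15 + 224 * U^10 + 1536 * U^5 + 3072" "N4 = U^15 + 40 * U^10 + 128 * U^5 + 512"
  have G: "G_curve u = [: - (N0 / (2 * U^4 * w^4)), - (N1 / (2 * U^5 * w^4)), N2 / (16 * U^6 * w^4),
      N3 / (U^2 * w^3), - (N4 / (2 * U^3 * w^2)), - (16 * U / w), 1:]"
    by (simp add: G_curve_def g_poly_def map_poly_pCons N w_def U_def)
  have p: "(U ^ 5) ^ 2 = U ^ 10" "(U ^ 5) ^ 3 = U ^ 15" "(U ^ 5) ^ 4 = U ^ 20" "(U ^ 5) ^ 5 = U ^ 25"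
    "(U ^ 5) ^ 6 = U ^ 30" by (simp_all flip: power_mult)
  have h: "h_poly (U ^ 5) = [: - (N0 / (2 * U^10 * w^4)), - (N1 / (2 * U^10 * w^4)), N2 / (16 * U^10 * w^4),
      N3 / (U^5 * w^3), - (N4 / (2 * U^5 * w^2)), - (16 / w), 1:]"
    unfolding h_poly_def p N w_def ..
  have scaled: "smult k (pcompose [:c0, c1, c2, c3, c4, c5, c6:] [:0, s:]) =
      [:k * c0, k * s * c1, k * s^2 * c2, k * s^3 * c3, k * s^4 * c4, k * s^5 * c5, k * s^6 * c6:]"
    for k s c0 c1 c2 c3 c4 c5 c6 :: "rat alg_closure"
    by (simp add: pcompose_pCons eval_nat_numeral mult_ac)
  show ?thesis unfolding U_def[symmetric] G h scaled
    using nz(1) w by (simp add: divide_simps) (simp add: eval_nat_numeral mult_ac)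
qed

lemma h_poly_H_form:
  fixes v :: "'a::field_char_0"
  assumes "v \<noteq> 0" "v + 8 \<noteq> 0"
  shows "h_poly v = smult (1 / (16 * v ^ 2 * (v + 8) ^ 6)) (pcompose (specialize H_form v) [:0, v + 8:])"
proof (rule poly_eqI)
  fix n :: nat
  define w where "w = v + 8"
  have w: "w \<noteq> 0" and vw: "v = w - 8" using assms by (simp_all add: w_def)
  have c: "coeff (smult (1 / (16 * v ^ 2 * w ^ 6)) (pcompose (specialize H_form v) [:0, w:])) n =
      ipoly (coeff H_form n) v * w ^ n / (16 * v ^ 2 * w ^ 6)"
    by (simp add: coeff_pcompose_linear coeff_specialize)
  consider "n = 0" | "n = 1" | "n = 2" | "n = 3" | "n = 4" | "n = 5" | "n = 6" | "n > 6" by linarith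
  then have "coeff (h_poly v) n = ipoly (coeff H_form n) v * w ^ n / (16 * v ^ 2 * w ^ 6)"
  proof cases
    case 8
    moreover obtain k where "n = Suc (Suc (Suc (Suc (Suc (Suc (Suc k))))))"
      using le_Suc_ex[of 7 n] 8 by (auto simp: numeral_eq_Suc)
    ultimately show ?thesis by (simp add: h_poly_def H_form_def)
  qed (use assms(1) w in \<open>simp_all add: coeff_H_form coeff_H_form(2)[unfolded One_nat_def] h_poly_def w_def[symmetric]\<close>,
      simp_all add: numeral_eq_Suc(1) divide_simps, simp_all add: vw algebra_simps eval_nat_numeral)
  then show "coeff (h_poly v) n =
      coeff (smult (1 / (16 * v ^ 2 * (v + 8) ^ 6)) (pcompose (specialize H_form v) [:0, v + 8:])) n"
    unfolding c[unfolded w_def] by (simp add: w_def)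
qed

section \<open>The curves\<close>

lemma scaled_root_iff:
  fixes p :: "'a::field poly"
  assumes "k \<noteq> 0" "s \<noteq> 0"
  shows "poly (smult k (pcompose p [:0, s:])) r = 0 \<longleftrightarrow> poly p (s * r) = 0"
    and "poly (pderiv (smult k (pcompose p [:0, s:]))) r = 0 \<longleftrightarrow> poly (pderiv p) (s * r) = 0"
  using assms by (simp_all add: poly_pcompose pderiv_smult pderiv_pcompose pderiv_pCons mult.commute)

lemma ipoly_linear: "ipoly [:0, 1:] x = x" "ipoly [:8, 1:] x = x + 8"
  by simp_all

lemma same_invariants_scaled:
  fixes p :: "'a::field poly"
  assumes "k \<noteq> 0" "s \<noteq> 0"
  shows "same_invariants p (smult k (pcompose p [:0, s:]))"
  by (rule same_invariants_trans[OF same_invariants_scale same_invariants_smult]) (use assms in simp_all)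

lemma map_poly_monic_sextic:
  "degree (map_poly to_ac [:a, b, c, d, e, g, 1:]) = 6" "coeff (map_poly to_ac [:a, b, c, d, e, g, 1:]) 6 = 1"
  by (simp_all add: map_poly_pCons numeral_eq_Suc)

lemma H_form_simple_roots:
  fixes v :: "'a::field_char_0"
  assumes v: "v \<noteq> 0" "v + 8 \<noteq> 0" "ipoly d7 v \<noteq> 0" and r: "poly (specialize H_form v) y = 0"
  shows "poly (pderiv (specialize H_form v)) y \<noteq> 0"
proof
  assume r': "poly (pderiv (specialize H_form v)) y = 0"
  obtain U V where "U * H_form + V * pderiv H_form = [:[:0, 0, 16777216:] * [:8, 1:] ^ 6 * d7:]"
    using H_form_bezout by blast
  then have "specialize (U * H_form + V * pderiv H_form) v =
      specialize [:[:0, 0, 16777216:] * [:8, 1:] ^ 6 * d7:] v" by simp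
  then have "specialize U v * specialize H_form v + specialize V v * pderiv (specialize H_form v) =
      [:ipoly ([:0, 0, 16777216:] * [:8, 1:] ^ 6 * d7) v:]"
    by (simp only: specialize_simps specialize_pderiv)
  then have "poly (specialize U v * specialize H_form v + specialize V v * pderiv (specialize H_form v)) y =
      ipoly ([:0, 0, 16777216:] * [:8, 1:] ^ 6 * d7) v" by simp
  then have "ipoly ([:0, 0, 16777216:] * [:8, 1:] ^ 6 * d7) v = 0" using r r' by simp
  then show False using v by (simp add: add.commute)
qed

context
  fixes u :: rat and U V :: "rat alg_closure"
  assumes u: "u \<noteq> 0"
  defines "U \<equiv> to_ac u" and "V \<equiv> to_ac (u ^ 5)"
begin

lemma U_nonzero: "U \<noteq> 0" "V \<noteq> 0" "V + 8 \<noteq> 0" "ipoly d7 V \<noteq> 0"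
proof -
  show "U \<noteq> 0" "V \<noteq> 0" using u by (simp_all add: U_def V_def)
  have "V + 8 = to_ac (u ^ 5 + 8)" by (simp add: V_def)
  then show "V + 8 \<noteq> 0" using fifth_power_plus_8_nonzero[of u] by (simp only: to_ac_eq_0_iff not_False_eq_True)
  show "ipoly d7 V \<noteq> 0" unfolding V_def ipoly_to_ac using d7_nonzero[of u] by simp
qed

lemma G_curve_h: "G_curve u = smult (U ^ 6) (pcompose (h_poly V) [:0, 1 / U:])"
  using G_curve_h_poly[OF u] by (simp add: U_def V_def)

lemma h_factor: "U ^ 6 \<noteq> 0" "1 / U \<noteq> 0"
  using U_nonzero(1) by simp_all

lemma H_factor: "1 / (16 * V ^ 2 * (V + 8) ^ 6) \<noteq> 0" "V + 8 \<noteq> 0"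
  using U_nonzero(2,3) by simp_all

lemma G_curve_basic: "degree (G_curve u) = 6" "coeff (G_curve u) 6 = 1"
proof -
  have "\<exists>a b c d e g. G_curve u = map_poly to_ac [:a, b, c, d, e, g, 1:]"
    unfolding G_curve_def g_poly_def by blast
  then show "degree (G_curve u) = 6" "coeff (G_curve u) 6 = 1"
    using map_poly_monic_sextic by metis+
qed

lemma G_curve_smooth: "smooth_curve (G_curve u) 3"
proof
  fix r assume "poly (G_curve u) r = 0"
  then have "poly (h_poly V) (1 / U * r) = 0"
    unfolding G_curve_h scaled_root_iff(1)[OF h_factor] .
  then have "poly (specialize H_form V) ((V + 8) * (1 / U * r)) = 0"
    unfolding h_poly_H_form[OF U_nonzero(2,3)] scaled_root_iff(1)[OF H_factor] .
  then have "poly (pderiv (specialize H_form V)) ((V + 8) * (1 / U * r)) \<noteq> 0"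
    by (rule H_form_simple_roots[OF U_nonzero(2-4)])
  then have "poly (pderiv (h_poly V)) (1 / U * r) \<noteq> 0"
    unfolding h_poly_H_form[OF U_nonzero(2,3)] scaled_root_iff(2)[OF H_factor] .
  then show "poly (pderiv (G_curve u)) r \<noteq> 0"
    unfolding G_curve_h scaled_root_iff(2)[OF h_factor] .
qed (simp_all add: G_curve_basic)

lemma G_curve_invariants: "same_invariants (specialize H_form V) (G_curve u)"
proof -
  have "same_invariants (specialize H_form V) (h_poly V)"
    unfolding h_poly_H_form[OF U_nonzero(2,3)] by (rule same_invariants_scaled[OF H_factor])
  moreover have "same_invariants (h_poly V) (G_curve u)"
    unfolding G_curve_h by (rule same_invariants_scaled[OF h_factor])
  ultimately show ?thesis by (rule same_invariants_trans)
qed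

lemma G_curve_pell: "\<exists>A B c. A * A - B * B * G_curve u = [:c:] \<and> c \<noteq> 0 \<and> degree A = 11"
proof -
  obtain P Q where "pell_state (h_poly V) P Q 1 11" using h_poly_pell[OF U_nonzero(2,3)] by blast
  then obtain A B s where s: "s * s = 1" "A * A - B * B * h_poly V = - s" "degree A = 11"
    unfolding pell_state_def by auto
  have s0: "s \<noteq> 0" using s(1) by auto
  \<comment> \<open>So far \<open>s\<close> is only a polynomial with square 1; the Pell equation
    needs it as a constant.\<close>
  then have "degree s = 0" using s(1) degree_mult_eq[of s s] by simp
  then obtain c where c: "s = [:c:]" by (rule degree_eq_zeroE)
  \<comment> \<open>\<open>G_curve u\<close> is \<open>U^6\<close> times the sextic
    \<open>h_poly V\<close> at \<open>x / U\<close>; the factor \<open>1 / U^3\<close> in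
    \<open>?B\<close> compensates this.\<close>
  let ?A = "pcompose A [:0, 1 / U:]" and ?B = "smult (1 / U ^ 3) (pcompose B [:0, 1 / U:])"
  have "?A * ?A - ?B * ?B * G_curve u = pcompose (A * A - B * B * h_poly V) [:0, 1 / U:]"
    using U_nonzero(1) unfolding G_curve_h
    by (simp add: pcompose_mult pcompose_diff eval_nat_numeral field_simps)
  also have "\<dots> = [:- c:]" unfolding s c by (simp add: pcompose_pCons)
  finally have "?A * ?A - ?B * ?B * G_curve u = [:- c:]" .
  moreover have "degree ?A = 11" using s(3) U_nonzero(1) by (simp add: degree_pcompose)
  moreover have "- c \<noteq> 0" using s0 c by simp
  ultimately show ?thesis by blast
qed

lemma G_curve_order:
  "group.ord (jacobian (G_curve u)) (divisor_class (G_curve u) divisor_at_infinity) = 11"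
proof -
  interpret smooth_curve "G_curve u" 3 by (rule G_curve_smooth)
  obtain A B c where "A * A - B * B * G_curve u = [:c:]" "c \<noteq> 0" "degree A = 11"
    using G_curve_pell by blast
  then show ?thesis by (intro ord_infinity) simp_all
qed

end

section \<open>Non-isomorphism from absolute invariants\<close>

lemma to_ac_injD: "to_ac x = to_ac y \<Longrightarrow> x = y"
  by simp

text \<open>The relation expresses equality of \<open>inv2^2 / sub4\<close>. Injectivity of
  \<open>to_ac\<close> brings it down to the rationals, where common powers of the nonzero
  \<open>v\<close>, \<open>v + 8\<close> and their primed versions cancel.\<close>

lemma G_curves_isomorphic_imp:
  assumes "u \<noteq> 0" "u' \<noteq> 0" and iso: "isomorphic_curves (G_curve u) (G_curve u')"
  defines "v \<equiv> u ^ 5" and "v' \<equiv> u' ^ 5"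
  shows "ipoly a8 v ^ 2 * v' * (v' + 8) ^ 3 * ipoly x11 v' = ipoly a8 v' ^ 2 * v * (v + 8) ^ 3 * ipoly x11 v"
proof -
  interpret S: smooth_curve "G_curve u'" 3 by (rule G_curve_smooth) fact
  have "same_invariants (G_curve u) (G_curve u')"
    using isomorphic_curves_invariants[OF G_curve_smooth[OF assms(1)] S.even_curve_axioms iso] by blast
  then have "same_invariants (specialize H_form (to_ac v)) (specialize H_form (to_ac v'))"
    using same_invariants_trans[OF G_curve_invariants[OF assms(1)]] same_invariants_trans
      same_invariants_sym[OF G_curve_invariants[OF assms(2)]] unfolding v_def v'_def by blast
  from same_invariants_absolute(1)[OF this]
  have "ipoly (inv2 H_form) v ^ 2 * ipoly (sub4 H_form) v' = ipoly (inv2 H_form) v' ^ 2 * ipoly (sub4 H_form) v"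
    unfolding invariants_specialize ipoly_to_ac to_ac_power[symmetric] to_ac_mult[symmetric] by (rule to_ac_injD)
  then have eq: "(64 * (v * (v + 8) * ipoly a8 v)) ^ 2 * (15728640 * (v' ^ 3 * (v' + 8) ^ 5 * ipoly x11 v')) =
      (64 * (v' * (v' + 8) * ipoly a8 v')) ^ 2 * (15728640 * (v ^ 3 * (v + 8) ^ 5 * ipoly x11 v))"
    by (simp only: absolute_H_form ipoly_smult ipoly_simps(2) ipoly_power ipoly_linear of_int_numeral)
  define w w' where w: "w = v + 8" "w' = v' + 8"
  have nz: "v \<noteq> 0" "v' \<noteq> 0" "w \<noteq> 0" "w' \<noteq> 0"
    using assms(1,2) fifth_power_plus_8_nonzero[of u] fifth_power_plus_8_nonzero[of u']
    by (simp_all add: v_def v'_def w)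
  have "(64 ^ 2 * 15728640 * v ^ 2 * v' ^ 2 * w ^ 2 * w' ^ 2) *
      (ipoly a8 v ^ 2 * v' * w' ^ 3 * ipoly x11 v') =
      (64 ^ 2 * 15728640 * v ^ 2 * v' ^ 2 * w ^ 2 * w' ^ 2) *
      (ipoly a8 v' ^ 2 * v * w ^ 3 * ipoly x11 v)"
    using eq[folded w] by (simp add: power_mult_distrib eval_nat_numeral mult_ac)
  then show ?thesis using nz by (simp add: w)
qed


text \<open>The constant terms of \<open>a8\<close> and \<open>x11\<close> are powers of 2 up to
  sign, and \<open>v + 8\<close> is congruent to 8 modulo 11. Hence all factors except
  \<open>v\<close> and \<open>v'\<close> are prime to 11, and the two sides have different
  valuations.\<close>

lemma absolute_invariant_powers_of_11:
  assumes "i < j"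
    and eq: "ipoly a8 v ^ 2 * v' * (v' + 8) ^ 3 * ipoly x11 v' = ipoly a8 v' ^ 2 * v * (v + 8) ^ 3 * ipoly x11 v"
    and v: "v = (11 ^ Suc i) ^ 5" "v' = ((11::rat) ^ Suc j) ^ 5"
  shows False
proof -
  define V V' :: int where V: "V = (11 ^ Suc i) ^ 5" "V' = (11 ^ Suc j) ^ 5"
  have vV: "v = of_int V" "v' = of_int V'" by (simp_all add: v V)
  have "rat_of_int (poly a8 V ^ 2 * V' * (V' + 8) ^ 3 * poly x11 V') =
      of_int (poly a8 V' ^ 2 * V * (V + 8) ^ 3 * poly x11 V)"
    using eq unfolding vV ipoly_of_int by simp
  then have int_eq: "poly a8 V ^ 2 * V' * (V' + 8) ^ 3 * poly x11 V' = poly a8 V' ^ 2 * V * (V + 8) ^ 3 * poly x11 V"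
    by (simp only: of_int_eq_iff)
  obtain k where k: "j = i + Suc k" using assms(1) less_iff_Suc_add by auto
  \<comment> \<open>One split-off factor 11 is enough for the contradiction; the exponent
    \<open>k + 4 * Suc k\<close> completes \<open>5 * Suc k\<close>.\<close>
  have V': "V' = V * (11 * (11 ^ k * 11 ^ (4 * Suc k)))"
    unfolding V k by (simp add: power_mult[symmetric] power_add[symmetric] algebra_simps flip: power_Suc)
  have V0: "V \<noteq> 0" by (simp add: V)
  have "V * (11 * (poly a8 V ^ 2 * (11 ^ k * 11 ^ (4 * Suc k)) * (V' + 8) ^ 3 * poly x11 V')) =
      V * (poly a8 V' ^ 2 * (V + 8) ^ 3 * poly x11 V)"
  proof -
    have "V * (11 * (poly a8 V ^ 2 * (11 ^ k * 11 ^ (4 * Suc k)) * (V' + 8) ^ 3 * poly x11 V')) =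
        poly a8 V ^ 2 * (V * (11 * (11 ^ k * 11 ^ (4 * Suc k)))) * (V' + 8) ^ 3 * poly x11 V'"
      by (simp only: mult_ac)
    also have "\<dots> = poly a8 V' ^ 2 * V * (V + 8) ^ 3 * poly x11 V" unfolding V'[symmetric] by (rule int_eq)
    finally show ?thesis by (simp only: mult_ac)
  qed
  then have "11 dvd poly a8 V' ^ 2 * (V + 8) ^ 3 * poly x11 V" using V0 by (metis dvd_triv_left mult_cancel_left)
  moreover have prime: "prime (11::int)" by simp
  ultimately have cases: "11 dvd poly a8 V' \<or> 11 dvd V + 8 \<or> 11 dvd poly x11 V"
    using prime_dvd_power[OF prime] prime_dvd_mult_iff[OF prime] by blast
  have dvd: "11 dvd V" "11 dvd V'" by (simp_all add: V dvd_power)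
  have "\<And>p x. \<not> 11 dvd poly p 0 \<Longrightarrow> 11 dvd x \<Longrightarrow> \<not> 11 dvd poly p (x::int)"
  proof
    fix p and x :: int
    assume p: "\<not> 11 dvd poly p 0" and x: "11 dvd x" and "11 dvd poly p x"
    then show False by (cases p) (auto simp: dvd_add_left_iff)
  qed
  moreover have "\<not> 11 dvd poly a8 0" "\<not> 11 dvd poly x11 0" by (simp_all add: a8_def x11_def)
  ultimately have "\<not> 11 dvd poly a8 V'" "\<not> 11 dvd poly x11 V" using dvd by blast+
  moreover have "\<not> 11 dvd V + 8" using dvd(1) by presburger
  ultimately show False using cases by blast
qed

lemma F_curve_form: "F_curve t = specialize F_form (to_ac t)"
  by (simp add: F_curve_def f_poly_def F_form_def specialize_def map_poly_pCons power2_eq_square algebra_simps)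

lemma F_curve_even: "even_curve (F_curve t) 3"
proof -
  have "degree (F_curve t) = 6" "coeff (F_curve t) 6 = 1"
    unfolding F_curve_def f_poly_def by (rule map_poly_monic_sextic)+
  then show ?thesis by unfold_locales simp_all
qed

text \<open>At \<open>t = 0\<close> the sextic has the double root 0. This value is treated apart
  because \<open>t^2\<close> has to be cancelled from the second relation of invariants.\<close>

lemma card_roots_F_curve_0: "card {r. poly (F_curve 0) r = 0} < 6"
proof -
  let ?q = "[:1, 2, 3, 2, 1:] :: rat alg_closure poly"
  have eq: "F_curve 0 = [:0, 1:] * ([:0, 1:] * ?q)"
    by (simp add: F_curve_def f_poly_def map_poly_pCons)
  have "{r. poly (F_curve 0) r = 0} \<subseteq> insert 0 {r. poly ?q r = 0}"
    unfolding eq poly_mult by auto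
  moreover have "finite {r. poly ?q r = 0}" "card {r. poly ?q r = 0} \<le> 4"
    using poly_roots_finite[of ?q] card_poly_roots_bound[of ?q] by simp_all
  ultimately have "card {r. poly (F_curve 0) r = 0} \<le> Suc 4"
    using card_mono[of "insert 0 {r. poly ?q r = 0}" "{r. poly (F_curve 0) r = 0}"]
    by (auto simp: card_insert_if split: if_splits)
  then show ?thesis by simp
qed

lemma G_curve_not_F_curve:
  assumes u: "u \<noteq> 0"
  shows "\<not> isomorphic_curves (G_curve u) (F_curve t)"
proof
  assume iso: "isomorphic_curves (G_curve u) (F_curve t)"
  have inv: "same_invariants (G_curve u) (F_curve t)" and card: "card {r. poly (F_curve t) r = 0} = 6"
    using isomorphic_curves_invariants[OF G_curve_smooth[OF u] F_curve_even iso] by auto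
  have t: "t \<noteq> 0" using card card_roots_F_curve_0 by auto
  define v where "v = u ^ 5"
  have "same_invariants (specialize H_form (to_ac v)) (specialize F_form (to_ac t))"
    using same_invariants_trans[OF G_curve_invariants[OF u] inv] unfolding v_def F_curve_form .
  note abs = same_invariants_absolute[OF this]
  from abs(1) have "ipoly (inv2 H_form) v ^ 2 * ipoly (sub4 F_form) t = ipoly (inv2 F_form) t ^ 2 * ipoly (sub4 H_form) v"
    unfolding invariants_specialize ipoly_to_ac to_ac_power[symmetric] to_ac_mult[symmetric] by (rule to_ac_injD)
  then have 1: "(64 * (v * (v + 8) * ipoly a8 v)) ^ 2 * (1920 * (t * ipoly q3 t)) =
      (4 * ipoly a3 t) ^ 2 * (15728640 * (v ^ 3 * (v + 8) ^ 5 * ipoly x11 v))"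
    by (simp only: absolute_H_form absolute_F_form ipoly_smult ipoly_simps(2) ipoly_power ipoly_linear of_int_numeral)
  from abs(2) have "ipoly (sub8 H_form) v * ipoly (sub4 F_form) t ^ 2 = ipoly (sub8 F_form) t * ipoly (sub4 H_form) v ^ 2"
    unfolding invariants_specialize ipoly_to_ac to_ac_power[symmetric] to_ac_mult[symmetric] by (rule to_ac_injD)
  then have 2: "47498902319923200 * (v ^ 7 * (v + 8) ^ 9 * ipoly y21 v) * (1920 * (t * ipoly q3 t)) ^ 2 =
      44236800 * (t ^ 2 * ipoly q7 t) * (15728640 * (v ^ 3 * (v + 8) ^ 5 * ipoly x11 v)) ^ 2"
    by (simp only: absolute_H_form absolute_F_form ipoly_smult ipoly_simps(2) ipoly_power ipoly_linear of_int_numeral)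
  define w where "w = v + 8"
  have nz: "v \<noteq> 0" "w \<noteq> 0"
    using u fifth_power_plus_8_nonzero[of u] by (simp_all add: v_def w_def)
  \<comment> \<open>The common constant is \<open>64^2 * 1920\<close>; the other side has
    \<open>16 * 15728640\<close>, which is 32 times as large.\<close>
  have "(7864320 * v ^ 2 * w ^ 2) * (32 * v * w ^ 3 * ipoly a3 t ^ 2 * ipoly x11 v) =
      (7864320 * v ^ 2 * w ^ 2) * (ipoly a8 v ^ 2 * t * ipoly q3 t)"
    using 1[folded w_def, symmetric] by (simp add: power_mult_distrib eval_nat_numeral mult_ac)
  then have E1: "32 * v * w ^ 3 * ipoly a3 t ^ 2 * ipoly x11 v = ipoly a8 v ^ 2 * t * ipoly q3 t"
    by (rule mult_left_cancel[THEN iffD1, rotated]) (use nz in simp)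
  \<comment> \<open>The remaining coefficient 16 is the quotient of
    \<open>47498902319923200 * 1920^2\<close> by \<open>44236800 * 15728640^2\<close>.\<close>
  have "(44236800 * 15728640 ^ 2 * v ^ 6 * w ^ 9 * t ^ 2) * (16 * v * ipoly y21 v * ipoly q3 t ^ 2) =
      (44236800 * 15728640 ^ 2 * v ^ 6 * w ^ 9 * t ^ 2) * (w * ipoly q7 t * ipoly x11 v ^ 2)"
    using 2[folded w_def] by (simp add: power_mult_distrib eval_nat_numeral mult_ac)
  then have E2: "16 * v * ipoly y21 v * ipoly q3 t ^ 2 = w * ipoly q7 t * ipoly x11 v ^ 2"
    using nz t by simp
  show False by (rule no_rational_solution[OF E1[unfolded w_def v_def] E2[unfolded w_def v_def]])
qed

theorem theorem1:
  shows "(\<forall>u::rat. u \<noteq> 0 \<longrightarrow>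
            group.ord (jacobian (G_curve u)) (divisor_class (G_curve u) divisor_at_infinity) = 11) \<and>
         (\<exists>S::rat set. S \<subseteq> {u. u \<noteq> 0} \<and> infinite S \<and>
            pairwise (\<lambda>u v. \<not> isomorphic_curves (G_curve u) (G_curve v)) S) \<and>
         (\<forall>u t::rat. u \<noteq> 0 \<longrightarrow> \<not> isomorphic_curves (G_curve u) (F_curve t))"
proof (intro conjI exI allI impI)
  show "group.ord (jacobian (G_curve u)) (divisor_class (G_curve u) divisor_at_infinity) = 11"
    if "u \<noteq> 0" for u
    using that by (rule G_curve_order)
  show "\<not> isomorphic_curves (G_curve u) (F_curve t)" if "u \<noteq> 0" for u t
    using that by (rule G_curve_not_F_curve)
  let ?S = "range (\<lambda>i. 11 ^ Suc i :: rat)"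
  show "?S \<subseteq> {u. u \<noteq> 0}" by auto
  have "inj (\<lambda>i. 11 ^ Suc i :: rat)" by (rule injI) simp
  then show "infinite ?S" by (rule range_inj_infinite)
  show "pairwise (\<lambda>u v. \<not> isomorphic_curves (G_curve u) (G_curve v)) ?S"
  proof (rule pairwiseI, rule notI)
    fix u v assume "u \<in> ?S" "v \<in> ?S" "u \<noteq> v" and iso: "isomorphic_curves (G_curve u) (G_curve v)"
    then obtain i j where ij: "u = 11 ^ Suc i" "v = 11 ^ Suc j" "i < j \<or> j < i"
      by (auto simp: neq_iff)
    then have "u \<noteq> 0" "v \<noteq> 0" by auto
    note eq = G_curves_isomorphic_imp[OF this iso]
    from ij(3) show False
    proof
      assume "i < j"
      then show False by (rule absolute_invariant_powers_of_11[OF _ eq]) (simp_all only: ij)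
    next
      assume "j < i"
      then show False by (rule absolute_invariant_powers_of_11[OF _ eq[symmetric]]) (simp_all only: ij)
    qed
  qed
qed

end
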